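(* Let $P$ be an unknown distribution and $Q$ a known distribution, both over $\mathbb{Z}$. Let $\varepsilon,\eta\in(0,1)$ with $\eta>\varepsilon$ be accuracy parameters and $\delta\in(0,1)$ a confidence parameter. Then there are two randomized algorithms, $\mathsf{toltest}$ and $\mathsf{ERtoltest}$, which access $P$ only through the interval conditioning oracle $\mathsf{ICOND}(P)$ and satisfy the following. (1) $\mathsf{toltest}$ distinguishes between the cases $d_{TV}(P,Q)\le\varepsilon$ and $d_{TV}(P,Q)\ge\eta$ with probability at least $1-\delta$: it outputs Accept in the first case and Reject in the second case, each with probability at least $1-\delta$. Its expected number of $\mathsf{ICOND}$ queries is $$\widetilde{O}\left(\frac{1}{(\eta-\varepsilon)^4}\,\mathbb{E}_{x\sim P\diamond Q}\left[\mathrm{tilt}_{P\diamond Q}(x)\cdot\log^2\frac{1}{P\diamond Q(x)}\right]\right),$$ where $P\diamond Q$ is the distribution $P\diamond Q(x)=(P(x)+Q(x))/2$. (2) $\mathsf{ERtoltest}$ distinguishes between the cases $\ell_\infty(P,Q)\le 2\varepsilon$ and $d_{TV}(P,Q)\ge\eta$ with probability at least $1-\delta$ (Accept in the first case, Reject in the second). Its expected number of oracle queries is at most $$\widetilde{O}\left(\frac{1}{(\eta-\varepsilon)^4}\,\mathbb{E}_{x\sim P}\left[\mathrm{tilt}_Q(x)\cdot K(x)\right]\right),\qquad K(x)=\min\left(\log^2\frac{1}{P(x)},\ \log^2\frac{1}{Q(x)}\right).$$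
   Context: Distributions over $\mathbb{Z}$ are probability mass functions on $\mathbb{Z}$; for integers $a\le b$, $[a,b]=\{a,a+1,\dots,b\}$ and $P([a,b])=\sum_{t=a}^b P(t)$. The known distribution $Q$ can be evaluated at any point ($Q(x)$ is available) and sampled from. The interval conditioning oracle $\mathsf{ICOND}(P)$ takes an interval $[i,j]$ of integers (with $P([i,j])>0$) and returns an independent sample from $P$ conditioned on lying in $[i,j]$. Distances: $d_{TV}(P,Q)=\frac12\sum_x|P(x)-Q(x)|$ and $\ell_\infty(P,Q)=\max_x|P(x)/Q(x)-1|$. For a distribution $P$ and $x$ with $P(x)>0$, $\mathrm{tilt}_P(x)=\max\{\max_{y<x}\frac{P(y)}{P([y+1,x])},\ \max_{y>x}\frac{P(y)}{P([x,y-1])}\}$. Logarithms are natural. $\widetilde{O}(\cdot)$ is big-O notation suppressing polylogarithmic factors in the parameters.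
   Formalization: Each expectation in the query bounds is replaced by max(1, expectation), since for point masses it is 0 though queries are needed; and ICOND may also be asked the whole line ℤ (a plain sample of P), since bounded intervals cannot detect mass placed far away. *)

theory Defs
  imports "HOL-Probability.Probability"
begin

definition mix :: "int pmf \<Rightarrow> int pmf \<Rightarrow> int pmf" (infixl "\<diamondop>" 70) where
  "P \<diamondop> Q = embed_pmf (\<lambda>x. (pmf P x + pmf Q x) / 2)"

lemma pmf_mix: "pmf (P \<diamondop> Q) x = (pmf P x + pmf Q x) / 2"
  unfolding mix_def
proof (rule pmf_embed_pmf)
  have "(\<integral>\<^sup>+ x. ennreal ((pmf P x + pmf Q x) / 2) \<partial>count_space UNIV)
      = (\<integral>\<^sup>+ x. ennreal (1 / 2) * ennreal (pmf P x) + ennreal (1 / 2) * ennreal (pmf Q x)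
          \<partial>count_space UNIV)"
    by (intro nn_integral_cong, subst (1 2) ennreal_mult [symmetric])
       (simp_all add: add_divide_distrib flip: ennreal_plus)
  also have "\<dots> = ennreal (1 / 2) + ennreal (1 / 2)"
    by (simp add: nn_integral_cmult nn_integral_add nn_integral_pmf)
  also have "\<dots> = 1"
    by (subst ennreal_plus [symmetric]) simp_all
  finally show "(\<integral>\<^sup>+ x. ennreal ((pmf P x + pmf Q x) / 2) \<partial>count_space UNIV) = 1" .
qed simp

definition tv_dist :: "int pmf \<Rightarrow> int pmf \<Rightarrow> real" where
  "tv_dist P Q = (1 / 2) * (\<Sum>\<^sub>\<infinity>x. \<bar>pmf P x - pmf Q x\<bar>)"

(* P(x) / Q(x) is read as 1 where both masses vanish and as infinite where only Q(x) vanishes. *)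
definition linf_dist :: "int pmf \<Rightarrow> int pmf \<Rightarrow> ennreal" where
  "linf_dist P Q =
     (SUP x. if pmf Q x > 0 then ennreal \<bar>pmf P x / pmf Q x - 1\<bar>
             else if pmf P x > 0 then \<infinity> else 0)"

(* In ennreal, 0 / 0 = 0 and c / 0 = \<infinity> for c > 0. Where P(x) > 0 no denominator vanishes;
   where P(x) = 0 the value is \<infinity>, because of the point of the support nearest to x. *)
definition tilt :: "int pmf \<Rightarrow> int \<Rightarrow> ennreal" where
  "tilt P x =
     max (SUP y\<in>{..<x}. ennreal (pmf P y) / ennreal (measure_pmf.prob P {y + 1..x}))
         (SUP y\<in>{x<..}. ennreal (pmf P y) / ennreal (measure_pmf.prob P {x..y - 1}))"

(* The case distinction is needed because ln (1 / 0) = 0 in HOL. *)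
definition sq_log_inv :: "real \<Rightarrow> ennreal" where
  "sq_log_inv p = (if p = 0 then \<infinity> else ennreal ((ln (1 / p))\<^sup>2))"


datatype verdict = Accept | Reject

(* Draw D is internal randomness, for instance a coin flip or a sample of the known distribution;
   Icond S is a query to the interval conditioning oracle. *)
datatype action = Output verdict | Draw "int pmf" | Icond "int set"

(* A randomized algorithm determines its next action from all the values (internal draws and
   oracle answers) that it has received so far. The queries themselves need not be recorded,
   since they can be recomputed from these values. *)
type_synonym algorithm = "int list \<Rightarrow> action"

fun step :: "int pmf \<Rightarrow> algorithm \<Rightarrow> int list \<Rightarrow> int list pmf" where
  "step P A h =
     (case A h of
        Output v \<Rightarrow> return_pmf h
      | Draw D \<Rightarrow> map_pmf (\<lambda>y. h @ [y]) D
      | Icond S \<Rightarrow> map_pmf (\<lambda>y. h @ [y]) (cond_pmf P S))"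

primrec run :: "int pmf \<Rightarrow> algorithm \<Rightarrow> nat \<Rightarrow> int list pmf" where
  "run P A 0 = return_pmf []"
| "run P A (Suc n) = bind_pmf (run P A n) (step P A)"

(* The whole line counts as an interval: conditioning on it is sampling from P. *)
definition legal_query :: "int pmf \<Rightarrow> int set \<Rightarrow> bool" where
  "legal_query P S \<longleftrightarrow>
     (S = UNIV \<or> (\<exists>i j. i \<le> j \<and> S = {i..j})) \<and> measure_pmf.prob P S > 0"

definition only_legal_queries :: "int pmf \<Rightarrow> algorithm \<Rightarrow> bool" where
  "only_legal_queries P A \<longleftrightarrow>
     (\<forall>n. \<forall>h\<in>set_pmf (run P A n). \<forall>S. A h = Icond S \<longrightarrow> legal_query P S)"

(* The events below increase with n, since a run stays put once it has an output. *)
definition prob_output :: "int pmf \<Rightarrow> algorithm \<Rightarrow> verdict \<Rightarrow> real" where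
  "prob_output P A v = (SUP n. measure_pmf.prob (run P A n) {h. A h = Output v})"

definition num_queries :: "algorithm \<Rightarrow> int list \<Rightarrow> nat" where
  "num_queries A h = card {m. m < length h \<and> (\<exists>S. A (take m h) = Icond S)}"

definition expected_queries :: "int pmf \<Rightarrow> algorithm \<Rightarrow> ennreal" where
  "expected_queries P A =
     (SUP n. \<integral>\<^sup>+ h. of_nat (num_queries A h) \<partial>measure_pmf (run P A n))"


(* The bound C X log^k (X + 1/\<delta>), with e added inside the logarithm to keep it at least 1.
   For X = \<infinity> (where enn2real X = 0) and C > 0 its value is \<infinity>.
   Big-O presupposes a quantity bounded away from 0, so it has to be used with the truncation
   max 1 of an expectation: the expected product of tilt and squared logarithm vanishes if the
   distribution is a point mass, while some queries are necessary even then. *)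
definition soft_O :: "real \<Rightarrow> nat \<Rightarrow> real \<Rightarrow> ennreal \<Rightarrow> ennreal" where
  "soft_O C k \<delta> X = ennreal (C * (ln (exp 1 + enn2real X + 1 / \<delta>)) ^ k) * X"

end

theory Submission
  imports Defs
begin

text \<open>
  Both parts are served by one estimator of the total variation distance; for the second part,
  \<open>\<ell>\<^sub>\<infinity>(P, Q) \<le> 2\<epsilon>\<close> implies \<open>d\<^sub>T\<^sub>V(P, Q) \<le> \<epsilon>\<close>. It rests on
  \<open>d\<^sub>T\<^sub>V(P, Q) = E\<^bsub>x\<sim>P\<^esub> max 0 (1 - Q(x)/P(x))\<close>. The known \<open>Q\<close> determines a binary tree of
  intervals in which \<open>x\<close> has depth about \<open>log (1/Q(x))\<close>. For a sample \<open>x\<close> of \<open>P\<close> one walks down the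
  tree to \<open>x\<close> and estimates \<open>Q(x)/P(x)\<close> as the product over the levels \<open>k\<close> of
  \<open>Q(child | node) (N + 1)/(c + 1)\<close>, where \<open>c\<close> of \<open>N\<close> conditional samples fall into the child and
  \<open>N\<close> is proportional to \<open>k + 1\<close>. Given \<open>x\<close>, one level contributes a relative variance of about
  \<open>1/(N p)\<close> with \<open>p = P(child | node)\<close>; averaging over \<open>x \<sim> P\<close> turns \<open>1/p\<close> into the number of
  children, so the mean square error is governed by the harmonic sum of \<open>1/N\<close>. The walk stops as
  soon as the product is small, which happens at depth about \<open>log (1/P(x))\<close>.

  The points of tilt at most \<open>\<tau>\<close> have \<open>Q\<close>-mass about \<open>\<tau>\<close>, so that less precision is needed on
  them: \<open>N\<close> can be scaled by \<open>min 1 (tilt\<^sub>Q x)\<close>, up to classes of dyadic tilt. The cost of a sample is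
  thus about \<open>min 1 (tilt\<^sub>Q x) K(x)\<close>. Part (1) needs no tilt: \<open>K(x)\<close> is at most the squared logarithm
  for \<open>R = P \<diamondop> Q\<close>, and a point of tilt below \<open>1\<close> is dominated by its neighbour in the support.

  As the harmonic sum grows with the depth, the depth is cut off at \<open>2\<^sup>j\<close> in stage \<open>j\<close>. Walks cut
  off are left undecided; the tester answers when they cannot matter and otherwise goes to the next
  stage. That happens with probability at most \<open>2 C\<^sub>j / 4\<^sup>j\<close>, where \<open>C\<^sub>j\<close> is the expected cost of
  stage \<open>j\<close>.
\<close>

text \<open>No accuracy for every single x is within reach: about k + 1 samples at level k say
  little about a child of small conditional mass. All errors are therefore bounded on average over
  x, where a child is visited in proportion to its mass. The estimate (N + 1)/(c + 1) of 1/p is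
  always positive and finite, and its mean is exactly (1 - (1 - p)^(N+1))/p. Taking N proportional
  to k + 1 makes the cost of a walk quadratic in its depth, as the squared logarithm permits, while
  the sum of 1/N up to depth 2^j grows only like j. The gain from low tilt comes from the factor min
  1 (Q(x)/P(x)): the squared error of max 0 (1 - v) is at most this factor times the squared
  relative error of v. By AM-GM with weight c the error splits into c/2 times the factor, whose
  P-average is at most c/2 times the Q-mass of the class, and the squared relative error divided by
  2c. In a class of mass about 2^-i, c and hence the mean square error may be larger by 2^i. The
  same factor multiplies the error of early stops and turns their P-average into a Q-average, in
  which the denominators Q(child | node) cancel level by level.\<close>

abbreviation expect :: "'a pmf \<Rightarrow> ('a \<Rightarrow> real) \<Rightarrow> real" where
  "expect p \<equiv> measure_pmf.expectation p"

abbreviation mass :: "'a pmf \<Rightarrow> 'a set \<Rightarrow> real" where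
  "mass p \<equiv> measure_pmf.prob p"

section \<open>Query programs\<close>

text \<open>Well-founded trees: every run ends, but because of the infinite branching there need not
  be a common bound on its length. The only randomness is that of the oracle answers; a sample of P
  itself is a query to the whole line.\<close>

datatype 'a prog = Ret 'a | Query "int set" "int \<Rightarrow> 'a prog"

primrec bind_prog :: "'a prog \<Rightarrow> ('a \<Rightarrow> 'b prog) \<Rightarrow> 'b prog" where
  "bind_prog (Ret a) f = f a"
| "bind_prog (Query S c) f = Query S (\<lambda>y. bind_prog (c y) f)"

primrec sem :: "int pmf \<Rightarrow> 'a prog \<Rightarrow> 'a pmf" where
  "sem P (Ret a) = return_pmf a"
| "sem P (Query S c) = bind_pmf (cond_pmf P S) (\<lambda>y. sem P (c y))"

primrec cost :: "int pmf \<Rightarrow> 'a prog \<Rightarrow> ennreal" where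
  "cost P (Ret a) = 0"
| "cost P (Query S c) = 1 + (\<integral>\<^sup>+ y. cost P (c y) \<partial>(cond_pmf P S))"

primrec legal :: "int pmf \<Rightarrow> 'a prog \<Rightarrow> bool" where
  "legal P (Ret a) \<longleftrightarrow> True"
| "legal P (Query S c) \<longleftrightarrow> legal_query P S \<and> (\<forall>y\<in>set_pmf (cond_pmf P S). legal P (c y))"

lemma sem_bind: "sem P (bind_prog t f) = bind_pmf (sem P t) (\<lambda>a. sem P (f a))"
  by (induction t) (simp_all add: bind_return_pmf bind_assoc_pmf)

lemma cost_bind:
  "cost P (bind_prog t f) = cost P t + (\<integral>\<^sup>+ a. cost P (f a) \<partial>(sem P t))"
  by (induction t) (simp_all add: nn_integral_add add.assoc)

lemma legal_bind:
  "legal P (bind_prog t f) \<longleftrightarrow> legal P t \<and> (\<forall>a\<in>set_pmf (sem P t). legal P (f a))"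
  by (induction t) auto

primrec residual :: "int list \<Rightarrow> 'a prog \<Rightarrow> 'a prog" where
  "residual [] t = t"
| "residual (y # h) t = (case t of Ret a \<Rightarrow> Ret a | Query S c \<Rightarrow> residual h (c y))"

primrec next_action :: "verdict prog \<Rightarrow> action" where
  "next_action (Ret v) = Output v"
| "next_action (Query S c) = Icond S"

text \<open>An \<open>algorithm\<close> sees only the list of answers, so it replays them through
  the program and performs the action at the top of what remains.\<close>

definition alg :: "verdict prog \<Rightarrow> algorithm" where
  "alg t h = next_action (residual h t)"

text \<open>The same transcripts as \<^const>\<open>run\<close>, but recursing on the program instead of extending
  histories at the end.\<close>

primrec transcript :: "int pmf \<Rightarrow> nat \<Rightarrow> 'a prog \<Rightarrow> int list pmf" where
  "transcript P 0 t = return_pmf []"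
| "transcript P (Suc n) t = (case t of Ret a \<Rightarrow> return_pmf []
     | Query S c \<Rightarrow> bind_pmf (cond_pmf P S) (\<lambda>y. map_pmf ((#) y) (transcript P n (c y))))"

lemma residual_Ret [simp]: "residual h (Ret a) = Ret a"
  by (induction h) auto

lemma alg_simps [simp]:
  "alg (Ret v) h = Output v" "alg (Query S c) [] = Icond S" "alg (Query S c) (y # h) = alg (c y) h"
  by (simp_all add: alg_def)

lemma transcript_Ret [simp]: "transcript P n (Ret a) = return_pmf []"
  by (cases n) auto

lemma step_alg_Cons:
  "step P (alg (Query S c)) (y # h) = map_pmf ((#) y) (step P (alg (c y)) h)"
  by (auto simp: pmf.map_comp o_def split: action.splits)

declare step.simps [simp del]

text \<open>\<open>run\<close> appends answers at the end of a history, whereas recursion on a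
  program prepends them. The two orders are reconciled once here, so that later inductions can
  follow the program.\<close>

lemma transcript_Suc:
  "transcript P (Suc n) t = bind_pmf (transcript P n t) (step P (alg t))"
proof (induction n arbitrary: t)
  case 0
  show ?case
    by (cases t) (simp_all add: bind_return_pmf step.simps map_pmf_def)
next
  case (Suc n)
  show ?case
  proof (cases t)
    case (Ret a)
    then show ?thesis by (simp add: bind_return_pmf step.simps)
  next
    case (Query S c)
    have "transcript P (Suc (Suc n)) t = bind_pmf (cond_pmf P S)
        (\<lambda>y. map_pmf ((#) y) (bind_pmf (transcript P n (c y)) (step P (alg (c y)))))"
      using Query Suc.IH by (simp del: transcript.simps add: transcript.simps(2)[of P "Suc n"])
    also have "\<dots> = bind_pmf (transcript P (Suc n) t) (step P (alg t))"
      using Query by (simp add: map_bind_pmf bind_map_pmf bind_assoc_pmf step_alg_Cons)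
    finally show ?thesis .
  qed
qed

lemma run_alg: "run P (alg t) n = transcript P n t"
  by (induction n) (simp_all del: transcript.simps(2) add: transcript_Suc)

lemma num_queries_Ret [simp]: "num_queries (alg (Ret v)) h = 0"
  by (simp add: num_queries_def)

lemma num_queries_Nil [simp]: "num_queries A [] = 0"
  by (simp add: num_queries_def)

lemma num_queries_Cons:
  "num_queries (alg (Query S c)) (y # h) = Suc (num_queries (alg (c y)) h)"
proof -
  let ?M = "{m. m < length h \<and> (\<exists>S. alg (c y) (take m h) = Icond S)}"
  have "{m. m < length (y # h) \<and> (\<exists>S'. alg (Query S c) (take m (y # h)) = Icond S')}
      = insert 0 (Suc ` ?M)"
  proof (rule set_eqI)
    fix m
    show "m \<in> {m. m < length (y # h) \<and> (\<exists>S'. alg (Query S c) (take m (y # h)) = Icond S')}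
      \<longleftrightarrow> m \<in> insert 0 (Suc ` ?M)"
      by (cases m) auto
  qed
  moreover have "finite ?M"
    by simp
  ultimately show ?thesis
    by (simp add: num_queries_def card_image)
qed

text \<open>A history cut off after n steps contains no more queries than the full run; the bound is
  uniform in n and passes to the supremum.\<close>

lemma expected_queries_alg: "expected_queries P (alg t) \<le> cost P t"
proof -
  have "(\<integral>\<^sup>+ h. of_nat (num_queries (alg t) h) \<partial>(transcript P n t)) \<le> cost P t" for n
  proof (induction n arbitrary: t)
    case (Suc n)
    show ?case
    proof (cases t)
      case (Query S c)
      have "(\<integral>\<^sup>+ h. of_nat (num_queries (alg t) h) \<partial>(transcript P (Suc n) t))
        = (\<integral>\<^sup>+ y. 1 + (\<integral>\<^sup>+ h. of_nat (num_queries (alg (c y)) h) \<partial>(transcript P n (c y)))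
            \<partial>(cond_pmf P S))"
        using Query by (simp add: num_queries_Cons nn_integral_add)
      also have "\<dots> \<le> (\<integral>\<^sup>+ y. 1 + cost P (c y) \<partial>(cond_pmf P S))"
        by (intro nn_integral_mono add_left_mono Suc.IH)
      also have "\<dots> = cost P t"
        using Query by (simp add: nn_integral_add)
      finally show ?thesis .
    qed auto
  qed auto
  then show ?thesis
    unfolding expected_queries_def run_alg by (intro SUP_least)
qed

lemma only_legal_queries_alg:
  assumes "legal P t"
  shows "only_legal_queries P (alg t)"
proof -
  have "legal_query P S"
    if "legal P t" "h \<in> set_pmf (transcript P n t)" "alg t h = Icond S" for n h S and t :: "verdict prog"
    using that
  proof (induction n arbitrary: t h)
    case (0 t)
    then show ?case by (cases t) auto
  next
    case (Suc n t)
    show ?case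
    proof (cases t)
      case (Query S' c)
      then show ?thesis using Suc by auto
    qed (use Suc in auto)
  qed
  with assms show ?thesis
    unfolding only_legal_queries_def run_alg by blast
qed

text \<open>Runs may be unboundedly long, so no single n suffices. Monotone convergence moves the
  supremum over n through the integral over the answer to each \<open>Query\<close>.\<close>

lemma prob_output_alg: "prob_output P (alg t) v \<ge> mass (sem P t) {v}"
proof -
  define E where "E n t = emeasure (measure_pmf (transcript P n t)) {h. alg t h = Output v}" for n t
  have E_Ret: "E n (Ret w) = indicator {v} w" for n w
    by (auto simp: E_def indicator_def)
  have E_Query: "E (Suc n) (Query S c) = (\<integral>\<^sup>+ y. E n (c y) \<partial>(cond_pmf P S))" for n S c
    by (auto simp: E_def vimage_def intro!: nn_integral_cong)
  have E_0: "E 0 (Query S c) = 0" for S c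
    by (simp add: E_def)
  have E_mono: "E n t \<le> E (Suc n) t" for n t
  proof (induction n arbitrary: t)
    case 0
    show ?case by (cases t) (simp_all add: E_Ret E_0)
  next
    case (Suc n)
    show ?case
      by (cases t) (simp_all add: E_Ret E_Query nn_integral_mono Suc)
  qed
  have "emeasure (measure_pmf (sem P t)) {v} \<le> (SUP n. E n t)"
  proof (induction t)
    case (Ret w)
    show ?case by (auto simp: E_Ret indicator_def)
  next
    case (Query S c)
    have "emeasure (measure_pmf (sem P (Query S c))) {v}
        \<le> (\<integral>\<^sup>+ y. (SUP n. E n (c y)) \<partial>(cond_pmf P S))"
      using Query by (auto intro!: nn_integral_mono)
    also have "\<dots> = (SUP n. \<integral>\<^sup>+ y. E n (c y) \<partial>(cond_pmf P S))"
      by (intro nn_integral_monotone_convergence_SUP) (auto intro!: incseq_SucI le_funI E_mono)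
    also have "\<dots> = (SUP n. E (Suc n) (Query S c))"
      by (simp add: E_Query)
    also have "\<dots> \<le> (SUP n. E n (Query S c))"
      by (intro SUP_mono) auto
    finally show ?case .
  qed
  also have "(SUP n. E n t) \<le> ennreal (prob_output P (alg t) v)"
  proof (intro SUP_least)
    fix n
    have "mass (run P (alg t) n) {h. alg t h = Output v} \<le> prob_output P (alg t) v"
      unfolding prob_output_def by (intro cSUP_upper bdd_aboveI2[where M = 1]) auto
    then show "E n t \<le> ennreal (prob_output P (alg t) v)"
      by (simp add: E_def run_alg measure_pmf.emeasure_eq_measure ennreal_leI)
  qed
  finally have "ennreal (mass (sem P t) {v}) \<le> ennreal (prob_output P (alg t) v)"
    by (simp add: measure_pmf.emeasure_eq_measure)
  moreover have "0 \<le> prob_output P (alg t) v"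
  proof -
    have "0 \<le> mass (run P (alg t) 0) {h. alg t h = Output v}" by simp
    also have "\<dots> \<le> prob_output P (alg t) v"
      unfolding prob_output_def by (intro cSUP_upper bdd_aboveI2[where M = 1]) auto
    finally show ?thesis .
  qed
  ultimately show ?thesis
    by simp
qed

primrec count_hits :: "int set \<Rightarrow> int set \<Rightarrow> nat \<Rightarrow> nat prog" where
  "count_hits S T 0 = Ret 0"
| "count_hits S T (Suc N) =
     Query S (\<lambda>y. bind_prog (count_hits S T N) (\<lambda>c. Ret (if y \<in> T then Suc c else c)))"

lemma prob_ratio_bounds:
  assumes "T \<subseteq> S"
  shows "mass P T / mass P S \<in> {0..1}"
  using measure_pmf.finite_measure_mono[OF assms, of P] by (auto simp: divide_le_eq_1 less_le)

lemma cond_pmf_hit: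
  assumes "T \<subseteq> S" "mass P S > 0"
  shows "map_pmf (\<lambda>y. y \<in> T) (cond_pmf P S)
    = bernoulli_pmf (mass P T / mass P S)"
proof (rule pmf_eqI)
  have S_pos: "emeasure (measure_pmf P) S \<noteq> 0"
    using assms(2) by (simp add: measure_pmf.emeasure_eq_measure)
  have ne: "set_pmf P \<inter> S \<noteq> {}"
    using assms(2) by (metis less_irrefl measure_Int_set_pmf measure_empty inf_commute)
  define p where "p = mass P T / mass P S"
  have p: "0 \<le> p" "p \<le> 1"
    using prob_ratio_bounds[OF assms(1), of P] by (auto simp: p_def)
  have T: "mass (cond_pmf P S) T = p"
    using assms(1) S_pos
    by (simp add: p_def cond_pmf.rep_eq[OF ne] measure_uniform_measure Int_absorb1)
  have "pmf (map_pmf (\<lambda>y. y \<in> T) (cond_pmf P S)) True = p"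
    by (simp add: pmf_map vimage_def T)
  moreover have "pmf (map_pmf (\<lambda>y. y \<in> T) (cond_pmf P S)) False = 1 - p"
    using measure_pmf.prob_compl[of T "cond_pmf P S"]
    by (simp add: pmf_map vimage_def T Compl_eq_Diff_UNIV[symmetric] Compl_eq)
  ultimately show "pmf (map_pmf (\<lambda>y. y \<in> T) (cond_pmf P S)) b
      = pmf (bernoulli_pmf (mass P T / mass P S)) b" for b
    using p by (cases b) (simp_all flip: p_def)
qed

lemma sem_count_hits:
  assumes "T \<subseteq> S" "mass P S > 0"
  shows "sem P (count_hits S T N) = binomial_pmf N (mass P T / mass P S)"
proof (induction N)
  case 0
  show ?case
    using prob_ratio_bounds[OF assms(1), of P] by (simp add: binomial_pmf_0)
next
  case (Suc N)
  let ?p = "mass P T / mass P S"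
  have p: "?p \<in> {0..1}"
    by (rule prob_ratio_bounds[OF assms(1)])
  have "sem P (count_hits S T (Suc N)) = bind_pmf (map_pmf (\<lambda>y. y \<in> T) (cond_pmf P S))
      (\<lambda>b. bind_pmf (binomial_pmf N ?p) (\<lambda>c. return_pmf (if b then Suc c else c)))"
    by (simp add: sem_bind Suc bind_map_pmf)
  also have "\<dots> = binomial_pmf (Suc N) ?p"
    unfolding cond_pmf_hit[OF assms] using p
    by (subst binomial_pmf_Suc) (auto simp: map_pmf_def pair_pmf_def bind_assoc_pmf bind_return_pmf
        intro!: bind_pmf_cong)
  finally show ?case .
qed

lemma cost_count_hits: "cost P (count_hits S T N) = of_nat N"
  by (induction N) (simp_all add: cost_bind)

lemma legal_count_hits: "legal_query P S \<Longrightarrow> legal P (count_hits S T N)"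
  by (induction N) (simp_all add: legal_bind)

section \<open>Binomial moments and concentration\<close>

text \<open>Absorption trades the weight 1/(c + 1) for one additional trial; the subtracted term is
  c = 0 of the larger binomial, which the shift does not reach. The moments below all come from this
  identity.\<close>

lemma binomial_expectation_shift:
  fixes \<phi> :: "nat \<Rightarrow> real"
  assumes p: "0 < p" "p \<le> 1"
  shows "expect (binomial_pmf N p) (\<lambda>c. \<phi> (Suc c) / real (Suc c))
    = (expect (binomial_pmf (Suc N) p) \<phi> - (1 - p) ^ Suc N * \<phi> 0) / (real (Suc N) * p)"
proof -
  have "real (Suc N) * p * (\<Sum>k\<le>N. real (N choose k) * p ^ k * (1 - p) ^ (N - k) * (\<phi> (Suc k) / real (Suc k)))
      = (\<Sum>k\<le>N. real (Suc N choose Suc k) * p ^ Suc k * (1 - p) ^ (N - k) * \<phi> (Suc k))"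
    unfolding sum_distrib_left
  proof (intro sum.cong refl)
    fix k
    have "real (Suc N) * real (N choose k) = real (Suc N choose Suc k) * real (Suc k)"
      by (metis Suc_times_binomial_eq of_nat_mult)
    then have e: "real (Suc N) * real (N choose k) / real (Suc k) = real (Suc N choose Suc k)"
      by (simp add: field_simps del: binomial_Suc_Suc of_nat_Suc)
    have "real (Suc N) * p * (real (N choose k) * p ^ k * (1 - p) ^ (N - k) * (\<phi> (Suc k) / real (Suc k)))
      = (real (Suc N) * real (N choose k) / real (Suc k)) * p ^ Suc k * (1 - p) ^ (N - k) * \<phi> (Suc k)"
      by simp
    then show "real (Suc N) * p * (real (N choose k) * p ^ k * (1 - p) ^ (N - k) * (\<phi> (Suc k) / real (Suc k)))
      = real (Suc N choose Suc k) * p ^ Suc k * (1 - p) ^ (N - k) * \<phi> (Suc k)"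
      unfolding e .
  qed
  also have "\<dots> = (\<Sum>k\<le>Suc N. real (Suc N choose k) * p ^ k * (1 - p) ^ (Suc N - k) * \<phi> k)
      - (1 - p) ^ Suc N * \<phi> 0"
    by (subst sum.atMost_Suc_shift) simp
  finally show ?thesis
    using p by (simp add: expectation_binomial_pmf' eq_divide_eq mult.commute del: binomial_Suc_Suc of_nat_Suc)
qed

lemma binomial_expectation_inverse:
  assumes p: "0 < p" "p \<le> 1"
  shows "expect (binomial_pmf N p) (\<lambda>c. 1 / real (Suc c))
    = (1 - (1 - p) ^ Suc N) / (real (Suc N) * p)"
  using binomial_expectation_shift[OF p, of N "\<lambda>_. 1"] by simp

lemma binomial_expectation_inverse_le:
  assumes p: "0 < p" "p \<le> 1"
  shows "expect (binomial_pmf N p) (\<lambda>c. 1 / real (Suc c)) \<le> 1 / (real (Suc N) * p)"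
  using p by (subst binomial_expectation_inverse) (auto intro!: divide_right_mono)

lemma binomial_expectation_inverse_square_le:
  assumes p: "0 < p" "p \<le> 1" and N: "0 < N"
  shows "expect (binomial_pmf N p) (\<lambda>c. (real (Suc N) / real (Suc c))\<^sup>2)
    \<le> (1 + 3 / (real N * p)) / p\<^sup>2"
proof -
  let ?E = "\<lambda>N. expect (binomial_pmf N p)"
  have int [simp]: "integrable (measure_pmf (binomial_pmf N p)) f" for N and f :: "nat \<Rightarrow> real"
    using p by (intro integrable_binomial_pmf) auto
  \<comment> \<open>The shift is applied with \<open>\<phi> c = 1 / c\<close>; as 1/0 = 0, the term
    for c = 0 vanishes.\<close>
  have "?E N (\<lambda>c. 1 / (real (Suc c))\<^sup>2) = ?E (Suc N) (\<lambda>c. 1 / real c) / (real (Suc N) * p)"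
    using binomial_expectation_shift[OF p, of N "\<lambda>c. 1 / real c"]
    by (simp add: power2_eq_square del: of_nat_Suc)
  \<comment> \<open>The shift does not apply to 1/c again, so 1/c is replaced by 1/(c+1) +
    3/((c+1)(c+2)). The constant 3 gives equality at c = 1, and at c = 0 the left-hand side is 0 by
    convention.\<close>
  also have "?E (Suc N) (\<lambda>c. 1 / real c)
      \<le> ?E (Suc N) (\<lambda>c. 1 / real (Suc c) + 3 * (1 / (real (Suc (Suc c))) / real (Suc c)))"
  proof (intro integral_mono int)
    fix c
    show "1 / real c \<le> 1 / real (Suc c) + 3 * (1 / (real (Suc (Suc c))) / real (Suc c))"
    proof (cases c)
      case (Suc m)
      have "1 / real c + 2 * real m / ((real m + 1) * (real m + 2) * (real m + 3))
          = 1 / real (Suc c) + 3 * (1 / (real (Suc (Suc c))) / real (Suc c))"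
        unfolding Suc by (simp add: divide_simps) (simp add: algebra_simps)
      moreover have "0 \<le> 2 * real m / ((real m + 1) * (real m + 2) * (real m + 3))"
        by simp
      ultimately show ?thesis by linarith
    qed simp
  qed
  also have "\<dots> = ?E (Suc N) (\<lambda>c. 1 / real (Suc c))
      + 3 * ?E (Suc N) (\<lambda>c. 1 / (real (Suc (Suc c))) / real (Suc c))"
    by (subst Bochner_Integration.integral_add) (simp_all only: int integral_mult_right_zero)
  also have "?E (Suc N) (\<lambda>c. 1 / (real (Suc (Suc c))) / real (Suc c))
      = (?E (Suc (Suc N)) (\<lambda>c. 1 / real (Suc c)) - (1 - p) ^ Suc (Suc N)) / (real (Suc (Suc N)) * p)"
    using binomial_expectation_shift[OF p, of "Suc N" "\<lambda>c. 1 / real (Suc c)"] by simp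
  also have "\<dots> \<le> 1 / (real (Suc (Suc (Suc N))) * p) / (real (Suc (Suc N)) * p)"
    using binomial_expectation_inverse_le[OF p, of "Suc (Suc N)"] p
    by (intro divide_right_mono) (auto intro: order.trans[rotated])
  also have "?E (Suc N) (\<lambda>c. 1 / real (Suc c)) \<le> 1 / (real (Suc (Suc N)) * p)"
    by (rule binomial_expectation_inverse_le[OF p])
  finally have *: "?E N (\<lambda>c. 1 / (real (Suc c))\<^sup>2) \<le> (1 / (real (Suc (Suc N)) * p)
      + 3 * (1 / (real (Suc (Suc (Suc N))) * p) / (real (Suc (Suc N)) * p))) / (real (Suc N) * p)"
    using p by (simp add: divide_right_mono)
  have "?E N (\<lambda>c. (real (Suc N) / real (Suc c))\<^sup>2) = (real (Suc N))\<^sup>2 * ?E N (\<lambda>c. 1 / (real (Suc c))\<^sup>2)"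
    unfolding integral_mult_right_zero[symmetric] by (simp add: power_divide del: of_nat_Suc)
  also have "\<dots> \<le> (real (Suc N))\<^sup>2 * ((1 / (real (Suc (Suc N)) * p)
      + 3 * (1 / (real (Suc (Suc (Suc N))) * p) / (real (Suc (Suc N)) * p))) / (real (Suc N) * p))"
    by (intro mult_left_mono *) simp
  also have "\<dots> = (real (Suc N) / real (Suc (Suc N))
      + 3 * (real (Suc N) / (real (Suc (Suc N)) * real (Suc (Suc (Suc N)))) / p)) / p\<^sup>2"
    using p by (simp add: power2_eq_square divide_simps del: of_nat_Suc) (simp add: algebra_simps del: of_nat_Suc)
  also have "\<dots> \<le> (1 + 3 * (1 / real N / p)) / p\<^sup>2"
  proof -
    have "real (Suc N) * real N \<le> real (Suc (Suc N)) * real (Suc (Suc (Suc N)))"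
      by (intro mult_mono) auto
    then have "real (Suc N) / (real (Suc (Suc N)) * real (Suc (Suc (Suc N)))) \<le> 1 / real N"
      using N by (subst frac_le_eq) (auto simp: field_simps simp del: of_nat_Suc intro!: divide_nonpos_pos)
    then show ?thesis
      using p N by (intro divide_right_mono add_mono mult_left_mono) auto
  qed
  finally show ?thesis
    by simp
qed

lemma binomial_expectation_Suc:
  assumes p: "0 < p" "p \<le> 1"
  shows "expect (binomial_pmf N p) (\<lambda>c. real (Suc c) / real (Suc N))
    = (real N * p + 1) / real (Suc N)"
proof -
  have mean: "expect (binomial_pmf N p) real = real N * p"
  proof (cases N)
    case 0
    then show ?thesis using p by (simp add: binomial_pmf_0)
  next
    case (Suc n)
    \<comment> \<open>With \<open>\<phi> c = c\<close> the denominator cancels, so the shift also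
      yields the mean.\<close>
    show ?thesis
      using binomial_expectation_shift[OF p, of n real] p Suc
      by (simp add: eq_divide_eq mult.commute del: of_nat_Suc)
  qed
  have "expect (binomial_pmf N p) (\<lambda>c. real c + 1) = real N * p + 1"
    using p by (subst Bochner_Integration.integral_add) (simp_all add: mean)
  then show ?thesis
    by (simp add: add.commute)
qed

section \<open>Sums over independent repetitions\<close>

primrec repeat_prog :: "nat \<Rightarrow> 'a::monoid_add prog \<Rightarrow> 'a prog" where
  "repeat_prog 0 t = Ret 0"
| "repeat_prog (Suc M) t = bind_prog t (\<lambda>a. bind_prog (repeat_prog M t) (\<lambda>b. Ret (a + b)))"

lemma cost_repeat: "cost P (repeat_prog M t) = of_nat M * cost P t"
  by (induction M) (simp_all add: cost_bind distrib_right measure_pmf.emeasure_space_1)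

lemma legal_repeat: "legal P t \<Longrightarrow> legal P (repeat_prog M t)"
  by (induction M) (simp_all add: legal_bind)

lemma nn_integral_repeat:
  fixes \<phi> :: "'a::monoid_add \<Rightarrow> ennreal"
  assumes "\<phi> 0 = 0" "\<And>a b. \<phi> (a + b) = \<phi> a + \<phi> b"
  shows "(\<integral>\<^sup>+ a. \<phi> a \<partial>(sem P (repeat_prog M t))) = of_nat M * (\<integral>\<^sup>+ a. \<phi> a \<partial>(sem P t))"
  by (induction M) (simp_all add: assms sem_bind nn_integral_add distrib_right)

text \<open>Hoeffding's bound by exponential moments, which multiply along the recursion of
  \<open>repeat_prog\<close>. An arbitrary additive \<open>\<phi>\<close> covers \<open>fst\<close>
  (with l = 0) as well as the negated sum of \<open>fst\<close> and \<open>snd\<close> (with l =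
  -1).\<close>

lemma repeat_tail:
  fixes \<phi> :: "'a::monoid_add \<Rightarrow> real"
  assumes \<phi>: "\<phi> 0 = 0" "\<And>a b. \<phi> (a + b) = \<phi> a + \<phi> b"
    and bounds: "\<And>a. a \<in> set_pmf (sem P t) \<Longrightarrow> \<phi> a \<in> {l..l + 1}"
    and mean: "expect (sem P t) \<phi> \<le> \<mu>" and s: "s > 0"
  shows "mass (sem P (repeat_prog M t)) {a. \<phi> a \<ge> real M * (\<mu> + s)} \<le> exp (- 2 * real M * s\<^sup>2)"
proof -
  interpret interval_bounded_random_variable "measure_pmf (sem P t)" \<phi> l "l + 1"
    by unfold_locales (use bounds in \<open>simp_all add: AE_measure_pmf_iff\<close>)
  \<comment> \<open>The parameter 4 s minimizes t^2/8 - t s over t; the minimum is -2 s^2.\<close>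
  have one: "(\<integral>\<^sup>+ a. ennreal (exp (4 * s * (\<phi> a - \<mu>))) \<partial>(sem P t)) \<le> ennreal (exp (2 * s\<^sup>2))"
  proof -
    have "(\<integral>\<^sup>+ a. ennreal (exp (4 * s * (\<phi> a - \<mu>))) \<partial>(sem P t))
       \<le> (\<integral>\<^sup>+ a. ennreal (exp (4 * s * (\<phi> a - expect (sem P t) \<phi>))) \<partial>(sem P t))"
      using mean s by (intro nn_integral_mono) (auto intro!: ennreal_leI mult_left_mono)
    also have "\<dots> \<le> ennreal (exp ((4 * s)\<^sup>2 * (l + 1 - l)\<^sup>2 / 8))"
      using s by (intro Hoeffdings_lemma_nn_integral) auto
    finally show ?thesis
      by (simp add: power_mult_distrib)
  qed
  have all: "(\<integral>\<^sup>+ a. ennreal (exp (4 * s * (\<phi> a - real M * \<mu>))) \<partial>(sem P (repeat_prog M t)))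
     \<le> ennreal (exp (2 * s\<^sup>2) ^ M)"
  proof (induction M)
    case (Suc M)
    have factor: "ennreal (exp (4 * s * (\<phi> (a + b) - real (Suc M) * \<mu>)))
        = ennreal (exp (4 * s * (\<phi> a - \<mu>))) * ennreal (exp (4 * s * (\<phi> b - real M * \<mu>)))" for a b
    proof -
      have "4 * s * (\<phi> (a + b) - real (Suc M) * \<mu>) = 4 * s * (\<phi> a - \<mu>) + 4 * s * (\<phi> b - real M * \<mu>)"
        by (simp add: \<phi>(2) algebra_simps)
      then show ?thesis
        by (simp only: exp_add ennreal_mult exp_ge_zero)
    qed
    have "(\<integral>\<^sup>+ a. ennreal (exp (4 * s * (\<phi> a - real (Suc M) * \<mu>))) \<partial>(sem P (repeat_prog (Suc M) t)))
      = (\<integral>\<^sup>+ a. (\<integral>\<^sup>+ b. ennreal (exp (4 * s * (\<phi> a - \<mu>))) * ennreal (exp (4 * s * (\<phi> b - real M * \<mu>)))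
          \<partial>(sem P (repeat_prog M t))) \<partial>(sem P t))"
      by (simp add: sem_bind factor del: of_nat_Suc)
    also have "\<dots> = (\<integral>\<^sup>+ a. ennreal (exp (4 * s * (\<phi> a - \<mu>))) \<partial>(sem P t))
        * (\<integral>\<^sup>+ b. ennreal (exp (4 * s * (\<phi> b - real M * \<mu>))) \<partial>(sem P (repeat_prog M t)))"
      by (simp add: nn_integral_cmult nn_integral_multc)
    also have "\<dots> \<le> ennreal (exp (2 * s\<^sup>2)) * ennreal (exp (2 * s\<^sup>2) ^ M)"
      by (intro mult_mono one Suc) auto
    finally show ?case
      by (simp only: power_Suc ennreal_mult exp_ge_zero zero_le_power)
  qed (simp add: \<phi>)
  have "emeasure (measure_pmf (sem P (repeat_prog M t))) {a. \<phi> a \<ge> real M * (\<mu> + s)}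
     \<le> (\<integral>\<^sup>+ a. ennreal (exp (- 4 * real M * s\<^sup>2)) * ennreal (exp (4 * s * (\<phi> a - real M * \<mu>)))
          \<partial>(sem P (repeat_prog M t)))"
  proof (subst nn_integral_indicator[symmetric], simp, intro nn_integral_mono)
    fix a
    show "indicator {a. real M * (\<mu> + s) \<le> \<phi> a} a
      \<le> ennreal (exp (- 4 * real M * s\<^sup>2)) * ennreal (exp (4 * s * (\<phi> a - real M * \<mu>)))"
    proof (cases "real M * (\<mu> + s) \<le> \<phi> a")
      case True
      then have "4 * s * (real M * s) \<le> 4 * s * (\<phi> a - real M * \<mu>)"
        using s by (intro mult_left_mono) (auto simp: algebra_simps)
      then have "0 \<le> - 4 * real M * s\<^sup>2 + 4 * s * (\<phi> a - real M * \<mu>)"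
        by (simp add: power2_eq_square algebra_simps)
      then have "1 \<le> exp (- 4 * real M * s\<^sup>2) * exp (4 * s * (\<phi> a - real M * \<mu>))"
        by (simp only: exp_add[symmetric] one_le_exp_iff)
      then have "1 \<le> ennreal (exp (- 4 * real M * s\<^sup>2) * exp (4 * s * (\<phi> a - real M * \<mu>)))"
        by (metis ennreal_1 ennreal_leI)
      with True show ?thesis
        by (simp add: ennreal_mult)
    qed simp
  qed
  also have "\<dots> = ennreal (exp (- 4 * real M * s\<^sup>2))
      * (\<integral>\<^sup>+ a. ennreal (exp (4 * s * (\<phi> a - real M * \<mu>))) \<partial>(sem P (repeat_prog M t)))"
    by (simp add: nn_integral_cmult)
  also have "\<dots> \<le> ennreal (exp (- 4 * real M * s\<^sup>2)) * ennreal (exp (2 * s\<^sup>2) ^ M)"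
    by (intro mult_left_mono all) auto
  also have "\<dots> = ennreal (exp (- 2 * real M * s\<^sup>2))"
  proof -
    have "- 4 * real M * s\<^sup>2 + real M * (2 * s\<^sup>2) = - 2 * real M * s\<^sup>2"
      by simp
    then show ?thesis
      by (simp only: exp_of_nat_mult[symmetric] exp_add[symmetric] ennreal_mult[symmetric] exp_ge_zero)
  qed
  finally show ?thesis
    by (simp add: measure_pmf.emeasure_eq_measure)
qed

section \<open>Descending a chain of nested sets\<close>

lemma expectation_bind_finite:
  fixes h :: "'b \<Rightarrow> real"
  assumes "finite (set_pmf p)" "\<And>x. x \<in> set_pmf p \<Longrightarrow> finite (set_pmf (f x))"
  shows "expect (bind_pmf p f) h
    = expect p (\<lambda>x. expect (f x) h)"
  using assms by (subst pmf_expectation_bind[where A = "set_pmf p"])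
    (auto simp: integral_measure_pmf[where A = "set_pmf p"])

text \<open>A result \<open>(g, u)\<close> stands for an estimate in \<open>[g, g + u]\<close>: walks that are cut off before
  they reach a leaf return \<open>(0, 1)\<close>.\<close>

primrec descend :: "(nat \<Rightarrow> int set) \<Rightarrow> (nat \<Rightarrow> real) \<Rightarrow> nat \<Rightarrow> real \<Rightarrow> (real \<Rightarrow> real \<times> nat)
    \<Rightarrow> nat \<Rightarrow> nat \<Rightarrow> real \<Rightarrow> (real \<times> nat) prog" where
  "descend B q n \<theta> leaf 0 k v = Ret (leaf v)"
| "descend B q n \<theta> leaf (Suc r) k v =
     bind_prog (count_hits (B k) (B (Suc k)) (Suc k * n)) (\<lambda>c.
       let w = v * q k * (real (Suc (Suc k * n)) / real (Suc c))
       in if w \<le> \<theta> then Ret (1, 0) else descend B q n \<theta> leaf r (Suc k) w)"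

text \<open>The walk to one fixed sample: in the application \<open>B k\<close> is the node of level
  k around the sample and \<open>q k\<close> is the conditional Q-mass of the next node.\<close>

locale descent =
  fixes P :: "int pmf" and B :: "nat \<Rightarrow> int set" and q :: "nat \<Rightarrow> real" and n :: nat
    and \<theta> :: real and leaf :: "real \<Rightarrow> real \<times> nat"
  assumes decreasing: "B (Suc k) \<subseteq> B k"
    and prob_pos: "mass P (B k) > 0"
    and q_pos: "q k > 0"
    and n_pos: "n > 0"
    and \<theta>_pos: "\<theta> > 0"
    and leaf_range: "0 \<le> fst (leaf v)" "fst (leaf v) + real (snd (leaf v)) \<le> 1"
begin

definition p :: "nat \<Rightarrow> real" where
  "p k = mass P (B (Suc k)) / mass P (B k)"

definition N :: "nat \<Rightarrow> nat" where "N k = Suc k * n"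

abbreviation prog :: "nat \<Rightarrow> nat \<Rightarrow> real \<Rightarrow> (real \<times> nat) prog" where
  "prog \<equiv> descend B q n \<theta> leaf"

definition upd :: "nat \<Rightarrow> real \<Rightarrow> nat \<Rightarrow> real" where
  "upd k v c = v * q k * (real (Suc (N k)) / real (Suc c))"

lemma p: "0 < p k" "p k \<le> 1"
  using prob_pos prob_ratio_bounds[OF decreasing, of P k] by (auto simp: p_def)

lemma N_pos: "0 < N k"
  using n_pos by (simp add: N_def)

lemma upd_pos: "v > 0 \<Longrightarrow> upd k v c > 0"
  using q_pos[of k] by (auto simp: upd_def intro!: mult_pos_pos divide_pos_pos)

abbreviation counts :: "nat \<Rightarrow> nat pmf" where
  "counts k \<equiv> binomial_pmf (N k) (p k)"

lemma finite_counts [simp]: "finite (set_pmf (counts k))"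
  using p[of k] by (intro finite_set_pmf_binomial_pmf) auto

lemma integrable_counts [simp]: "integrable (measure_pmf (counts k)) (f :: nat \<Rightarrow> real)"
  by (intro integrable_measure_pmf_finite) simp

lemma sem_prog_Suc:
  "sem P (prog (Suc r) k v) = bind_pmf (counts k)
     (\<lambda>c. if upd k v c \<le> \<theta> then return_pmf (1, 0) else sem P (prog r (Suc k) (upd k v c)))"
  unfolding descend.simps sem_bind sem_count_hits[OF decreasing prob_pos] p_def[symmetric] N_def[symmetric]
  by (intro bind_pmf_cong refl) (simp add: upd_def Let_def)

lemma cost_prog_Suc:
  "cost P (prog (Suc r) k v) = of_nat (N k) + (\<integral>\<^sup>+ c. (if upd k v c \<le> \<theta> then 0
     else cost P (prog r (Suc k) (upd k v c))) \<partial>(counts k))"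
  unfolding descend.simps cost_bind cost_count_hits sem_count_hits[OF decreasing prob_pos]
    p_def[symmetric] N_def[symmetric]
  by (intro arg_cong2[where f = "(+)"] refl nn_integral_cong) (simp add: upd_def Let_def)

lemma finite_sem_prog [simp]: "finite (set_pmf (sem P (prog r k v)))"
  by (induction r arbitrary: k v) (simp_all add: sem_prog_Suc del: descend.simps(2))

lemma prog_range:
  "a \<in> set_pmf (sem P (prog r k v)) \<Longrightarrow> 0 \<le> fst a \<and> fst a + real (snd a) \<le> 1"
proof (induction r arbitrary: k v)
  case (Suc r)
  then show ?case
    by (auto simp: sem_prog_Suc simp del: descend.simps(2) split: if_splits)
qed (use leaf_range in auto)

lemma legal_prog:
  assumes "\<And>k. legal_query P (B k)"
  shows "legal P (prog r k v)"
  by (induction r arbitrary: k v) (auto simp: legal_bind Let_def intro!: legal_count_hits assms)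

lemma expectation_prog_Suc:
  fixes h :: "real \<times> nat \<Rightarrow> real"
  shows "expect (sem P (prog (Suc r) k v)) h = expect (counts k)
     (\<lambda>c. if upd k v c \<le> \<theta> then h (1, 0) else expect (sem P (prog r (Suc k) (upd k v c))) h)"
  unfolding sem_prog_Suc
  by (subst expectation_bind_finite) (auto intro!: Bochner_Integration.integral_cong)

text \<open>The mean, and bounds for the second and for the inverse moment, of the factor by which
  one level multiplies the running value. Their products over the levels (\<open>drift\<close>)
  control the accuracy (\<open>b1\<close>, \<open>b2\<close>) and the early stops
  (\<open>b3\<close>).\<close>

definition b1 :: "nat \<Rightarrow> real" where "b1 k = q k / p k * (1 - (1 - p k) ^ Suc (N k))"
definition b2 :: "nat \<Rightarrow> real" where "b2 k = (q k / p k)\<^sup>2 * (1 + 3 / (real (N k) * p k))"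
definition b3 :: "nat \<Rightarrow> real" where "b3 k = (p k + 1 / real (N k)) / q k"

lemma upd_mean: "expect (counts k) (upd k v) = v * b1 k"
proof -
  have "expect (counts k) (upd k v)
      = (v * q k * real (Suc (N k))) * expect (counts k) (\<lambda>c. 1 / real (Suc c))"
    unfolding integral_mult_right_zero[symmetric]
    by (intro Bochner_Integration.integral_cong refl) (simp add: upd_def)
  then show ?thesis
    using p[of k] by (subst (asm) binomial_expectation_inverse)
      (auto simp: b1_def divide_simps simp del: of_nat_Suc power_Suc)
qed

lemma upd_square: "expect (counts k) (\<lambda>c. (upd k v c)\<^sup>2) \<le> v\<^sup>2 * b2 k"
proof -
  have "expect (counts k) (\<lambda>c. (upd k v c)\<^sup>2)
      = (v * q k)\<^sup>2 * expect (counts k) (\<lambda>c. (real (Suc (N k)) / real (Suc c))\<^sup>2)"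
    unfolding integral_mult_right_zero[symmetric]
    by (intro Bochner_Integration.integral_cong refl)
       (simp add: upd_def power_mult_distrib power_divide del: of_nat_Suc)
  also have "\<dots> \<le> (v * q k)\<^sup>2 * ((1 + 3 / (real (N k) * p k)) / (p k)\<^sup>2)"
    by (intro mult_left_mono binomial_expectation_inverse_square_le p N_pos) auto
  finally show ?thesis
    by (simp add: b2_def power_mult_distrib power_divide mult.assoc)
qed

lemma upd_inverse:
  assumes "v > 0"
  shows "expect (counts k) (\<lambda>c. 1 / upd k v c) \<le> b3 k / v"
proof -
  have "expect (counts k) (\<lambda>c. 1 / upd k v c)
      = 1 / (v * q k) * expect (counts k) (\<lambda>c. real (Suc c) / real (Suc (N k)))"
    unfolding integral_mult_right_zero[symmetric]
    by (intro Bochner_Integration.integral_cong refl) (simp add: upd_def)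
  also have "\<dots> = 1 / (v * q k) * ((real (N k) * p k + 1) / real (Suc (N k)))"
    using p[of k] by (subst binomial_expectation_Suc) auto
  also have "(real (N k) * p k + 1) / real (Suc (N k)) \<le> (real (N k) * p k + 1) / real (N k)"
    using p[of k] N_pos[of k] by (intro divide_left_mono) auto
  also have "\<dots> = p k + 1 / real (N k)"
    using N_pos[of k] by (simp add: add_divide_distrib)
  finally show ?thesis
    using assms q_pos[of k] by (simp add: b3_def mult.commute divide_right_mono)
qed

lemma b1: "0 \<le> b1 k" "b1 k \<le> q k / p k" "(b1 k)\<^sup>2 \<le> b2 k"
proof -
  have "0 \<le> (1 - p k) ^ Suc (N k)" "(1 - p k) ^ Suc (N k) \<le> 1"
    using p[of k] by (auto intro!: power_le_one simp del: power_Suc)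
  then show 0: "0 \<le> b1 k" and le: "b1 k \<le> q k / p k"
    using p[of k] q_pos[of k] unfolding b1_def
    by (auto intro!: mult_nonneg_nonneg divide_nonneg_nonneg mult_left_le simp del: power_Suc times_divide_eq_left)
  have "(b1 k)\<^sup>2 \<le> (q k / p k)\<^sup>2"
    using 0 le by (intro power_mono)
  also have "\<dots> \<le> b2 k"
    unfolding b2_def using p[of k] by (simp add: mult_le_cancel_left1)
  finally show "(b1 k)\<^sup>2 \<le> b2 k" .
qed

definition drift :: "(nat \<Rightarrow> real) \<Rightarrow> nat \<Rightarrow> nat \<Rightarrow> real" where
  "drift b k r = (\<Prod>l\<in>{k..<k + r}. b l)"

lemma drift_0 [simp]: "drift b k 0 = 1"
  by (simp add: drift_def)

lemma drift_Suc: "drift b k (Suc r) = b k * drift b (Suc k) r"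
  by (simp add: drift_def prod.atLeast_Suc_lessThan)

lemma drift_nonneg: "(\<And>l. b l \<ge> 0) \<Longrightarrow> drift b k r \<ge> 0"
  by (auto simp: drift_def intro!: prod_nonneg)

lemma b3_nonneg: "b3 k \<ge> 0"
  using p[of k] q_pos[of k] by (auto simp: b3_def)

lemma drift_b1_b2: "(drift b1 k r)\<^sup>2 \<le> drift b2 k r"
  unfolding drift_def prod_power_distrib
  by (intro prod_mono) (auto intro: b1 order.trans[OF zero_le_power2])

text \<open>By Markov's inequality for 1/w, a stop w \<le> \<theta> at a given level has probability
  at most \<theta> E[1/w], hence at most \<theta>/v times a product of \<open>b3\<close>. These
  products are added over the levels.\<close>

definition stop_weight :: "nat \<Rightarrow> nat \<Rightarrow> real" where
  "stop_weight k r = (\<Sum>m<r. drift b3 k (Suc m))"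

lemma stop_weight_Suc: "stop_weight k (Suc r) = b3 k * (1 + stop_weight (Suc k) r)"
  unfolding stop_weight_def
  by (subst sum.lessThan_Suc_shift) (simp add: drift_Suc sum_distrib_left distrib_left)

lemma stop_weight_nonneg: "stop_weight k r \<ge> 0"
  by (auto simp: stop_weight_def intro!: sum_nonneg drift_nonneg b3_nonneg)

text \<open>An upper bound for the expectation of \<open>(w / V - 1)\<^sup>2\<close>, where \<open>w\<close> is the value that \<open>v\<close>
  would reach after \<open>r\<close> more levels if the stopping rule were ignored.\<close>

definition sq_error :: "real \<Rightarrow> nat \<Rightarrow> nat \<Rightarrow> real \<Rightarrow> real" where
  "sq_error V k r v = v\<^sup>2 * drift b2 k r / V\<^sup>2 - 2 * v * drift b1 k r / V + 1"

text \<open>\<open>sq_error\<close> is a formal polynomial rather than an expectation: it is a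
  square plus a term that \<open>drift_b1_b2\<close> makes nonnegative.\<close>

lemma sq_error_nonneg: "sq_error V k r v \<ge> 0"
proof -
  have "0 \<le> (v * drift b1 k r / V - 1)\<^sup>2 + v\<^sup>2 * (drift b2 k r - (drift b1 k r)\<^sup>2) / V\<^sup>2"
    using drift_b1_b2[of k r] by (intro add_nonneg_nonneg divide_nonneg_nonneg mult_nonneg_nonneg) auto
  also have "\<dots> = sq_error V k r v"
    by (cases "V = 0") (auto simp: sq_error_def power2_eq_square field_simps)
  finally show ?thesis .
qed

text \<open>The second moment has a nonnegative coefficient, where an upper bound is enough; the
  linear term enters with a minus sign, so the first moment is used with its exact value.\<close>

lemma sq_error_step:
  "expect (counts k) (\<lambda>c. sq_error V (Suc k) r (upd k v c)) \<le> sq_error V k (Suc r) v"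
proof -
  have "expect (counts k) (\<lambda>c. sq_error V (Suc k) r (upd k v c))
    = expect (counts k) (\<lambda>c. (upd k v c)\<^sup>2 * (drift b2 (Suc k) r / V\<^sup>2)
        + (upd k v c * (- 2 * drift b1 (Suc k) r / V) + 1))"
    by (simp add: sq_error_def algebra_simps)
  also have "\<dots> = expect (counts k) (\<lambda>c. (upd k v c)\<^sup>2) * (drift b2 (Suc k) r / V\<^sup>2)
      + (expect (counts k) (upd k v) * (- 2 * drift b1 (Suc k) r / V) + 1)"
    by (simp only: Bochner_Integration.integral_add[OF integrable_counts integrable_counts]
        integral_mult_left_zero measure_pmf.prob_space_axioms prob_space.prob_space
        lebesgue_integral_const) simp
  also have "\<dots> \<le> v\<^sup>2 * b2 k * (drift b2 (Suc k) r / V\<^sup>2)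
      + (v * b1 k * (- 2 * drift b1 (Suc k) r / V) + 1)"
    unfolding upd_mean
    by (intro add_right_mono mult_right_mono upd_square divide_nonneg_nonneg drift_nonneg)
       (auto intro: order.trans[OF zero_le_power2 b1(3)])
  also have "\<dots> = sq_error V k (Suc r) v"
    by (simp add: sq_error_def drift_Suc algebra_simps)
  finally show ?thesis .
qed

text \<open>A stopped walk reports 1, which exceeds the target f by only 1 - f. This factor is kept
  in front of the stop term: for f = 1 - \<open>deficit\<close> it is \<open>deficit\<close>, which
  later turns an average over P into one over Q.\<close>

lemma prog_upper:
  assumes f: "0 \<le> f" "f \<le> 1" and \<kappa>: "0 \<le> \<kappa>" "0 \<le> \<mu>"
    and leaf: "\<And>v. v > 0 \<Longrightarrow> fst (leaf v) \<le> f + \<kappa> + \<mu> * (v / V - 1)\<^sup>2"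
    and v: "v > 0" and V: "V > 0"
  shows "expect (sem P (prog r k v)) fst
    \<le> f + \<kappa> + \<mu> * sq_error V k r v + (1 - f) * (\<theta> / v * stop_weight k r)"
  using v
proof (induction r arbitrary: k v)
  case 0
  have "sq_error V k 0 v = (v / V - 1)\<^sup>2"
    using V by (simp add: sq_error_def power2_eq_square field_simps)
  then show ?case
    using leaf[OF 0] by (simp add: stop_weight_def)
next
  case (Suc r)
  let ?E = "expect (counts k)"
  let ?S = "1 + stop_weight (Suc k) r"
  have "expect (sem P (prog (Suc r) k v)) fst
    \<le> ?E (\<lambda>c. f + \<kappa> + (\<mu> * sq_error V (Suc k) r (upd k v c) + (1 - f) * \<theta> * ?S * (1 / upd k v c)))"
    unfolding expectation_prog_Suc
  proof (intro integral_mono integrable_counts)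
    fix c
    have w: "upd k v c > 0"
      using Suc.prems by (rule upd_pos)
    have sq: "0 \<le> \<mu> * sq_error V (Suc k) r (upd k v c)"
      using \<kappa> sq_error_nonneg by simp
    have st: "0 \<le> (1 - f) * \<theta> * (1 / upd k v c)" "0 \<le> stop_weight (Suc k) r"
      using f w \<theta>_pos stop_weight_nonneg by auto
    have split: "(1 - f) * \<theta> * ?S * (1 / upd k v c) = (1 - f) * \<theta> * (1 / upd k v c)
       + (1 - f) * (\<theta> / upd k v c * stop_weight (Suc k) r)"
      by (simp add: divide_inverse algebra_simps)
    show "(if upd k v c \<le> \<theta> then fst (1, 0) else expect (sem P (prog r (Suc k) (upd k v c))) fst)
      \<le> f + \<kappa> + (\<mu> * sq_error V (Suc k) r (upd k v c) + (1 - f) * \<theta> * ?S * (1 / upd k v c))"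
    proof (cases "upd k v c \<le> \<theta>")
      case True
      \<comment> \<open>Markov's inequality inside the induction: a stop means 1 \<le>
        \<theta>/w.\<close>
      have "(1 - f) * 1 \<le> (1 - f) * (\<theta> * (1 / upd k v c))"
        using True w f by (intro mult_left_mono) (auto simp: field_simps)
      moreover have "0 \<le> (1 - f) * (\<theta> / upd k v c * stop_weight (Suc k) r)"
        using f w \<theta>_pos st by simp
      ultimately show ?thesis
        using True sq \<kappa> unfolding split by simp
    next
      case False
      have "expect (sem P (prog r (Suc k) (upd k v c))) fst
        \<le> f + \<kappa> + \<mu> * sq_error V (Suc k) r (upd k v c) + (1 - f) * (\<theta> / upd k v c * stop_weight (Suc k) r)"
        by (rule Suc.IH[OF w])
      then show ?thesis
        using False st(1) unfolding split by simp
    qed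
  qed
  also have "\<dots> = f + \<kappa> + (\<mu> * ?E (\<lambda>c. sq_error V (Suc k) r (upd k v c))
      + (1 - f) * \<theta> * ?S * ?E (\<lambda>c. 1 / upd k v c))"
    by (simp only: Bochner_Integration.integral_add[OF integrable_counts integrable_counts]
        integral_mult_right_zero measure_pmf.prob_space_axioms prob_space.prob_space
        lebesgue_integral_const) simp
  also have "\<dots> \<le> f + \<kappa> + (\<mu> * sq_error V k (Suc r) v + (1 - f) * \<theta> * ?S * (b3 k / v))"
    using f \<kappa> \<theta>_pos stop_weight_nonneg[of "Suc k" r]
    by (intro add_left_mono add_mono mult_left_mono sq_error_step upd_inverse Suc.prems) auto
  also have "\<dots> = f + \<kappa> + \<mu> * sq_error V k (Suc r) v + (1 - f) * (\<theta> / v * stop_weight k (Suc r))"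
    by (simp add: stop_weight_Suc)
  finally show ?case .
qed

text \<open>A stop reports 1 \<ge> f, which does no harm in this direction, so no stop term
  appears.\<close>

lemma prog_lower:
  assumes f: "0 \<le> f" "f \<le> 1" and \<kappa>: "0 \<le> \<kappa>" "0 \<le> \<mu>"
    and leaf: "\<And>v. v > 0 \<Longrightarrow> f \<le> fst (leaf v) + real (snd (leaf v)) + \<kappa> + \<mu> * (v / V - 1)\<^sup>2"
    and v: "v > 0" and V: "V > 0"
  shows "f - (\<kappa> + \<mu> * sq_error V k r v)
    \<le> expect (sem P (prog r k v)) (\<lambda>a. fst a + real (snd a))"
  using v
proof (induction r arbitrary: k v)
  case 0
  have "sq_error V k 0 v = (v / V - 1)\<^sup>2"
    using V by (simp add: sq_error_def power2_eq_square field_simps)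
  then show ?case
    using leaf[OF 0] by simp
next
  case (Suc r)
  let ?E = "expect (counts k)"
  have "f - (\<kappa> + \<mu> * sq_error V k (Suc r) v)
      \<le> f - (\<kappa> + \<mu> * ?E (\<lambda>c. sq_error V (Suc k) r (upd k v c)))"
    using \<kappa> by (intro diff_left_mono add_left_mono mult_left_mono sq_error_step)
  also have "\<dots> = ?E (\<lambda>c. (f - \<kappa>) + (- \<mu>) * sq_error V (Suc k) r (upd k v c))"
    by (simp only: Bochner_Integration.integral_add[OF integrable_counts integrable_counts]
        integral_mult_right_zero measure_pmf.prob_space_axioms prob_space.prob_space
        lebesgue_integral_const) simp
  also have "\<dots> \<le> expect (sem P (prog (Suc r) k v)) (\<lambda>a. fst a + real (snd a))"
    unfolding expectation_prog_Suc
  proof (intro integral_mono integrable_counts)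
    fix c
    have w: "upd k v c > 0"
      using Suc.prems by (rule upd_pos)
    have sq: "0 \<le> \<mu> * sq_error V (Suc k) r (upd k v c)"
      using \<kappa> sq_error_nonneg by simp
    show "(f - \<kappa>) + (- \<mu>) * sq_error V (Suc k) r (upd k v c)
      \<le> (if upd k v c \<le> \<theta> then fst (1, 0) + real (snd (1, 0))
         else expect (sem P (prog r (Suc k) (upd k v c))) (\<lambda>a. fst a + real (snd a)))"
      using Suc.IH[OF w, of "Suc k"] sq \<kappa> f by auto
  qed
  finally show ?case .
qed

lemma expectation_min_le:
  fixes h :: "nat \<Rightarrow> real"
  assumes "expect (counts k) h \<le> m"
  shows "expect (counts k) (\<lambda>c. min 1 (h c)) \<le> min 1 m"
proof -
  have "expect (counts k) (\<lambda>c. min 1 (h c)) \<le> expect (counts k) (\<lambda>c. 1)"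
    by (intro integral_mono integrable_counts) auto
  moreover have "expect (counts k) (\<lambda>c. min 1 (h c)) \<le> expect (counts k) h"
    by (intro integral_mono integrable_counts) auto
  ultimately show ?thesis
    using assms by simp
qed

text \<open>A level is paid for only while the running value exceeds \<theta>. Markov's inequality
  bounds the probability of this by the mean over \<theta>, and \<open>b1\<close> \<le> q/p bounds
  the mean by the product of the exact quotients.\<close>

lemma cost_prog:
  assumes "v \<ge> \<theta>"
  shows "cost P (prog r k v)
    \<le> ennreal (\<Sum>m<r. real (N (k + m)) * min 1 (v / \<theta> * drift (\<lambda>l. q l / p l) k m))"
  using assms
proof (induction r arbitrary: k v)
  case (Suc r)
  let ?d = "drift (\<lambda>l. q l / p l)"
  have d_nonneg: "?d k m \<ge> 0" for k m
    using p q_pos by (intro drift_nonneg) (auto intro!: divide_nonneg_nonneg less_imp_le)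
  have v: "v > 0"
    using Suc.prems \<theta>_pos by linarith
  let ?t = "\<lambda>c m. real (N (Suc k + m)) * min 1 (upd k v c / \<theta> * ?d (Suc k) m)"
  have nonneg: "0 \<le> (\<Sum>m<r. ?t c m)" for c
    using upd_pos[OF v, of k c] d_nonneg \<theta>_pos by (intro sum_nonneg mult_nonneg_nonneg) auto
  have "(\<integral>\<^sup>+ c. (if upd k v c \<le> \<theta> then 0 else cost P (prog r (Suc k) (upd k v c))) \<partial>(counts k))
    \<le> (\<integral>\<^sup>+ c. ennreal (\<Sum>m<r. ?t c m) \<partial>(counts k))"
  proof (intro nn_integral_mono)
    fix c
    show "(if upd k v c \<le> \<theta> then 0 else cost P (prog r (Suc k) (upd k v c))) \<le> ennreal (\<Sum>m<r. ?t c m)"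
      using Suc.IH[of "upd k v c" "Suc k"] by simp
  qed
  also have "\<dots> = ennreal (expect (counts k) (\<lambda>c. \<Sum>m<r. ?t c m))"
    by (intro nn_integral_eq_integral integrable_counts) (use nonneg in auto)
  also have "expect (counts k) (\<lambda>c. \<Sum>m<r. ?t c m)
      = (\<Sum>m<r. real (N (Suc k + m)) * expect (counts k)
            (\<lambda>c. min 1 (upd k v c / \<theta> * ?d (Suc k) m)))"
    by (simp only: Bochner_Integration.integral_sum[OF integrable_counts] integral_mult_right_zero)
  also have "\<dots> \<le> (\<Sum>m<r. real (N (Suc k + m)) * min 1 (v / \<theta> * ?d k (Suc m)))"
  proof (intro sum_mono mult_left_mono expectation_min_le)
    fix m
    have "expect (counts k) (\<lambda>c. upd k v c / \<theta> * ?d (Suc k) m)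
        = v * b1 k / \<theta> * ?d (Suc k) m"
      by (simp add: upd_mean)
    also have "\<dots> \<le> v * (q k / p k) / \<theta> * ?d (Suc k) m"
      using v \<theta>_pos d_nonneg b1 by (intro mult_right_mono divide_right_mono mult_left_mono) auto
    also have "\<dots> = v / \<theta> * ?d k (Suc m)"
      by (simp add: drift_Suc mult_ac)
    finally show "expect (counts k) (\<lambda>c. upd k v c / \<theta> * ?d (Suc k) m) \<le> v / \<theta> * ?d k (Suc m)" .
  qed auto
  finally have "cost P (prog (Suc r) k v) \<le> of_nat (N k) + ennreal (\<Sum>m<r. real (N (Suc k + m)) * min 1 (v / \<theta> * ?d k (Suc m)))"
    unfolding cost_prog_Suc by (auto intro: add_left_mono ennreal_leI order.trans)
  also have "\<dots> = ennreal (real (N k) + (\<Sum>m<r. real (N (Suc k + m)) * min 1 (v / \<theta> * ?d k (Suc m))))"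
  proof (subst ennreal_plus)
    show "0 \<le> (\<Sum>m<r. real (N (Suc k + m)) * min 1 (v / \<theta> * ?d k (Suc m)))"
      using v d_nonneg \<theta>_pos by (intro sum_nonneg mult_nonneg_nonneg) auto
  qed (simp_all add: ennreal_of_nat_eq_real_of_nat)
  also have "real (N k) + (\<Sum>m<r. real (N (Suc k + m)) * min 1 (v / \<theta> * ?d k (Suc m)))
     = (\<Sum>m<Suc r. real (N (k + m)) * min 1 (v / \<theta> * ?d k m))"
    using Suc.prems \<theta>_pos by (subst sum.lessThan_Suc_shift) (simp add: min_def)
  finally show ?case .
qed simp

text \<open>A nonzero second component arises only at the leaf, after all r levels have been paid
  for.\<close>

lemma unfinished_cost:
  "(\<integral>\<^sup>+ a. of_nat (snd a) \<partial>(sem P (prog r k v))) * of_nat (\<Sum>m<r. N (k + m)) \<le> cost P (prog r k v)"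
proof (induction r arbitrary: k v)
  case (Suc r)
  let ?U = "\<lambda>r k v. \<integral>\<^sup>+ a. of_nat (snd a) \<partial>(sem P (prog r k v)) :: ennreal"
  let ?T = "of_nat (\<Sum>m<r. N (Suc k + m)) :: ennreal"
  have one: "?U r k v \<le> 1" for r k v
  proof -
    have "?U r k v \<le> (\<integral>\<^sup>+ a. 1 \<partial>(sem P (prog r k v)))"
    proof (rule nn_integral_mono_AE, unfold AE_measure_pmf_iff, rule ballI)
      fix a assume "a \<in> set_pmf (sem P (prog r k v))"
      then have "real (snd a) \<le> 1"
        using prog_range by fastforce
      then show "(of_nat (snd a) :: ennreal) \<le> 1"
        by (simp add: ennreal_of_nat_eq_real_of_nat)
    qed
    then show ?thesis by (simp add: measure_pmf.emeasure_space_1)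
  qed
  have U: "?U (Suc r) k v = (\<integral>\<^sup>+ c. (if upd k v c \<le> \<theta> then 0 else ?U r (Suc k) (upd k v c)) \<partial>(counts k))"
    unfolding sem_prog_Suc nn_integral_bind_pmf by (intro nn_integral_cong) auto
  have sum: "(\<Sum>m<Suc r. N (k + m)) = N k + (\<Sum>m<r. N (Suc k + m))"
    by (subst sum.lessThan_Suc_shift) simp
  have "?U (Suc r) k v * of_nat (\<Sum>m<Suc r. N (k + m))
      = ?U (Suc r) k v * of_nat (N k) + ?U (Suc r) k v * ?T"
    unfolding sum of_nat_add by (rule distrib_left)
  also have "\<dots> \<le> of_nat (N k) + ?U (Suc r) k v * ?T"
    using mult_right_mono[OF one[of "Suc r" k v], of "of_nat (N k)"]
    by (intro add_right_mono) (simp del: descend.simps(2))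
  also have "?U (Suc r) k v * ?T
    = (\<integral>\<^sup>+ c. (if upd k v c \<le> \<theta> then 0 else ?U r (Suc k) (upd k v c)) * ?T \<partial>(counts k))"
    unfolding U by (simp add: nn_integral_multc)
  also have "\<dots> \<le> (\<integral>\<^sup>+ c. (if upd k v c \<le> \<theta> then 0 else cost P (prog r (Suc k) (upd k v c))) \<partial>(counts k))"
  proof (intro nn_integral_mono)
    fix c
    show "(if upd k v c \<le> \<theta> then 0 else ?U r (Suc k) (upd k v c)) * ?T
      \<le> (if upd k v c \<le> \<theta> then 0 else cost P (prog r (Suc k) (upd k v c)))"
      using Suc.IH[of "Suc k" "upd k v c"] by simp
  qed
  finally show ?case
    unfolding cost_prog_Suc by (simp add: add_left_mono)
qed simp

end

section \<open>Trees of intervals\<close>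

text \<open>Multiplied by N + 2, the left-hand side is the probability of exactly one success in N +
  2 trials.\<close>

lemma binomial_single_hit_le:
  fixes p :: real
  assumes "0 \<le> p" "p \<le> 1"
  shows "p * (1 - p) ^ Suc N \<le> 1 / real (N + 2)"
proof -
  have "pmf (binomial_pmf (N + 2) p) 1 \<le> 1"
    by (rule pmf_le_1)
  then have "real (N + 2) * (p * (1 - p) ^ Suc N) \<le> 1"
    using assms by (simp add: mult.assoc)
  then show ?thesis
    by (simp add: field_simps del: power_Suc)
qed

lemma prod_add_1_le_exp:
  fixes a :: "'a \<Rightarrow> real"
  assumes "\<And>i. i \<in> I \<Longrightarrow> 0 \<le> a i"
  shows "(\<Prod>i\<in>I. 1 + a i) \<le> exp (sum a I)"
proof (cases "finite I")
  case True
  then show ?thesis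
    using assms by (auto simp: exp_sum intro!: prod_mono)
qed simp

lemma exp_le_1_plus_2x:
  fixes x :: real
  assumes "0 \<le> x" "x \<le> 1"
  shows "exp x \<le> 1 + 2 * x"
  using exp_bound[OF assms] assms mult_left_le[of x x] by (simp add: power2_eq_square)

text \<open>Each dyadic block contributes at most 1. Hence depth 2^j raises the error by a factor 1
  + j only.\<close>

lemma harmonic_dyadic_le: "(\<Sum>l<2 ^ j. 1 / real (Suc l)) \<le> 1 + real j"
proof (induction j)
  case (Suc j)
  have "(\<Sum>l<2 ^ Suc j. 1 / real (Suc l)) = (\<Sum>l<2 ^ j. 1 / real (Suc l)) + (\<Sum>l=2 ^ j..<2 ^ Suc j. 1 / real (Suc l))"
    by (subst sum.atLeastLessThan_concat[of 0 "2 ^ j" "2 ^ Suc j", symmetric, unfolded atLeast0LessThan]) auto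
  also have "(\<Sum>l=2 ^ j..<2 ^ Suc j. 1 / real (Suc l)) \<le> (\<Sum>l=(2::nat) ^ j..<2 ^ Suc j. 1 / 2 ^ j)"
  proof (intro sum_mono divide_left_mono)
    fix l :: nat assume "l \<in> {2 ^ j..<2 ^ Suc j}"
    then have "real (2 ^ j) \<le> real (Suc l)" by (subst of_nat_le_iff) auto
    then show "2 ^ j \<le> real (Suc l)" by simp
  qed auto
  also have "\<dots> = 1"
    by simp
  finally show ?case
    using Suc by simp
qed simp

text \<open>\<open>A k x\<close> is the node of level k around x. The root is the whole line rather
  than \<open>J\<close>, so that conditional masses multiply to the unconditional mass in
  \<open>prod_ratio\<close>; all lower nodes lie in \<open>J\<close>, which makes level 0
  exceptional below.\<close>

locale binary_tree =
  fixes J :: "int set" and A :: "nat \<Rightarrow> int \<Rightarrow> int set"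
  assumes finite_J: "finite J"
    and A_0: "A 0 x = UNIV"
    and A_self: "x \<in> J \<Longrightarrow> x \<in> A k x"
    and A_sub: "x \<in> J \<Longrightarrow> A (Suc k) x \<subseteq> J"
    and A_decreasing: "A (Suc k) x \<subseteq> A k x"
    and A_class: "\<lbrakk>x \<in> J; y \<in> J; y \<in> A k x\<rbrakk> \<Longrightarrow> A k y = A k x"
    and A_binary: "x \<in> J \<Longrightarrow> card (A (Suc k) ` (A k x \<inter> J)) \<le> 2"
begin

definition ratio :: "int pmf \<Rightarrow> nat \<Rightarrow> int \<Rightarrow> real" where
  "ratio W k x = mass W (A (Suc k) x) / mass W (A k x)"

lemma ratio_bounds: "0 \<le> ratio W k x" "ratio W k x \<le> 1"
  using prob_ratio_bounds[OF A_decreasing, of W k x] by (auto simp: ratio_def)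

lemma A_pos: "x \<in> J \<Longrightarrow> pmf W x > 0 \<Longrightarrow> mass W (A k x) > 0"
  using A_self by (intro measure_pmf_posI[of x]) (auto simp: set_pmf_iff)

lemma ratio_pos: "x \<in> J \<Longrightarrow> pmf W x > 0 \<Longrightarrow> ratio W k x > 0"
  using A_pos by (auto simp: ratio_def)

lemma prod_ratio:
  assumes "x \<in> J" "pmf W x > 0"
  shows "(\<Prod>l<k. ratio W l x) = mass W (A k x)"
proof (induction k)
  case 0
  show ?case by (simp add: A_0)
next
  case (Suc k)
  then show ?case
    using A_pos[OF assms, of k] by (simp add: ratio_def)
qed

text \<open>A function of the nodes of level k, written as a function of their points so that sums
  over \<open>J\<close> need no choice of representatives.\<close>

definition constant_on_level :: "nat \<Rightarrow> (int \<Rightarrow> real) \<Rightarrow> bool" where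
  "constant_on_level k \<phi> \<longleftrightarrow> (\<forall>x\<in>J. \<forall>y\<in>J. A k x = A k y \<longrightarrow> \<phi> x = \<phi> y)"

lemma same_parent: "x \<in> J \<Longrightarrow> y \<in> J \<Longrightarrow> A (Suc k) x = A (Suc k) y \<Longrightarrow> A k x = A k y"
  using A_self[of x "Suc k"] A_decreasing[of k y] A_class[of y x k] by auto

lemma constant_on_level_ratio: "constant_on_level (Suc k) (\<lambda>x. h (ratio P k x) (ratio Q k x))"
  unfolding constant_on_level_def ratio_def using same_parent by metis

lemma constant_on_level_Suc: "constant_on_level k \<phi> \<Longrightarrow> constant_on_level (Suc k) \<phi>"
  unfolding constant_on_level_def using same_parent by blast

lemma constant_on_level_mult:
  "constant_on_level k \<phi> \<Longrightarrow> constant_on_level k \<psi> \<Longrightarrow> constant_on_level k (\<lambda>x. \<phi> x * \<psi> x)"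
  unfolding constant_on_level_def by metis

lemma constant_on_level_prod:
  assumes "\<And>l. constant_on_level (Suc l) (\<phi> l)"
  shows "constant_on_level k (\<lambda>x. \<Prod>l<k. \<phi> l x)"
proof (induction k)
  case (Suc k)
  then show ?case
    by (simp add: constant_on_level_mult constant_on_level_Suc assms)
qed (simp add: constant_on_level_def)

text \<open>The points of a node are grouped by child; on a child \<open>\<beta>\<close> is
  constant, so the group sums to the mass of the child times that constant.\<close>

lemma children_sum:
  assumes x: "x \<in> J" and \<beta>: "constant_on_level (Suc k) \<beta>"
    and t: "\<And>y. y \<in> A k x \<inter> J \<Longrightarrow> mass W (A (Suc k) y) * \<beta> y \<le> t (A (Suc k) y)"
  shows "(\<Sum>y\<in>A k x \<inter> J. pmf W y * \<beta> y) \<le> (\<Sum>c\<in>A (Suc k) ` (A k x \<inter> J). t c)"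
proof -
  have fin: "finite (A k x \<inter> J)"
    using finite_J by simp
  have "(\<Sum>y\<in>A k x \<inter> J. pmf W y * \<beta> y)
    = (\<Sum>c\<in>A (Suc k) ` (A k x \<inter> J). \<Sum>y\<in>{y\<in>A k x \<inter> J. A (Suc k) y = c}. pmf W y * \<beta> y)"
    by (rule sum.image_gen[OF fin])
  also have "\<dots> \<le> (\<Sum>c\<in>A (Suc k) ` (A k x \<inter> J). t c)"
  proof (intro sum_mono)
    fix c assume "c \<in> A (Suc k) ` (A k x \<inter> J)"
    then obtain z where z: "z \<in> A k x" "z \<in> J" "c = A (Suc k) z"
      by auto
    have c: "{y\<in>A k x \<inter> J. A (Suc k) y = c} = c"
    proof safe
      fix y assume "y \<in> c"
      then have "y \<in> J" "y \<in> A k z"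
        using z A_sub[of z k] A_decreasing[of k z] by auto
      moreover have "A k z = A k x"
        using A_class[OF x z(2,1)] .
      ultimately show "y \<in> J" "y \<in> A k x" and "\<And>w. w \<in> A (Suc k) y \<Longrightarrow> w \<in> c" "\<And>w. w \<in> c \<Longrightarrow> w \<in> A (Suc k) y"
        using A_class[of z y "Suc k"] z \<open>y \<in> c\<close> by auto
    qed (use z A_self in auto)
    have "finite c"
      using z A_sub[of z k] finite_J by (auto intro: finite_subset)
    then have "mass W c = (\<Sum>y\<in>c. pmf W y)"
      by (rule measure_measure_pmf_finite)
    moreover have "(\<Sum>y\<in>c. pmf W y * \<beta> y) = (\<Sum>y\<in>c. pmf W y * \<beta> z)"
    proof (intro sum.cong refl arg_cong2[where f = "(*)"])
      fix y assume "y \<in> c"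
      then have "y \<in> J" "A (Suc k) y = A (Suc k) z"
        using c z(3) by auto
      then show "\<beta> y = \<beta> z"
        using \<beta> z(2) unfolding constant_on_level_def by blast
    qed
    ultimately have "(\<Sum>y\<in>c. pmf W y * \<beta> y) = mass W (A (Suc k) z) * \<beta> z"
      using z(3) by (simp add: sum_distrib_right)
    also have "\<dots> \<le> t c"
      using t[of z] z by auto
    finally show "(\<Sum>y\<in>{y\<in>A k x \<inter> J. A (Suc k) y = c}. pmf W y * \<beta> y) \<le> t c"
      unfolding c .
  qed
  finally show ?thesis .
qed

text \<open>The induction step from one level to the next: the factor \<open>\<phi>\<close>
  collected so far is constant on a node and can be pulled out before the bound for its children is
  applied. The root has mass 1, which \<open>J\<close> may not have; hence the case
  distinction.\<close>

lemma level_sum: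
  assumes \<phi>: "constant_on_level k \<phi>" "\<And>x. 0 \<le> \<phi> x" "k = 0 \<Longrightarrow> \<phi> = (\<lambda>x. 1)"
    and r: "\<And>x. x \<in> J \<Longrightarrow> (\<Sum>y\<in>A k x \<inter> J. pmf W y * \<beta> y) \<le> r * mass W (A k x)" "0 \<le> r"
  shows "(\<Sum>x\<in>J. pmf W x * (\<phi> x * \<beta> x)) \<le> r * (if k = 0 then 1 else \<Sum>x\<in>J. pmf W x * \<phi> x)"
proof (cases "J = {}")
  case True
  then show ?thesis using r by simp
next
  case False
  then obtain x0 where x0: "x0 \<in> J" by blast
  show ?thesis
  proof (cases k)
    case 0
    then show ?thesis
      using r(1)[OF x0] \<phi>(3) by (simp add: A_0)
  next
    case (Suc k')
    have sub: "{y\<in>J. A k y = A k z} = A k z" if "z \<in> J" for z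
      using that A_self[of _ k] A_sub[of z k'] A_class[of z _ k] Suc by blast
    have finite_A: "finite (A k z)" if "z \<in> J" for z
      using that A_sub[of z k'] Suc finite_J by (auto intro: finite_subset)
    have gen: "(\<Sum>x\<in>J. pmf W x * (\<phi> x * \<gamma> x)) = (\<Sum>c\<in>A k ` J. \<Sum>y\<in>{y\<in>J. A k y = c}. pmf W y * (\<phi> y * \<gamma> y))" for \<gamma>
      by (rule sum.image_gen[OF finite_J])
    have "(\<Sum>x\<in>J. pmf W x * (\<phi> x * \<beta> x)) \<le> (\<Sum>c\<in>A k ` J. r * (\<Sum>y\<in>{y\<in>J. A k y = c}. pmf W y * (\<phi> y * 1)))"
      unfolding gen[of \<beta>]
    proof (intro sum_mono)
      fix c assume "c \<in> A k ` J"
      then obtain z where z: "z \<in> J" "c = A k z" by auto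
      have \<phi>_eq: "\<phi> y = \<phi> z" if "y \<in> A k z" for y
        using that \<phi>(1) z sub[OF z(1)] unfolding constant_on_level_def by blast
      have "(\<Sum>y\<in>A k z. pmf W y * (\<phi> y * \<beta> y)) = \<phi> z * (\<Sum>y\<in>A k z \<inter> J. pmf W y * \<beta> y)"
        using A_sub[OF z(1), of k'] Suc
        by (auto simp: sum_distrib_left \<phi>_eq mult_ac Int_absorb2 intro!: sum.cong)
      also have "\<dots> \<le> \<phi> z * (r * mass W (A k z))"
        by (intro mult_left_mono r \<phi> z)
      also have "\<dots> = r * (\<Sum>y\<in>A k z. pmf W y * (\<phi> y * 1))"
        by (simp add: measure_measure_pmf_finite[OF finite_A[OF z(1)]] sum_distrib_left \<phi>_eq mult_ac cong: sum.cong)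
      finally show "(\<Sum>y\<in>{y\<in>J. A k y = c}. pmf W y * (\<phi> y * \<beta> y)) \<le> r * (\<Sum>y\<in>{y\<in>J. A k y = c}. pmf W y * (\<phi> y * 1))"
        unfolding z(2) sub[OF z(1)] .
    qed
    also have "\<dots> = r * (\<Sum>x\<in>J. pmf W x * (\<phi> x * 1))"
      unfolding gen[of "\<lambda>_. 1"] sum_distrib_left ..
    finally show ?thesis
      using Suc by simp
  qed
qed

lemma finite_children: "finite (A (Suc k) ` (A k x \<inter> J))"
  using finite_J by simp

lemma children_sum_const:
  assumes "x \<in> J" "constant_on_level (Suc k) \<beta>" "0 \<le> t"
    and "\<And>y. y \<in> A k x \<inter> J \<Longrightarrow> mass W (A (Suc k) y) * \<beta> y \<le> t"
  shows "(\<Sum>y\<in>A k x \<inter> J. pmf W y * \<beta> y) \<le> 2 * t"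
proof -
  have "(\<Sum>y\<in>A k x \<inter> J. pmf W y * \<beta> y) \<le> (\<Sum>c\<in>A (Suc k) ` (A k x \<inter> J). t)"
    using assms by (intro children_sum) auto
  also have "\<dots> = real (card (A (Suc k) ` (A k x \<inter> J))) * t"
    by simp
  also have "\<dots> \<le> 2 * t"
    using A_binary[OF assms(1), of k] assms(3) by (intro mult_right_mono) auto
  finally show ?thesis .
qed

lemma A_eq_of_mem: "x \<in> J \<Longrightarrow> y \<in> A k x \<inter> J \<Longrightarrow> A k y = A k x"
  using A_class by auto

text \<open>A child of conditional mass p is weighted by p, which cancels 1/p, so a level
  contributes its number of children, at most 2. The 1 is subtracted under the sum: outside it would
  leave a term 1 - P(J), which is not small in terms of a.\<close>

lemma sum_prod_inverse_ratio:
  assumes a: "\<And>l. 0 \<le> a l"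
  shows "(\<Sum>x\<in>J. pmf P x * ((\<Prod>l<k. 1 + a l / ratio P l x) - 1)) \<le> (\<Prod>l<k. 1 + 2 * a l) - 1"
proof (induction k)
  case 0
  show ?case by simp
next
  case (Suc k)
  let ?F = "\<lambda>k x. \<Prod>l<k. 1 + a l / ratio P l x"
  let ?s = "\<lambda>k. \<Sum>x\<in>J. pmf P x * (?F k x - 1)"
  have const: "constant_on_level k (?F k)"
    by (intro constant_on_level_prod constant_on_level_ratio[where h = "\<lambda>p q. 1 + a _ / p"])
  have nonneg: "0 \<le> ?F k x" for x
    using a ratio_bounds by (intro prod_nonneg) (auto intro!: add_nonneg_nonneg divide_nonneg_nonneg)
  have child: "(\<Sum>y\<in>A k x \<inter> J. pmf P y * (1 / ratio P k y)) \<le> 2 * mass P (A k x)" if "x \<in> J" for x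
  proof (intro children_sum_const that constant_on_level_ratio[where h = "\<lambda>p q. 1 / p"])
    fix y assume "y \<in> A k x \<inter> J"
    then have "A k y = A k x"
      using A_eq_of_mem that by blast
    then show "mass P (A (Suc k) y) * (1 / ratio P k y) \<le> mass P (A k x)"
      by (simp add: ratio_def)
  qed auto
  have "(\<Sum>x\<in>J. pmf P x * (?F k x * (1 / ratio P k x))) \<le> 2 * (if k = 0 then 1 else \<Sum>x\<in>J. pmf P x * ?F k x)"
    by (intro level_sum const nonneg child) auto
  also have "(if k = 0 then 1 else \<Sum>x\<in>J. pmf P x * ?F k x) \<le> ?s k + 1"
  proof -
    have "(\<Sum>x\<in>J. pmf P x) \<le> 1"
      using measure_measure_pmf_finite[OF finite_J, of P] by (metis measure_pmf.prob_le_1)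
    then show ?thesis
      by (auto simp: algebra_simps sum_subtractf)
  qed
  finally have *: "(\<Sum>x\<in>J. pmf P x * (?F k x * (1 / ratio P k x))) \<le> 2 * (?s k + 1)"
    by simp
  have "?s (Suc k) = ?s k + a k * (\<Sum>x\<in>J. pmf P x * (?F k x * (1 / ratio P k x)))"
    by (simp add: sum_distrib_left algebra_simps flip: sum.distrib)
  also have "\<dots> \<le> ?s k + a k * (2 * (?s k + 1))"
    by (intro add_left_mono mult_left_mono * a)
  also have "\<dots> = (?s k + 1) * (1 + 2 * a k) - 1"
    by (simp add: algebra_simps)
  also have "\<dots> \<le> (\<Prod>l<k. 1 + 2 * a l) * (1 + 2 * a k) - 1"
    using Suc a by (intro diff_right_mono mult_right_mono) auto
  finally show ?case
    by simp
qed

text \<open>The relative bias of (N + 1)/(c + 1) is (1 - p)^(N+1). A child is weighted by p, and p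
  (1 - p)^(N+1) is small uniformly in p.\<close>

lemma sum_miss_prob: "(\<Sum>x\<in>J. pmf P x * (1 - ratio P k x) ^ Suc N) \<le> 2 / real (N + 2)"
proof -
  have "(\<Sum>y\<in>A k x \<inter> J. pmf P y * (1 - ratio P k y) ^ Suc N) \<le> 2 * (mass P (A k x) / real (N + 2))"
    if "x \<in> J" for x
  proof (intro children_sum_const that constant_on_level_ratio[where h = "\<lambda>p q. (1 - p) ^ Suc N"])
    fix y assume "y \<in> A k x \<inter> J"
    then have eq: "A k y = A k x"
      using A_eq_of_mem that by blast
    have "mass P (A (Suc k) y) \<le> mass P (A k x)"
      using A_decreasing[of k y] eq by (intro measure_pmf.finite_measure_mono) auto
    then have "mass P (A (Suc k) y) = mass P (A k x) * ratio P k y"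
      by (cases "mass P (A k x) = 0") (auto simp: ratio_def eq measure_le_0_iff)
    then have "mass P (A (Suc k) y) * (1 - ratio P k y) ^ Suc N
        = mass P (A k x) * (ratio P k y * (1 - ratio P k y) ^ Suc N)"
      by simp
    also have "\<dots> \<le> mass P (A k x) * (1 / real (N + 2))"
      by (intro mult_left_mono binomial_single_hit_le ratio_bounds) auto
    finally show "mass P (A (Suc k) y) * (1 - ratio P k y) ^ Suc N \<le> mass P (A k x) / real (N + 2)"
      by simp
  qed auto
  then have "(\<Sum>x\<in>J. pmf P x * (1 * (1 - ratio P k x) ^ Suc N)) \<le> 2 / real (N + 2) * (if k = 0 then 1 else \<Sum>x\<in>J. pmf P x * 1)"
    by (intro level_sum) (auto simp: constant_on_level_def)
  also have "\<dots> \<le> 2 / real (N + 2) * 1"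
    using measure_measure_pmf_finite[OF finite_J, of P] measure_pmf.prob_le_1[of P J]
    by (intro mult_left_mono) auto
  finally show ?thesis
    by simp
qed

text \<open>Under Q a child is weighted by its conditional Q-mass, which cancels the denominator;
  the numerators p + 1/N of at most two children sum to at most 1 + 2/N.\<close>

lemma sum_prod_ratio_quotient:
  assumes N: "\<And>l. N l > (0::real)"
  shows "(\<Sum>x\<in>J. pmf Q x * (\<Prod>l<k. (ratio P l x + 1 / N l) / ratio Q l x)) \<le> (\<Prod>l<k. 1 + 2 / N l)"
proof (induction k)
  case 0
  then show ?case
    using measure_measure_pmf_finite[OF finite_J, of Q] measure_pmf.prob_le_1[of Q J] by simp
next
  case (Suc k)
  let ?b = "\<lambda>k x. (ratio P k x + 1 / N k) / ratio Q k x"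
  let ?F = "\<lambda>k x. \<Prod>l<k. ?b l x"
  have const: "constant_on_level k (?F k)"
    by (intro constant_on_level_prod constant_on_level_ratio[where h = "\<lambda>p q. (p + 1 / N _) / q"])
  have b_nonneg: "0 \<le> ?b k x" for k x
    using N[of k] ratio_bounds by (auto intro!: divide_nonneg_nonneg add_nonneg_nonneg)
  have child: "(\<Sum>y\<in>A k x \<inter> J. pmf Q y * ?b k y) \<le> (1 + 2 / N k) * mass Q (A k x)" if x: "x \<in> J" for x
  proof -
    let ?PA = "mass P (A k x)" and ?QA = "mass Q (A k x)"
    let ?C = "A (Suc k) ` (A k x \<inter> J)"
    have "(\<Sum>y\<in>A k x \<inter> J. pmf Q y * ?b k y) \<le> (\<Sum>c\<in>?C. ?QA * (mass P c / ?PA) + ?QA / N k)"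
    proof (intro children_sum x constant_on_level_ratio[where h = "\<lambda>p q. (p + 1 / N _) / q"])
      fix y assume "y \<in> A k x \<inter> J"
      then have eq: "A k y = A k x"
        using A_eq_of_mem x by blast
      show "mass Q (A (Suc k) y) * ?b k y \<le> ?QA * (mass P (A (Suc k) y) / ?PA) + ?QA / N k"
      proof (cases "mass Q (A (Suc k) y) = 0")
        case False
        then have "mass Q (A (Suc k) y) * ?b k y = ?QA * (ratio P k y + 1 / N k)"
          by (simp add: ratio_def[of Q] eq)
        then show ?thesis
          by (simp add: ratio_def[of P] eq distrib_left)
      qed (use N[of k] in simp)
    qed
    also have "\<dots> = ?QA * ((\<Sum>c\<in>?C. mass P c) / ?PA) + real (card ?C) * (?QA / N k)"
      by (simp add: sum.distrib sum_distrib_left sum_divide_distrib)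
    also have "\<dots> \<le> ?QA * 1 + 2 * (?QA / N k)"
    proof (intro add_mono mult_left_mono mult_right_mono)
      have disj: "pairwise disjnt ?C"
      proof (intro pairwiseI)
        fix c d assume "c \<in> ?C" "d \<in> ?C" "c \<noteq> d"
        then obtain y z where "y \<in> J" "z \<in> J" "c = A (Suc k) y" "d = A (Suc k) z" by auto
        then show "disjnt c d"
          using \<open>c \<noteq> d\<close> A_class[of y _ "Suc k"] A_class[of z _ "Suc k"] A_sub[of y k] unfolding disjnt_iff by blast
      qed
      have "(\<Sum>c\<in>?C. mass P c) = mass P (\<Union>?C)"
        using disj by (subst measure_pmf.finite_measure_finite_Union[symmetric, of _ "\<lambda>c. c", simplified])
          (auto simp: finite_children disjoint_family_on_disjoint_image disjoint_family_on_def pairwise_def disjnt_def)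
      also have "\<dots> \<le> ?PA"
      proof (intro measure_pmf.finite_measure_mono)
        show "\<Union> ?C \<subseteq> A k x"
          using A_eq_of_mem[OF x, of _ k] A_decreasing[of k] by blast
      qed auto
      finally show "(\<Sum>c\<in>?C. mass P c) / ?PA \<le> 1"
        by (simp add: divide_le_eq_1 less_le)
      show "real (card ?C) \<le> 2"
        using A_binary[OF x, of k] by simp
    qed (use N[of k] in auto)
    finally show ?thesis
      by (simp add: algebra_simps)
  qed
  have "(\<Sum>x\<in>J. pmf Q x * ?F (Suc k) x) = (\<Sum>x\<in>J. pmf Q x * (?F k x * ?b k x))"
    by simp
  also have "\<dots> \<le> (1 + 2 / N k) * (if k = 0 then 1 else \<Sum>x\<in>J. pmf Q x * ?F k x)"
    using N[of k] by (intro level_sum const child prod_nonneg b_nonneg) auto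
  also have "\<dots> \<le> (1 + 2 / N k) * (\<Prod>l<k. 1 + 2 / N l)"
    using Suc N[of k] by (intro mult_left_mono) auto
  finally show ?case
    by (simp add: mult.commute)
qed

end

section \<open>Dyadic cells and points of low tilt\<close>

text \<open>Half of the jump at x is counted, so that x is separated by at least Q(x)/2 from its
  neighbours on both sides. For the plain distribution function, one of the two gaps would depend on
  the neighbour's mass alone.\<close>

definition mid_cdf :: "int pmf \<Rightarrow> int \<Rightarrow> real" where
  "mid_cdf Q x = mass Q {..<x} + pmf Q x / 2"

lemma prob_split:
  assumes "S \<inter> T = {}"
  shows "mass Q (S \<union> T) = mass Q S + mass Q T"
  using assms by (intro measure_pmf.finite_measure_Union) auto

lemma mid_cdf_diff:
  assumes "x < y"
  shows "mid_cdf Q y - mid_cdf Q x = mass Q {x..<y} + (pmf Q y - pmf Q x) / 2"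
proof -
  have "{..<y} = {..<x} \<union> {x..<y}"
    using assms by auto
  then show ?thesis
    by (simp add: mid_cdf_def prob_split diff_divide_distrib ivl_disj_int)
qed

lemma pmf_le_prob: "x \<in> S \<Longrightarrow> pmf Q x \<le> mass Q S"
  unfolding measure_pmf_single[symmetric] by (intro measure_pmf.finite_measure_mono) auto

lemma mid_cdf_gap:
  assumes "x < y"
  shows "pmf Q x / 2 + pmf Q y / 2 \<le> mid_cdf Q y - mid_cdf Q x"
proof -
  have "pmf Q x \<le> mass Q {x..<y}"
    using assms by (intro pmf_le_prob) auto
  then show ?thesis
    unfolding mid_cdf_diff[OF assms] by (simp add: diff_divide_distrib)
qed

lemma mid_cdf_mono:
  assumes "x \<le> y"
  shows "mid_cdf Q x \<le> mid_cdf Q y"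
proof (cases "x < y")
  case True
  then show ?thesis
    using mid_cdf_gap[of x y Q] pmf_nonneg[of Q x] pmf_nonneg[of Q y] by linarith
qed (use assms in simp)

text \<open>Only the two end points are counted by half, so a node with several points in a cell of
  width 2^-k has mass at most 2 / 2^k.\<close>

lemma prob_interval_le_mid_cdf_diff:
  assumes "x < y"
  shows "mass Q {x..y} \<le> 2 * (mid_cdf Q y - mid_cdf Q x)"
proof -
  have "{x..y} = {x..<y} \<union> {y}"
    using assms by auto
  then have "mass Q {x..y} = mass Q {x..<y} + pmf Q y"
    by (metis prob_split[of "{x..<y}" "{y}" Q] measure_pmf_single Int_insert_right_if0 Int_empty_right
        atLeastLessThan_iff less_irrefl)
  then show ?thesis
    using mid_cdf_diff[OF assms, of Q] pmf_le_prob[of x "{x..<y}" Q] assms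
    by (simp add: diff_divide_distrib)
qed

lemma mid_cdf_bounds: "0 \<le> mid_cdf Q x" "mid_cdf Q x \<le> 1"
proof -
  have "mass Q ({..<x} \<union> {x}) \<le> 1"
    by (rule measure_pmf.prob_le_1)
  then have "mass Q {..<x} + pmf Q x \<le> 1"
    by (subst (asm) prob_split) (auto simp: measure_pmf_single)
  then show "mid_cdf Q x \<le> 1"
    using pmf_nonneg[of Q x] unfolding mid_cdf_def by linarith
qed (simp add: mid_cdf_def)

section \<open>Dyadic cells and the tree of their nodes\<close>

definition cell :: "int pmf \<Rightarrow> nat \<Rightarrow> int \<Rightarrow> int" where
  "cell Q k x = \<lfloor>2 ^ k * mid_cdf Q x\<rfloor>"

text \<open>Levels are one ahead of cells: level 0 is the whole line, and the cells of width 1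
  already split it in two, because \<open>mid_cdf\<close> can take the value 1 to the right of the
  support.\<close>

fun node :: "int pmf \<Rightarrow> int set \<Rightarrow> nat \<Rightarrow> int \<Rightarrow> int set" where
  "node Q J 0 x = UNIV"
| "node Q J (Suc k) x = {y\<in>J. cell Q k y = cell Q k x}"

lemma cell_mono: "x \<le> y \<Longrightarrow> cell Q k x \<le> cell Q k y"
  unfolding cell_def by (intro floor_mono mult_left_mono mid_cdf_mono) auto

lemma cell_Suc: "cell Q (Suc k) x \<in> {2 * cell Q k x, 2 * cell Q k x + 1}"
  unfolding cell_def by (simp add: mult.assoc) linarith

lemma cell_0: "cell Q 0 x \<in> {0, 1}"
  using mid_cdf_bounds[of Q x] unfolding cell_def by simp linarith

lemma binary_tree_node:
  assumes "finite J"
  shows "binary_tree J (node Q J)"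
proof
  fix k x y
  show "node Q J (Suc k) x \<subseteq> node Q J k x"
  proof (cases k)
    case (Suc l)
    show ?thesis
    proof
      fix y assume y: "y \<in> node Q J (Suc k) x"
      then show "y \<in> node Q J k x"
        using cell_Suc[of Q l x] cell_Suc[of Q l y] Suc by auto
    qed
  qed simp
  show "x \<in> node Q J k x" if "x \<in> J"
    using that by (cases k) auto
  show "node Q J k y = node Q J k x" if "x \<in> J" "y \<in> J" "y \<in> node Q J k x"
    using that by (cases k) auto
  show "card (node Q J (Suc k) ` (node Q J k x \<inter> J)) \<le> 2" if "x \<in> J"
  proof -
    define c where "c = (case k of 0 \<Rightarrow> 0 | Suc l \<Rightarrow> 2 * cell Q l x)"
    have "node Q J (Suc k) ` (node Q J k x \<inter> J) \<subseteq> (\<lambda>i. {y\<in>J. cell Q k y = i}) ` {c, c + 1}"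
    proof (rule image_subsetI)
      fix y assume y: "y \<in> node Q J k x \<inter> J"
      have "cell Q k y \<in> {c, c + 1}"
      proof (cases k)
        case 0
        then show ?thesis using cell_0[of Q y] by (simp add: c_def)
      next
        case (Suc l)
        then show ?thesis using cell_Suc[of Q l y] y by (simp add: c_def)
      qed
      then show "node Q J (Suc k) y \<in> (\<lambda>i. {y\<in>J. cell Q k y = i}) ` {c, c + 1}"
        by (intro image_eqI[of _ _ "cell Q k y"]) auto
    qed
    then have "card (node Q J (Suc k) ` (node Q J k x \<inter> J)) \<le> card ((\<lambda>i. {y\<in>J. cell Q k y = i}) ` {c, c + 1})"
      by (intro card_mono) auto
    also have "\<dots> \<le> card {c, c + 1}"
      by (rule card_image_le) simp
    finally show ?thesis by simp
  qed
qed (use assms in auto)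

text \<open>\<open>mid_cdf\<close> is monotone, so a cell meets the window in an interval; this is
  what makes queries to nodes legal.\<close>

lemma node_interval:
  assumes "x \<in> {a..b}"
  shows "\<exists>i j. i \<le> j \<and> node Q {a..b} (Suc k) x = {i..j}"
proof -
  let ?S = "node Q {a..b} (Suc k) x"
  have fin: "finite ?S"
    by (rule finite_subset[of _ "{a..b}"]) auto
  have x: "x \<in> ?S"
    using assms by auto
  have "?S = {Min ?S..Max ?S}"
  proof (intro equalityI subsetI)
    fix y assume "y \<in> ?S"
    then show "y \<in> {Min ?S..Max ?S}"
      using fin by (simp del: node.simps)
  next
    fix y assume y: "y \<in> {Min ?S..Max ?S}"
    have mem: "Min ?S \<in> ?S" "Max ?S \<in> ?S"
      using fin x by (intro Min_in Max_in; blast)+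
    then have "cell Q k (Min ?S) \<le> cell Q k y" "cell Q k y \<le> cell Q k (Max ?S)"
      using y by (auto intro!: cell_mono simp del: node.simps)
    then show "y \<in> ?S"
      using mem y by auto
  qed
  moreover have "Min ?S \<le> Max ?S"
    using fin x by (meson Max_ge Min_le order.trans)
  ultimately show ?thesis
    by blast
qed

lemma legal_node:
  assumes "x \<in> {a..b}" "pmf P x > 0"
  shows "legal_query P (node Q {a..b} k x)"
proof -
  have "x \<in> node Q {a..b} k x"
    using assms by (cases k) auto
  then have "mass P (node Q {a..b} k x) > 0"
    using assms by (intro measure_pmf_posI[of x]) (auto simp: set_pmf_iff)
  then show ?thesis
    using node_interval[OF assms(1), of Q] unfolding legal_query_def by (cases k) auto
qed

text \<open>By \<open>mid_cdf_gap\<close> every other point is at distance at least Q(x)/2 \<ge>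
  2^-k and so falls into another cell.\<close>

lemma node_singleton:
  assumes "x \<in> J" "pmf Q x > 0" "2 / 2 ^ k \<le> pmf Q x"
  shows "node Q J (Suc k) x = {x}"
proof -
  have "y = x" if "cell Q k y = cell Q k x" for y
  proof (rule ccontr)
    assume "y \<noteq> x"
    then consider "x < y" | "y < x" by linarith
    then have "pmf Q x / 2 \<le> \<bar>mid_cdf Q y - mid_cdf Q x\<bar>"
    proof cases
      case 1
      then show ?thesis using mid_cdf_gap[of x y Q] pmf_nonneg[of Q y] by linarith
    next
      case 2
      then show ?thesis using mid_cdf_gap[of y x Q] pmf_nonneg[of Q y] by linarith
    qed
    then have "1 / 2 ^ k \<le> \<bar>mid_cdf Q y - mid_cdf Q x\<bar>"
      using assms(3) by simp
    then have "1 \<le> 2 ^ k * \<bar>mid_cdf Q y - mid_cdf Q x\<bar>"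
      by (simp add: field_simps)
    also have "\<dots> = \<bar>2 ^ k * mid_cdf Q y - 2 ^ k * mid_cdf Q x\<bar>"
      by (simp add: abs_mult flip: right_diff_distrib)
    finally have "1 \<le> \<bar>2 ^ k * mid_cdf Q y - 2 ^ k * mid_cdf Q x\<bar>" .
    then show False
      using that unfolding cell_def by linarith
  qed
  then show ?thesis
    using assms(1) by auto
qed

text \<open>A level at which x is certainly alone, read off from Q(x); \<open>Suc\<close> is the
  offset between levels and cells.\<close>

definition depth :: "int pmf \<Rightarrow> int \<Rightarrow> nat" where
  "depth Q x = Suc (LEAST k. 2 / 2 ^ k \<le> pmf Q x)"

lemma ex_small_power:
  assumes "(0::real) < e"
  shows "\<exists>k. 2 / 2 ^ k \<le> e"
proof -
  obtain k where "(1 / 2) ^ k < e / 2"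
    using real_arch_pow_inv[of "e / 2" "1 / 2"] assms by auto
  then show ?thesis
    by (intro exI[of _ k]) (simp add: power_divide)
qed

lemma node_depth:
  assumes "x \<in> J" "pmf Q x > 0" "depth Q x \<le> k"
  shows "node Q J k x = {x}"
proof -
  obtain l where l: "k = Suc l"
    using assms(3) by (cases k) (auto simp: depth_def)
  have "2 / 2 ^ l \<le> (2::real) / 2 ^ (LEAST k. 2 / 2 ^ k \<le> pmf Q x)"
    using assms(3) l by (intro divide_left_mono power_increasing) (auto simp: depth_def)
  also have "\<dots> \<le> pmf Q x"
    by (rule LeastI_ex) (rule ex_small_power[OF assms(2)])
  finally show ?thesis
    unfolding l by (rule node_singleton[OF assms(1,2)])
qed

text \<open>Before its depth, x has mass below 2 / 2^k, and a node with further points lies in a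
  cell of width 2^-k. The 4 absorbs the offset m = k + 1.\<close>

lemma prob_node_le:
  assumes "x \<in> {a..b}" "m < depth Q x"
  shows "mass Q (node Q {a..b} m x) \<le> 4 / 2 ^ m"
proof (cases m)
  case 0
  then show ?thesis by simp
next
  case (Suc k)
  then have light: "pmf Q x < 2 / 2 ^ k"
    using assms(2) not_less_Least[of k "\<lambda>k. 2 / 2 ^ k \<le> pmf Q x"] by (simp add: depth_def not_le)
  obtain i j where ij: "i \<le> j" "node Q {a..b} (Suc k) x = {i..j}"
    using node_interval[OF assms(1), of Q k] by blast
  have x: "x \<in> {i..j}"
    unfolding ij(2)[symmetric] using assms(1) by simp
  show ?thesis
  proof (cases "i = j")
    case True
    then show ?thesis
      using Suc ij x light by (simp add: measure_pmf_single del: node.simps)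
  next
    case False
    have "i \<in> node Q {a..b} (Suc k) x" "j \<in> node Q {a..b} (Suc k) x"
      using ij by auto
    then have "cell Q k i = cell Q k j"
      by simp
    then have "2 ^ k * mid_cdf Q j - 2 ^ k * mid_cdf Q i \<le> 1"
      unfolding cell_def by linarith
    then have "mid_cdf Q j - mid_cdf Q i \<le> 1 / 2 ^ k"
      by (simp add: field_simps)
    then show ?thesis
      using prob_interval_le_mid_cdf_diff[of i j Q] False ij Suc by (simp del: node.simps)
  qed
qed

lemma ln_2_ge_half: "1 / 2 \<le> ln (2::real)"
  using ln2_ge_two_thirds by simp

lemma depth_le:
  assumes "pmf Q x > 0"
  shows "real (depth Q x) \<le> 3 + 2 * ln (1 / pmf Q x)"
proof (cases "LEAST k. 2 / 2 ^ k \<le> pmf Q x")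
  case 0
  then show ?thesis
    using assms pmf_le_1[of Q x] by (simp add: depth_def)
next
  case (Suc k)
  then have "pmf Q x < 2 / 2 ^ k"
    using not_less_Least[of k "\<lambda>k. 2 / 2 ^ k \<le> pmf Q x"] by (simp add: not_le)
  then have "2 ^ k < 2 * (1 / pmf Q x)"
    using assms by (simp add: field_simps)
  then have "ln (2 ^ k) < ln (2 * (1 / pmf Q x))"
    using assms by (subst ln_less_cancel_iff) auto
  then have "real k * ln 2 < ln 2 + ln (1 / pmf Q x)"
    using assms by (simp add: ln_realpow ln_mult ln_div)
  then have "(real k - 1) * ln 2 < ln (1 / pmf Q x)"
    by (simp add: algebra_simps)
  moreover have "0 \<le> ln (1 / pmf Q x)"
    using assms pmf_le_1[of Q x] by simp
  moreover have "(real k - 1) * (1 / 2) \<le> (real k - 1) * ln 2" if "k \<ge> 1"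
    using that by (intro mult_left_mono ln_2_ge_half) auto
  ultimately have "real k - 1 \<le> 2 * ln (1 / pmf Q x)"
    by (cases "k \<ge> 1") auto
  then show ?thesis
    using Suc by (simp add: depth_def)
qed

section \<open>Finite windows, points of low tilt and tilt classes\<close>

definition window_radius :: "int pmf \<Rightarrow> real \<Rightarrow> nat" where
  "window_radius Q \<beta> = (LEAST n. mass Q (- {- int n..int n}) \<le> \<beta>)"

definition window :: "int pmf \<Rightarrow> real \<Rightarrow> int set" where
  "window Q \<beta> = {- int (window_radius Q \<beta>)..int (window_radius Q \<beta>)}"

lemma prob_window:
  assumes "\<beta> > 0"
  shows "mass Q (- window Q \<beta>) \<le> \<beta>"
proof -
  have "(\<lambda>n. mass Q (- {- int n..int n})) \<longlonglongrightarrow> mass Q (\<Inter>n. - {- int n..int n})"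
    by (intro measure_pmf.finite_Lim_measure_decseq) (auto simp: decseq_def)
  moreover have "(\<Inter>n. - {- int n..int n}) = {}"
  proof (intro equals0I)
    fix x assume "x \<in> (\<Inter>n. - {- int n..int n})"
    then have "x \<in> - {- int (nat \<bar>x\<bar>)..int (nat \<bar>x\<bar>)}" by blast
    then show False by auto
  qed
  ultimately have "(\<lambda>n. mass Q (- {- int n..int n})) \<longlonglongrightarrow> 0"
    by simp
  then have "eventually (\<lambda>n. mass Q (- {- int n..int n}) < \<beta>) sequentially"
    by (rule order_tendstoD) (fact assms)
  then obtain n where "mass Q (- {- int n..int n}) < \<beta>"
    unfolding eventually_sequentially by blast
  then have "\<exists>n. mass Q (- {- int n..int n}) \<le> \<beta>"
    by (auto intro: less_imp_le)
  then show ?thesis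
    unfolding window_def window_radius_def by (rule LeastI_ex)
qed

lemma tilt_le_imp:
  assumes "tilt Q x \<le> ennreal \<tau>" "0 \<le> \<tau>" "y < x" "pmf Q x > 0"
  shows "pmf Q y \<le> \<tau> * mass Q {y + 1..x}"
proof -
  have pos: "mass Q {y + 1..x} > 0"
    using assms pmf_le_prob[of x "{y + 1..x}" Q] by auto
  have "ennreal (pmf Q y) / ennreal (mass Q {y + 1..x}) \<le> tilt Q x"
    using assms(3) unfolding tilt_def by (intro max.coboundedI1 SUP_upper) auto
  then have "ennreal (pmf Q y / mass Q {y + 1..x}) \<le> ennreal \<tau>"
    using assms(1) pos by (simp add: divide_ennreal)
  then show ?thesis
    using assms(2) pos by (simp add: field_simps)
qed

text \<open>Consecutive points \<open>x < y\<close> of low tilt satisfy \<open>Q(x) \<le> \<tau> Q([x + 1, y])\<close>, and the intervals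
  \<open>[x + 1, y]\<close> are disjoint.\<close>

lemma sum_low_tilt:
  assumes "finite F" "F \<noteq> {}" "0 \<le> \<tau>" "\<And>x. x \<in> F \<Longrightarrow> pmf Q x > 0 \<and> tilt Q x \<le> ennreal \<tau>"
  shows "(\<Sum>x\<in>F. pmf Q x) \<le> \<tau> * mass Q {..Max F} + pmf Q (Max F)"
  using assms(1,2,4)
proof (induction F rule: finite_linorder_max_induct)
  case (insert b F)
  show ?case
  proof (cases "F = {}")
    case True
    then show ?thesis using assms(3) by simp
  next
    case False
    define m where "m = Max F"
    have m: "m \<in> F" "m < b"
      using insert.hyps False by (auto simp: m_def)
    have b: "Max (Set.insert b F) = b"
      using insert.hyps by (intro Max_eqI) (auto intro: less_imp_le)
    have "{..b} = {..m} \<union> {m + 1..b}"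
      using m by auto
    then have split: "mass Q {..b} = mass Q {..m} + mass Q {m + 1..b}"
      by (simp only:) (intro prob_split, auto)
    have "(\<Sum>x\<in>F. pmf Q x) \<le> \<tau> * mass Q {..m} + pmf Q m"
      unfolding m_def using insert False by auto
    moreover have "pmf Q m \<le> \<tau> * mass Q {m + 1..b}"
      using insert.prems(2)[of b] assms(3) m by (intro tilt_le_imp) auto
    moreover have "b \<notin> F"
      using insert.hyps by auto
    ultimately show ?thesis
      unfolding b split using insert.hyps by (simp add: distrib_left)
  qed
qed simp

text \<open>The additional \<open>\<beta>\<close> pays for the rightmost point, which has no
  interval of its own in \<open>sum_low_tilt\<close>.\<close>

lemma prob_low_tilt_le:
  assumes "finite F" "0 \<le> \<tau>" "0 \<le> \<beta>"
    and "\<And>x. x \<in> F \<Longrightarrow> pmf Q x > 0 \<and> pmf Q x < \<beta> \<and> tilt Q x \<le> ennreal \<tau>"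
  shows "(\<Sum>x\<in>F. pmf Q x) \<le> \<tau> + \<beta>"
proof (cases "F = {}")
  case False
  have "(\<Sum>x\<in>F. pmf Q x) \<le> \<tau> * mass Q {..Max F} + pmf Q (Max F)"
    using assms False by (intro sum_low_tilt) auto
  also have "\<dots> \<le> \<tau> * 1 + \<beta>"
    using assms False Max_in[of F] by (intro add_mono mult_left_mono) (auto simp: less_imp_le)
  finally show ?thesis by simp
qed (use assms in simp)

text \<open>Points of mass at least \<open>\<beta>\<close> are put in class \<open>0\<close>: they are cheap anyway, and a single one of
  them could violate the bound on the mass of the points of low tilt.\<close>

definition tested :: "int pmf \<Rightarrow> real \<Rightarrow> nat \<Rightarrow> int \<Rightarrow> bool" where
  "tested Q \<beta> I x \<longleftrightarrow> x \<in> window Q \<beta> \<and> pmf Q x > 0 \<and> (pmf Q x < \<beta> \<longrightarrow> tilt Q x > ennreal ((1 / 2) ^ I))"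

definition tilt_class :: "int pmf \<Rightarrow> real \<Rightarrow> int \<Rightarrow> nat" where
  "tilt_class Q \<beta> x = (if pmf Q x < \<beta> then LEAST i. tilt Q x > ennreal ((1 / 2) ^ Suc i) else 0)"

text \<open>Being tested bounds the tilt of a light point away from 0, so that the
  \<open>LEAST\<close> in \<open>tilt_class\<close> exists. It determines the tilt up to a factor 2,
  except that class 0 has no upper bound.\<close>

lemma tilt_class_light:
  assumes "tested Q \<beta> I x" "pmf Q x < \<beta>" "0 < I"
  shows "tilt_class Q \<beta> x < I" "tilt Q x > ennreal ((1 / 2) ^ Suc (tilt_class Q \<beta> x))"
    "0 < tilt_class Q \<beta> x \<Longrightarrow> tilt Q x \<le> ennreal ((1 / 2) ^ tilt_class Q \<beta> x)"
proof -
  let ?R = "\<lambda>i. tilt Q x > ennreal ((1 / 2) ^ Suc i)"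
  have cl: "tilt_class Q \<beta> x = (LEAST i. ?R i)"
    using assms(2) by (simp only: tilt_class_def if_True)
  have R: "?R (I - 1)"
    using assms by (simp add: tested_def)
  show "tilt_class Q \<beta> x < I"
    unfolding cl using Least_le[of ?R, OF R] assms(3) by linarith
  show "tilt Q x > ennreal ((1 / 2) ^ Suc (tilt_class Q \<beta> x))"
    unfolding cl by (rule LeastI[of ?R, OF R])
  assume "0 < tilt_class Q \<beta> x"
  then show "tilt Q x \<le> ennreal ((1 / 2) ^ tilt_class Q \<beta> x)"
    using not_less_Least[of "tilt_class Q \<beta> x - 1" ?R] unfolding cl[symmetric] by (simp add: not_less)
qed

lemma tilt_class_less: "tested Q \<beta> I x \<Longrightarrow> 0 < I \<Longrightarrow> tilt_class Q \<beta> x < I"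
  using tilt_class_light(1)[of Q \<beta> I x] by (cases "pmf Q x < \<beta>") (auto simp: tilt_class_def)

lemma prob_class_le:
  assumes "0 \<le> \<beta>" "\<beta> \<le> (1 / 2) ^ i" "0 < I"
  shows "(\<Sum>x\<in>{x\<in>window Q \<beta>. tested Q \<beta> I x \<and> tilt_class Q \<beta> x = i}. pmf Q x) \<le> 2 * (1 / 2) ^ i"
proof (cases "i = 0")
  case True
  have "(\<Sum>x\<in>{x\<in>window Q \<beta>. tested Q \<beta> I x \<and> tilt_class Q \<beta> x = i}. pmf Q x) \<le> 1"
    by (subst measure_measure_pmf_finite[symmetric], rule finite_subset[of _ "window Q \<beta>"])
       (auto simp: window_def)
  then show ?thesis
    using True by simp
next
  case False
  have "(\<Sum>x\<in>{x\<in>window Q \<beta>. tested Q \<beta> I x \<and> tilt_class Q \<beta> x = i}. pmf Q x) \<le> (1 / 2) ^ i + \<beta>"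
  proof (intro prob_low_tilt_le)
    fix x assume x: "x \<in> {x\<in>window Q \<beta>. tested Q \<beta> I x \<and> tilt_class Q \<beta> x = i}"
    then have "pmf Q x < \<beta>"
      using False by (auto simp: tilt_class_def split: if_splits)
    then show "pmf Q x > 0 \<and> pmf Q x < \<beta> \<and> tilt Q x \<le> ennreal ((1 / 2) ^ i)"
      using x False tilt_class_light(3)[of Q \<beta> I x] assms(3) by (auto simp: tested_def)
  next
    show "finite {x\<in>window Q \<beta>. tested Q \<beta> I x \<and> tilt_class Q \<beta> x = i}"
      by (rule finite_subset[of _ "window Q \<beta>"]) (auto simp: window_def)
  qed (use assms in auto)
  then show ?thesis
    using assms by simp
qed

text \<open>One \<open>\<beta>\<close> each for the tail outside the window, for the tilt bound
  (1/2)^I and for the rightmost point of low tilt.\<close>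

lemma prob_untested_le:
  assumes "0 < \<beta>" "(1 / 2) ^ I \<le> \<beta>"
  shows "mass Q {x. \<not> tested Q \<beta> I x} \<le> 3 * \<beta>"
proof -
  let ?L = "{x\<in>window Q \<beta>. pmf Q x > 0 \<and> pmf Q x < \<beta> \<and> tilt Q x \<le> ennreal ((1 / 2) ^ I)}"
  have fin: "finite (window Q \<beta>)"
    by (simp add: window_def)
  have "mass Q {x. \<not> tested Q \<beta> I x} = mass Q ({x. \<not> tested Q \<beta> I x} \<inter> set_pmf Q)"
    by (simp add: measure_Int_set_pmf)
  also have "\<dots> \<le> mass Q (- window Q \<beta> \<union> ?L)"
    by (intro measure_pmf.finite_measure_mono) (auto simp: tested_def not_less set_pmf_iff pmf_pos)
  also have "\<dots> = mass Q (- window Q \<beta>) + mass Q ?L"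
    by (intro prob_split) auto
  also have "mass Q ?L = (\<Sum>x\<in>?L. pmf Q x)"
    using fin by (intro measure_measure_pmf_finite) auto
  also have "\<dots> \<le> (1 / 2) ^ I + \<beta>"
    using fin assms by (intro prob_low_tilt_le) auto
  finally show ?thesis
    using prob_window[OF assms(1), of Q] assms by simp
qed

section \<open>Estimating the deficit of one sample\<close>

lemma integrable_unit:
  fixes h :: "'a \<Rightarrow> real"
  assumes "\<And>x. x \<in> set_pmf p \<Longrightarrow> 0 \<le> h x \<and> h x \<le> 1"
  shows "integrable (measure_pmf p) h"
  using assms by (intro measure_pmf.integrable_const_bound[where B = 1]) (auto simp: AE_measure_pmf_iff)

lemma expectation_unit:
  fixes h :: "'a \<Rightarrow> real"
  assumes "\<And>x. x \<in> set_pmf p \<Longrightarrow> 0 \<le> h x \<and> h x \<le> 1"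
  shows "0 \<le> expect p h" "expect p h \<le> 1"
proof -
  show "0 \<le> expect p h"
    using assms by (intro integral_nonneg_AE) (auto simp: AE_measure_pmf_iff)
  have "expect p h \<le> expect p (\<lambda>_. 1)"
    using assms by (intro integral_mono_AE integrable_unit) (auto simp: AE_measure_pmf_iff)
  then show "expect p h \<le> 1" by simp
qed

lemma nn_integral_unit:
  fixes h :: "'a \<Rightarrow> real"
  assumes "\<And>x. x \<in> set_pmf p \<Longrightarrow> 0 \<le> h x \<and> h x \<le> 1"
  shows "(\<integral>\<^sup>+ x. ennreal (h x) \<partial>measure_pmf p) = ennreal (expect p h)"
  using assms by (intro nn_integral_eq_integral integrable_unit) (auto simp: AE_measure_pmf_iff)

lemma expectation_bind_unit:
  fixes h :: "'b \<Rightarrow> real"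
  assumes h: "\<And>x y. x \<in> set_pmf p \<Longrightarrow> y \<in> set_pmf (f x) \<Longrightarrow> 0 \<le> h y \<and> h y \<le> 1"
  shows "expect (bind_pmf p f) h
    = expect p (\<lambda>x. expect (f x) h)"
proof -
  have E: "x \<in> set_pmf p \<Longrightarrow> 0 \<le> expect (f x) h \<and> expect (f x) h \<le> 1" for x
    using h by (intro conjI expectation_unit) auto
  have "ennreal (expect (bind_pmf p f) h) = (\<integral>\<^sup>+ y. ennreal (h y) \<partial>(bind_pmf p f))"
    using h by (subst nn_integral_unit) auto
  also have "\<dots> = (\<integral>\<^sup>+ x. \<integral>\<^sup>+ y. ennreal (h y) \<partial>(f x) \<partial>measure_pmf p)"
    by (rule nn_integral_bind_pmf)
  also have "\<dots> = (\<integral>\<^sup>+ x. ennreal (expect (f x) h) \<partial>measure_pmf p)"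
    using h by (intro nn_integral_cong_AE) (auto simp: AE_measure_pmf_iff intro!: nn_integral_unit)
  also have "\<dots> = ennreal (expect p (\<lambda>x. expect (f x) h))"
    using E by (rule nn_integral_unit)
  finally show ?thesis
    using h E expectation_unit(1)[of "bind_pmf p f" h] expectation_unit(1)[of p "\<lambda>x. expect (f x) h"]
    by (subst (asm) ennreal_inj) auto
qed

section \<open>The total variation distance as an expectation\<close>

definition deficit :: "int pmf \<Rightarrow> int pmf \<Rightarrow> int \<Rightarrow> real" where
  "deficit P Q x = min 1 (pmf Q x / pmf P x)"

lemma deficit_bounds: "0 \<le> deficit P Q x" "deficit P Q x \<le> 1"
  by (auto simp: deficit_def)

lemma integral_density_pmf:
  fixes h :: "int \<Rightarrow> real"
  shows "expect P h = (\<integral>x. pmf P x * h x \<partial>count_space UNIV)"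
  unfolding measure_pmf_eq_density by (subst integral_density) auto

lemma integrable_pmf_indicator: "integrable (count_space UNIV) (\<lambda>x. pmf P x * indicator S x :: real)"
  using integrable_pmf[of UNIV P] by (rule Bochner_Integration.integrable_bound) (auto simp: indicator_def)

lemma integral_pmf_indicator:
  fixes P :: "int pmf"
  shows "(\<integral>x. pmf P x * indicator S x \<partial>count_space UNIV) = mass P S"
  unfolding integral_density_pmf[of P "indicator S", symmetric] by simp

text \<open>|a - b| is 2 (a - b) on the set where a > b, minus (a - b) everywhere, and the latter
  sums to 0 for two distributions.\<close>

lemma tv_dist_eq:
  "tv_dist P Q = mass P {x. pmf P x > pmf Q x} - mass Q {x. pmf P x > pmf Q x}"
proof -
  let ?S = "{x. pmf P x > pmf Q x}"
  have abs: "\<bar>pmf P x - pmf Q x\<bar> = 2 * (pmf P x * indicator ?S x - pmf Q x * indicator ?S x)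
      - (pmf P x * indicator UNIV x - pmf Q x * indicator UNIV x)" for x
    by (auto simp: indicator_def)
  have int: "integrable (count_space UNIV) (\<lambda>x. \<bar>pmf P x - pmf Q x\<bar>)"
    unfolding abs by (intro Bochner_Integration.integrable_diff integrable_mult_right integrable_pmf_indicator)
  then have "(\<Sum>\<^sub>\<infinity>x. \<bar>pmf P x - pmf Q x\<bar>) = infsetsum (\<lambda>x. \<bar>pmf P x - pmf Q x\<bar>) UNIV"
    by (intro infsetsum_infsum[symmetric]) (simp add: abs_summable_on_def)
  also have "\<dots> = (\<integral>x. \<bar>pmf P x - pmf Q x\<bar> \<partial>count_space UNIV)"
    by (simp add: infsetsum_def)
  also have "\<dots> = 2 * (mass P ?S - mass Q ?S)
      - (mass P UNIV - mass Q UNIV)"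
    unfolding abs integral_pmf_indicator[symmetric]
    by (simp only: Bochner_Integration.integral_diff Bochner_Integration.integrable_diff integrable_mult_right
        integral_mult_right_zero integrable_pmf_indicator)
  finally show ?thesis
    by (simp add: tv_dist_def)
qed

text \<open>P(x) times \<open>deficit\<close> is min (P(x)) (Q(x)), also where P(x) = 0, and these
  minima sum to 1 minus the distance.\<close>

lemma expectation_deficit: "expect P (deficit P Q) = 1 - tv_dist P Q"
proof -
  let ?S = "{x. pmf P x > pmf Q x}"
  have "pmf P x * deficit P Q x = pmf P x * indicator UNIV x - (pmf P x * indicator ?S x - pmf Q x * indicator ?S x)" for x
  proof (cases "pmf P x = 0")
    case False
    then have "pmf P x > 0" by (simp add: pmf_pos)
    then show ?thesis by (auto simp: deficit_def indicator_def min_def divide_simps)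
  qed (auto simp: indicator_def)
  then have "expect P (deficit P Q) = mass P UNIV
      - (mass P ?S - mass Q ?S)"
    unfolding integral_density_pmf integral_pmf_indicator[symmetric]
    by (simp only: Bochner_Integration.integral_diff Bochner_Integration.integrable_diff integrable_pmf_indicator)
  then show ?thesis
    by (simp add: tv_dist_eq)
qed

lemma pmf_mult_deficit_le: "pmf P x * deficit P Q x \<le> pmf Q x"
proof (cases "pmf P x = 0")
  case False
  then have pos: "pmf P x > 0" by (simp add: pmf_pos)
  have "pmf P x * deficit P Q x \<le> pmf P x * (pmf Q x / pmf P x)"
    by (intro mult_left_mono) (auto simp: deficit_def)
  then show ?thesis
    using pos by simp
qed simp

text \<open>Untested points are reported as 1, an overestimate by \<open>deficit\<close>. The
  resulting bias is thus bounded by their Q-mass, whatever the unknown P is.\<close>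

lemma expectation_deficit_indicator_le:
  "expect P (\<lambda>x. indicator S x * deficit P Q x) \<le> mass Q S"
proof -
  have "integrable (measure_pmf P) (\<lambda>x. indicator S x * deficit P Q x)"
    using deficit_bounds by (intro integrable_unit) (auto simp: indicator_def)
  then have "integrable (count_space UNIV) (\<lambda>x. pmf P x * (indicator S x * deficit P Q x))"
    unfolding measure_pmf_eq_density by (subst (asm) integrable_density) auto
  then have "(\<integral>x. pmf P x * (indicator S x * deficit P Q x) \<partial>count_space UNIV)
      \<le> (\<integral>x. pmf Q x * indicator S x \<partial>count_space UNIV)"
  proof (rule integral_mono[OF _ integrable_pmf_indicator])
    show "pmf P x * (indicator S x * deficit P Q x) \<le> pmf Q x * indicator S x" for x
      using pmf_mult_deficit_le[of P x Q] by (simp add: indicator_def)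
  qed
  then show ?thesis
    by (simp add: integral_density_pmf integral_pmf_indicator)
qed

text \<open>With m = min 1 V and y = |v/V - 1| the error a satisfies a^2 \<le> m y^2; for V > 1
  there is an error only if v < 1, and then it is at most y. AM-GM with weight c separates m, which
  is \<open>deficit\<close> in the application.\<close>

lemma positive_part_error:
  fixes v V c :: real
  assumes "v > 0" "V > 0" "c > 0"
  shows "\<bar>max 0 (1 - v) - max 0 (1 - V)\<bar> \<le> c / 2 * min 1 V + 1 / (2 * c) * (v / V - 1)\<^sup>2"
proof -
  define a where "a = \<bar>max 0 (1 - v) - max 0 (1 - V)\<bar>"
  define m where "m = min 1 V"
  define y where "y = \<bar>v / V - 1\<bar>"
  have m: "m > 0" using assms by (simp add: m_def)
  have "a\<^sup>2 \<le> m * y\<^sup>2"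
  proof (cases "V \<le> 1")
    case True
    have "a \<le> \<bar>v - V\<bar>"
      by (auto simp: a_def)
    also have "\<dots> = V * y"
      using assms by (simp add: y_def abs_if field_simps)
    finally have "a\<^sup>2 \<le> (V * y)\<^sup>2"
      by (intro power_mono) (auto simp: a_def)
    also have "\<dots> = V * (V * y\<^sup>2)"
      by (simp add: power2_eq_square)
    also have "\<dots> \<le> V * (1 * y\<^sup>2)"
      using True assms by (intro mult_left_mono mult_right_mono) auto
    finally show ?thesis
      using True by (simp add: m_def)
  next
    case False
    have "a \<le> y"
    proof (cases "v < 1")
      case True
      then have "v / V \<le> v"
        using False assms by (simp add: divide_le_eq mult_left_le)
      then show ?thesis
        using True False by (auto simp: a_def y_def)
    qed (use False in \<open>auto simp: a_def y_def\<close>)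
    then have "a\<^sup>2 \<le> y\<^sup>2"
      by (intro power_mono) (auto simp: a_def)
    then show ?thesis
      using False by (simp add: m_def)
  qed
  then have "a\<^sup>2 / m \<le> y\<^sup>2"
    using m by (simp add: field_simps)
  moreover have "a \<le> c / 2 * m + 1 / (2 * c) * (a\<^sup>2 / m)"
  proof -
    have "0 \<le> (c * m - a)\<^sup>2 / (2 * c * m)"
      using m assms by simp
    also have "\<dots> = c / 2 * m + 1 / (2 * c) * (a\<^sup>2 / m) - a"
      using m assms by (simp add: power2_eq_square field_simps)
    finally show ?thesis by simp
  qed
  ultimately have "a \<le> c / 2 * m + 1 / (2 * c) * y\<^sup>2"
    using assms by (smt (verit, best) mult_left_mono divide_nonneg_nonneg)
  then show ?thesis
    by (simp add: a_def m_def y_def)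
qed

context descent
begin

text \<open>Division by the exact quotients leaves only the relative errors of the levels;
  Weierstrass' product inequality then replaces the product of the biases by their sum.\<close>

lemma sq_error_le:
  "sq_error (drift (\<lambda>l. q l / p l) 0 r) 0 r 1
    \<le> ((\<Prod>l<r. 1 + 3 / real (N l) / p l) - 1) + 2 * (\<Sum>l<r. (1 - p l) ^ Suc (N l))"
proof -
  let ?V = "drift (\<lambda>l. q l / p l) 0 r"
  have V: "?V > 0"
    using p q_pos unfolding drift_def by (intro prod_pos) auto
  have 2: "drift b2 0 r / ?V\<^sup>2 = (\<Prod>l<r. 1 + 3 / real (N l) / p l)"
    using V unfolding drift_def prod_power_distrib prod_dividef[symmetric] atLeast0LessThan add_0
    by (intro prod.cong refl) (use p q_pos in \<open>auto simp: b2_def less_imp_neq[THEN not_sym]\<close>)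
  have 1: "drift b1 0 r / ?V = (\<Prod>l<r. 1 - (1 - p l) ^ Suc (N l))"
    using V unfolding drift_def prod_dividef[symmetric] atLeast0LessThan add_0
    by (intro prod.cong refl) (use p q_pos in \<open>auto simp: b1_def less_imp_neq[THEN not_sym] simp del: power_Suc\<close>)
  have "1 - (\<Sum>l<r. (1 - p l) ^ Suc (N l)) \<le> drift b1 0 r / ?V"
    unfolding 1 using p by (intro Weierstrass_prod_ineq) (auto intro!: power_le_one simp: less_imp_le simp del: power_Suc)
  moreover have "sq_error ?V 0 r 1 = drift b2 0 r / ?V\<^sup>2 - 2 * (drift b1 0 r / ?V) + 1"
    by (simp add: sq_error_def)
  ultimately show ?thesis
    unfolding 2 by linarith
qed

end

section \<open>The estimator for one sample and its error\<close>

definition leaf :: "nat \<Rightarrow> nat \<Rightarrow> real \<Rightarrow> real \<times> nat" where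
  "leaf D d v = (if d \<le> D then (min 1 (max 0 (1 - v)), 0) else (0, 1))"

definition mass_ratio :: "int pmf \<Rightarrow> int set \<Rightarrow> int \<Rightarrow> nat \<Rightarrow> real" where
  "mass_ratio Q J x k = mass Q (node Q J (Suc k) x) / mass Q (node Q J k x)"

text \<open>A walk that is neither stopped nor cut off ends in the node {x}, where its running value
  estimates Q(x)/P(x). The number of samples depends on x only through the tilt class and the
  level.\<close>

definition estimate :: "int pmf \<Rightarrow> real \<Rightarrow> (nat \<Rightarrow> nat) \<Rightarrow> real \<Rightarrow> nat \<Rightarrow> int \<Rightarrow> (real \<times> nat) prog" where
  "estimate Q \<beta> n \<theta> D x = descend (\<lambda>k. node Q (window Q \<beta>) k x) (mass_ratio Q (window Q \<beta>) x)
     (n (tilt_class Q \<beta> x)) \<theta> (leaf D (depth Q x)) (min (depth Q x) D) 0 1"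

definition sample_prog :: "int pmf \<Rightarrow> real \<Rightarrow> nat \<Rightarrow> (nat \<Rightarrow> nat) \<Rightarrow> real \<Rightarrow> nat \<Rightarrow> (real \<times> nat) prog" where
  "sample_prog Q \<beta> I n \<theta> D =
     Query UNIV (\<lambda>x. if tested Q \<beta> I x then estimate Q \<beta> n \<theta> D x else Ret (1, 0))"

lemma cond_pmf_UNIV: "cond_pmf P UNIV = P"
proof (rule pmf_eqI)
  have ne: "set_pmf P \<inter> UNIV \<noteq> {}"
    using set_pmf_not_empty by auto
  show "pmf (cond_pmf P UNIV) x = pmf P x" for x
    using measure_pmf.prob_space[of P] by (simp add: pmf_cond[OF ne])
qed

locale sampling =
  fixes P Q :: "int pmf" and \<beta> :: real and I :: nat and n :: "nat \<Rightarrow> nat" and \<theta> :: real and D :: nat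
  assumes \<beta>_pos: "\<beta> > 0" and I_pos: "I > 0" and n_pos: "n i > 0" and \<theta>_pos: "\<theta> > 0" and \<theta>_le: "\<theta> \<le> 1"
begin

abbreviation J :: "int set" where "J \<equiv> window Q \<beta>"
abbreviation cl :: "int \<Rightarrow> nat" where "cl \<equiv> tilt_class Q \<beta>"
abbreviation est :: "int \<Rightarrow> (real \<times> nat) prog" where "est \<equiv> estimate Q \<beta> n \<theta> D"
abbreviation smp :: "(real \<times> nat) prog" where "smp \<equiv> sample_prog Q \<beta> I n \<theta> D"
abbreviation Tested :: "int \<Rightarrow> bool" where "Tested \<equiv> tested Q \<beta> I"

sublocale tree: binary_tree J "node Q J"
  by (intro binary_tree_node) (simp add: window_def)

lemma Tested_imp: "Tested x \<Longrightarrow> x \<in> J" "Tested x \<Longrightarrow> pmf Q x > 0"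
  by (auto simp: tested_def)

lemma descent:
  assumes "Tested x" "pmf P x > 0"
  shows "descent P (\<lambda>k. node Q J k x) (mass_ratio Q J x) (n (cl x)) \<theta> (leaf D (depth Q x))"
proof
  show "node Q J (Suc k) x \<subseteq> node Q J k x" for k
    by (rule tree.A_decreasing)
  show "mass P (node Q J k x) > 0" for k
    by (rule tree.A_pos[OF Tested_imp(1)[OF assms(1)] assms(2)])
  show "0 < mass_ratio Q J x k" for k
    using tree.A_pos[OF Tested_imp[OF assms(1)]] unfolding mass_ratio_def by (intro divide_pos_pos)
qed (use n_pos \<theta>_pos in \<open>auto simp: leaf_def\<close>)

abbreviation R :: "int \<Rightarrow> nat" where "R x \<equiv> min (depth Q x) D"

lemma
  assumes "Tested x" "pmf P x > 0"
  shows p_eq: "descent.p P (\<lambda>k. node Q J k x) = (\<lambda>l. tree.ratio P l x)"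
    and N_eq: "descent.N (n (cl x)) = (\<lambda>l. Suc l * n (cl x))"
    and q_eq: "mass_ratio Q J x = (\<lambda>l. tree.ratio Q l x)"
  by (auto simp: descent.p_def[OF descent[OF assms]] descent.N_def[OF descent[OF assms]]
      tree.ratio_def mass_ratio_def)

text \<open>All D levels are counted even if the walk to x is shorter, so that averages over x run
  over a common number of levels; the additional factors only enlarge the bound.\<close>

definition ratio_error :: "nat \<Rightarrow> int \<Rightarrow> real" where
  "ratio_error i x = ((\<Prod>l<D. 1 + 3 / real (Suc l * n i) / tree.ratio P l x) - 1)
     + 2 * (\<Sum>l<D. (1 - tree.ratio P l x) ^ Suc (Suc l * n i))"

definition stop_error :: "nat \<Rightarrow> int \<Rightarrow> real" where
  "stop_error i x = (\<Sum>m<D. \<Prod>l<Suc m. (tree.ratio P l x + 1 / real (Suc l * n i)) / tree.ratio Q l x)"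

lemma drift_ratio:
  assumes "Tested x" "pmf P x > 0"
  shows "(\<Prod>l<k. tree.ratio Q l x / tree.ratio P l x)
    = mass Q (node Q J k x) / mass P (node Q J k x)"
  using assms Tested_imp[OF assms(1)] by (simp add: prod_dividef tree.prod_ratio)

text \<open>\<open>prog_upper\<close> and \<open>prog_lower\<close> are used with f = 1 -
  \<open>deficit\<close>, and \<open>positive_part_error\<close> bounds the error at the leaf. For x
  deeper than D the leaf spans all of [0, 1], so the bounds hold there for any V.\<close>

lemma estimate_bounds:
  assumes x: "Tested x" "pmf P x > 0" and c: "c > 0"
  shows "expect (sem P (est x)) fst
      \<le> 1 - deficit P Q x + (c / 2 * deficit P Q x + 1 / (2 * c) * ratio_error (cl x) x)
        + deficit P Q x * (\<theta> * stop_error (cl x) x)" (is ?upper)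
    and "1 - deficit P Q x - (c / 2 * deficit P Q x + 1 / (2 * c) * ratio_error (cl x) x)
      \<le> expect (sem P (est x)) (\<lambda>a. fst a + real (snd a))" (is ?lower)
proof -
  interpret d: descent P "\<lambda>k. node Q J k x" "mass_ratio Q J x" "n (cl x)" \<theta> "leaf D (depth Q x)"
    by (rule descent[OF x])
  define V where "V = d.drift (\<lambda>l. mass_ratio Q J x l / d.p l) 0 (R x)"
  have pq: "0 < tree.ratio P l x" "tree.ratio P l x \<le> 1" "0 < tree.ratio Q l x" for l
    using tree.ratio_pos Tested_imp[OF x(1)] x(2) tree.ratio_bounds by auto
  have V_pos: "V > 0"
    unfolding V_def d.drift_def q_eq[OF x] p_eq[OF x] using pq by (intro prod_pos) auto
  have V_leaf: "V = pmf Q x / pmf P x" if "depth Q x \<le> D"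
    using that node_depth[of x J Q "depth Q x"] Tested_imp[OF x(1)] drift_ratio[OF x, of "depth Q x"]
    by (simp add: V_def d.drift_def q_eq[OF x] p_eq[OF x] atLeast0LessThan measure_pmf_single)
  have f: "0 \<le> 1 - deficit P Q x" "1 - deficit P Q x \<le> 1"
    using deficit_bounds[of P Q x] by auto
  have nonneg: "0 \<le> c / 2 * deficit P Q x" "0 \<le> 1 / (2 * c)"
    using deficit_bounds[of P Q x] c by auto
  have err: "\<bar>min 1 (max 0 (1 - v)) - (1 - deficit P Q x)\<bar> \<le> c / 2 * deficit P Q x + 1 / (2 * c) * (v / V - 1)\<^sup>2"
    if "v > 0" "depth Q x \<le> D" for v
  proof -
    have "min 1 (max 0 (1 - v)) = max 0 (1 - v)" "1 - deficit P Q x = max 0 (1 - V)" "deficit P Q x = min 1 V"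
      using that V_leaf by (auto simp: deficit_def)
    then show ?thesis
      using positive_part_error[OF that(1) V_pos c] by simp
  qed
  have sq: "1 / (2 * c) * d.sq_error V 0 (R x) 1 \<le> 1 / (2 * c) * ratio_error (cl x) x"
  proof (intro mult_left_mono nonneg)
    have "d.sq_error V 0 (R x) 1 \<le> ((\<Prod>l<R x. 1 + 3 / real (d.N l) / d.p l) - 1) + 2 * (\<Sum>l<R x. (1 - d.p l) ^ Suc (d.N l))"
      unfolding V_def by (rule d.sq_error_le)
    also have "\<dots> \<le> ratio_error (cl x) x"
      unfolding ratio_error_def p_eq[OF x] N_eq[OF x]
    proof (intro add_mono diff_right_mono mult_left_mono sum_mono2)
      show "(\<Prod>l<R x. 1 + 3 / real (Suc l * n (cl x)) / tree.ratio P l x)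
          \<le> (\<Prod>l<D. 1 + 3 / real (Suc l * n (cl x)) / tree.ratio P l x)"
      proof -
        have nn: "0 \<le> 3 / real (Suc l * n (cl x)) / tree.ratio P l x" for l
          using tree.ratio_bounds by (intro divide_nonneg_nonneg) auto
        then have ge: "1 \<le> 1 + 3 / real (Suc l * n (cl x)) / tree.ratio P l x" for l
          by (simp only: le_add_same_cancel1)
        show ?thesis
          by (intro prod_mono2)
             (auto intro: nn ge order.trans[OF zero_le_one ge] less_le_trans[OF zero_less_one ge]
               simp del: mult_Suc of_nat_mult of_nat_Suc le_add_same_cancel1 divide_divide_eq_left)
      qed
    qed (use pq in \<open>auto simp del: power_Suc\<close>)
    finally show "d.sq_error V 0 (R x) 1 \<le> ratio_error (cl x) x" .
  qed
  have st: "d.stop_weight 0 (R x) \<le> stop_error (cl x) x"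
    unfolding d.stop_weight_def stop_error_def d.drift_def d.b3_def
    unfolding p_eq[OF x] N_eq[OF x] q_eq[OF x] add_0 atLeast0LessThan
  proof (intro sum_mono2 prod_nonneg)
    show "0 \<le> (tree.ratio P l x + 1 / real (Suc l * n (cl x))) / tree.ratio Q l x" for l
      using tree.ratio_bounds by (intro divide_nonneg_nonneg add_nonneg_nonneg) auto
  qed auto
  have "expect (sem P (est x)) fst
    \<le> (1 - deficit P Q x) + c / 2 * deficit P Q x + 1 / (2 * c) * d.sq_error V 0 (R x) 1
      + (1 - (1 - deficit P Q x)) * (\<theta> / 1 * d.stop_weight 0 (R x))"
    unfolding estimate_def
  proof (intro d.prog_upper f nonneg V_pos)
    fix v :: real assume v: "v > 0"
    show "fst (leaf D (depth Q x) v) \<le> 1 - deficit P Q x + c / 2 * deficit P Q x + 1 / (2 * c) * (v / V - 1)\<^sup>2"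
    proof (cases "depth Q x \<le> D")
      case True
      then show ?thesis using err[OF v] by (simp add: leaf_def)
    next
      case False
      have "0 \<le> 1 / (2 * c) * (v / V - 1)\<^sup>2"
        using nonneg by (intro mult_nonneg_nonneg) auto
      then show ?thesis using False f nonneg by (simp add: leaf_def)
    qed
  qed simp
  also have "\<dots> \<le> 1 - deficit P Q x + (c / 2 * deficit P Q x + 1 / (2 * c) * ratio_error (cl x) x)
        + deficit P Q x * (\<theta> * stop_error (cl x) x)"
    using sq mult_left_mono[OF mult_left_mono[OF st, of \<theta>] deficit_bounds(1)[of P Q x]] \<theta>_pos by simp
  finally show ?upper .
  have "1 - deficit P Q x - (c / 2 * deficit P Q x + 1 / (2 * c) * d.sq_error V 0 (R x) 1)
    \<le> expect (sem P (est x)) (\<lambda>a. fst a + real (snd a))"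
    unfolding estimate_def
  proof (intro d.prog_lower f nonneg V_pos)
    fix v :: real assume v: "v > 0"
    show "1 - deficit P Q x \<le> fst (leaf D (depth Q x) v) + real (snd (leaf D (depth Q x) v))
        + c / 2 * deficit P Q x + 1 / (2 * c) * (v / V - 1)\<^sup>2"
    proof (cases "depth Q x \<le> D")
      case True
      then show ?thesis using err[OF v] by (simp add: leaf_def)
    next
      case False
      have "0 \<le> 1 / (2 * c) * (v / V - 1)\<^sup>2"
        using nonneg by (intro mult_nonneg_nonneg) auto
      moreover have "fst (leaf D (depth Q x) v) + real (snd (leaf D (depth Q x) v)) = 1"
        using False by (simp add: leaf_def)
      ultimately show ?thesis using f(2) nonneg(1) by linarith
    qed
  qed simp
  then show ?lower
    using sq by simp
qed

lemma estimate_range: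
  assumes "Tested x" "pmf P x > 0" "a \<in> set_pmf (sem P (est x))"
  shows "0 \<le> fst a" "fst a + real (snd a) \<le> 1"
  using descent.prog_range[OF descent[OF assms(1,2)]] assms(3) unfolding estimate_def by blast+

text \<open>The 3 of the second moment and two children give 6, which doubles when
  \<open>exp\<close> is linearised; the misses add 4. This is the 16.\<close>

lemma sum_ratio_error:
  assumes "(\<Sum>l<D. 1 / real (Suc l * n i)) \<le> 1 / 6"
  shows "(\<Sum>x\<in>J. pmf P x * ratio_error i x) \<le> 16 * (\<Sum>l<D. 1 / real (Suc l * n i))"
proof -
  let ?\<sigma> = "\<Sum>l<D. 1 / real (Suc l * n i)"
  have "(\<Sum>x\<in>J. pmf P x * ((\<Prod>l<D. 1 + 3 / real (Suc l * n i) / tree.ratio P l x) - 1))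
      \<le> (\<Prod>l<D. 1 + 2 * (3 / real (Suc l * n i))) - 1"
    by (rule tree.sum_prod_inverse_ratio) simp
  also have "(\<Prod>l<D. 1 + 2 * (3 / real (Suc l * n i))) \<le> exp (\<Sum>l<D. 2 * (3 / real (Suc l * n i)))"
    by (rule prod_add_1_le_exp) simp
  also have "(\<Sum>l<D. 2 * (3 / real (Suc l * n i))) = 6 * ?\<sigma>"
    by (simp add: sum_distrib_left)
  also have "exp (6 * ?\<sigma>) \<le> 1 + 2 * (6 * ?\<sigma>)"
    using assms by (intro exp_le_1_plus_2x) (auto intro!: sum_nonneg mult_nonneg_nonneg simp del: of_nat_mult)
  finally have 1: "(\<Sum>x\<in>J. pmf P x * ((\<Prod>l<D. 1 + 3 / real (Suc l * n i) / tree.ratio P l x) - 1)) \<le> 12 * ?\<sigma>"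
    by simp
  have "(\<Sum>x\<in>J. pmf P x * (\<Sum>l<D. (1 - tree.ratio P l x) ^ Suc (Suc l * n i)))
      = (\<Sum>l<D. \<Sum>x\<in>J. pmf P x * (1 - tree.ratio P l x) ^ Suc (Suc l * n i))"
    unfolding sum_distrib_left by (rule sum.swap)
  also have "\<dots> \<le> (\<Sum>l<D. 2 / real (Suc l * n i + 2))"
    by (intro sum_mono tree.sum_miss_prob)
  also have "\<dots> \<le> (\<Sum>l<D. 2 * (1 / real (Suc l * n i)))"
  proof (intro sum_mono)
    have "2 / real (k + 2) \<le> 2 * (1 / real k)" if "k > 0" for k
      using that by (simp add: frac_le)
    then show "2 / real (Suc l * n i + 2) \<le> 2 * (1 / real (Suc l * n i))" for l
      using n_pos[of i] by (metis mult_pos_pos zero_less_Suc)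
  qed
  also have "\<dots> = 2 * ?\<sigma>"
    by (simp add: sum_distrib_left)
  finally have 2: "(\<Sum>x\<in>J. pmf P x * (\<Sum>l<D. (1 - tree.ratio P l x) ^ Suc (Suc l * n i))) \<le> 2 * ?\<sigma>" .
  have "(\<Sum>x\<in>J. pmf P x * ratio_error i x)
    = (\<Sum>x\<in>J. pmf P x * ((\<Prod>l<D. 1 + 3 / real (Suc l * n i) / tree.ratio P l x) - 1))
      + 2 * (\<Sum>x\<in>J. pmf P x * (\<Sum>l<D. (1 - tree.ratio P l x) ^ Suc (Suc l * n i)))"
    unfolding ratio_error_def by (simp only: distrib_left sum.distrib sum_distrib_left mult.left_commute[of _ 2])
  then show ?thesis
    using 1 2 by linarith
qed

text \<open>Each of the D levels contributes at most \<open>exp 1\<close> \<le> 3, as the harmonic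
  sum is small.\<close>

lemma sum_stop_error:
  assumes "(\<Sum>l<D. 1 / real (Suc l * n i)) \<le> 1 / 6"
  shows "(\<Sum>x\<in>J. pmf Q x * stop_error i x) \<le> 3 * real D"
proof -
  let ?\<sigma> = "\<Sum>l<D. 1 / real (Suc l * n i)"
  have "(\<Sum>x\<in>J. pmf Q x * stop_error i x)
      = (\<Sum>m<D. \<Sum>x\<in>J. pmf Q x * (\<Prod>l<Suc m. (tree.ratio P l x + 1 / real (Suc l * n i)) / tree.ratio Q l x))"
    unfolding stop_error_def sum_distrib_left by (rule sum.swap)
  also have "\<dots> \<le> (\<Sum>m<D. 3)"
  proof (intro sum_mono)
    fix m assume m: "m \<in> {..<D}"
    have "(\<Sum>x\<in>J. pmf Q x * (\<Prod>l<Suc m. (tree.ratio P l x + 1 / real (Suc l * n i)) / tree.ratio Q l x))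
        \<le> (\<Prod>l<Suc m. 1 + 2 / real (Suc l * n i))"
      using n_pos[of i] by (intro tree.sum_prod_ratio_quotient) (simp only: of_nat_0_less_iff mult_pos_pos zero_less_Suc)
    also have "\<dots> \<le> (\<Prod>l<D. 1 + 2 / real (Suc l * n i))"
      using m by (intro prod_mono2) (auto intro!: add_nonneg_nonneg)
    also have "\<dots> \<le> exp (\<Sum>l<D. 2 / real (Suc l * n i))"
      by (rule prod_add_1_le_exp) simp
    also have "(\<Sum>l<D. 2 / real (Suc l * n i)) = 2 * ?\<sigma>"
      by (simp add: sum_distrib_left)
    also have "exp (2 * ?\<sigma>) \<le> exp 1"
      using assms by simp
    also have "exp 1 \<le> (3::real)"
      by (rule exp_le)
    finally show "(\<Sum>x\<in>J. pmf Q x * (\<Prod>l<Suc m. (tree.ratio P l x + 1 / real (Suc l * n i)) / tree.ratio Q l x)) \<le> 3" .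
  qed
  finally show ?thesis by simp
qed

end

text \<open>The error terms need not be bounded by 1, but they concern the finitely many tested
  points only; as a finite sum of indicators they are integrable.\<close>

lemma integrable_finite_combination:
  fixes r :: "'a \<Rightarrow> real"
  shows "integrable (measure_pmf P) (\<lambda>x. \<Sum>y\<in>T. r y * indicator {y} x)"
  by (intro Bochner_Integration.integrable_sum integrable_mult_right integrable_unit) (auto simp: indicator_def)

lemma expectation_finite_combination:
  fixes r :: "'a \<Rightarrow> real"
  shows "expect P (\<lambda>x. \<Sum>y\<in>T. r y * indicator {y} x) = (\<Sum>y\<in>T. pmf P y * r y)"
proof -
  have "integrable (measure_pmf P) (\<lambda>x. r y * indicator {y} x)" for y
    by (intro integrable_mult_right integrable_unit) (auto simp: indicator_def)
  then have "expect P (\<lambda>x. \<Sum>y\<in>T. r y * indicator {y} x)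
      = (\<Sum>y\<in>T. expect P (\<lambda>x. r y * indicator {y} x))"
    by (intro Bochner_Integration.integral_sum)
  then show ?thesis
    by (simp add: measure_pmf_single mult.commute)
qed

lemma finite_combination_eq:
  fixes r :: "'a \<Rightarrow> real"
  assumes "finite T"
  shows "(\<Sum>y\<in>T. r y * indicator {y} x) = (if x \<in> T then r x else 0)"
  using assms by (auto simp: indicator_def if_distrib[where f = "\<lambda>z. _ * z"] sum.delta cong: if_cong)

context sampling
begin

definition T :: "int set" where "T = {x \<in> J. Tested x}"

lemma finite_T: "finite T"
  unfolding T_def by (rule finite_subset[of _ J]) (auto simp: window_def)

lemma Tested_iff_T: "Tested x \<longleftrightarrow> x \<in> T"
  using Tested_imp by (auto simp: T_def)

lemma sem_sample_prog:
  "sem P smp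
    = bind_pmf P (\<lambda>x. if Tested x then sem P (est x) else return_pmf (1, 0))"
  unfolding sample_prog_def sem.simps cond_pmf_UNIV by (intro bind_pmf_cong) auto

lemma cost_sample_prog:
  "cost P smp
    = 1 + (\<integral>\<^sup>+ x. (if Tested x then cost P (est x) else 0) \<partial>measure_pmf P)"
  unfolding sample_prog_def cost.simps cond_pmf_UNIV
  by (intro arg_cong2[where f = "(+)"] refl nn_integral_cong) auto

lemma sample_range:
  assumes "a \<in> set_pmf (sem P smp)"
  shows "0 \<le> fst a" "fst a + real (snd a) \<le> 1"
proof -
  obtain x where x: "x \<in> set_pmf P"
    "a \<in> set_pmf (if Tested x then sem P (est x) else return_pmf (1, 0))"
    using assms by (auto simp: sem_sample_prog)
  have "pmf P x > 0"
    using x(1) by (simp add: set_pmf_iff pmf_pos)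
  then show "0 \<le> fst a" "fst a + real (snd a) \<le> 1"
    using x estimate_range[of x a] by (auto split: if_splits)
qed

lemma expectation_sample:
  assumes h: "\<And>a. 0 \<le> fst a \<Longrightarrow> fst a + real (snd a) \<le> 1 \<Longrightarrow> 0 \<le> h a \<and> h a \<le> (1::real)"
  shows "expect (sem P smp) h
    = expect P (\<lambda>x. if Tested x
        then expect (sem P (est x)) h else h (1, 0))"
proof -
  have "expect (sem P smp) h
    = expect P (\<lambda>x. expect
        (if Tested x then sem P (est x) else return_pmf (1, 0)) h)"
    unfolding sem_sample_prog
  proof (rule expectation_bind_unit)
    fix x y assume x: "x \<in> set_pmf P" and y: "y \<in> set_pmf (if Tested x then sem P (est x) else return_pmf (1, 0))"
    then have "y \<in> set_pmf (sem P smp)"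
      unfolding sem_sample_prog set_bind_pmf by blast
    then show "0 \<le> h y \<and> h y \<le> 1"
      using h sample_range by blast
  qed
  then show ?thesis
    by (simp add: if_distrib[where f = "\<lambda>p. expect p h"] cong: if_cong)
qed

lemma integrable_estimate:
  assumes h: "\<And>a. 0 \<le> fst a \<Longrightarrow> fst a + real (snd a) \<le> 1 \<Longrightarrow> 0 \<le> h a \<and> h a \<le> (1::real)"
  shows "integrable (measure_pmf P) (\<lambda>x. if Tested x
        then expect (sem P (est x)) h else h (1, 0))"
proof (intro integrable_unit)
  fix x assume "x \<in> set_pmf P"
  then have "pmf P x > 0"
    by (simp add: set_pmf_iff pmf_pos)
  then have "0 \<le> expect (sem P (est x)) h
      \<and> expect (sem P (est x)) h \<le> 1" if "Tested x"
    using that h estimate_range[of x] by (intro conjI expectation_unit) blast+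
  then show "0 \<le> (if Tested x then expect (sem P (est x)) h else h (1, 0)) \<and>
      (if Tested x then expect (sem P (est x)) h else h (1, 0)) \<le> 1"
    using h[of "(1, 0)"] by simp
qed

lemma ratio_error_nonneg: "0 \<le> ratio_error i x"
proof -
  have nn: "0 \<le> 3 / real (Suc l * n i) / tree.ratio P l x" for l
    using tree.ratio_bounds by (intro divide_nonneg_nonneg) auto
  have "1 \<le> (\<Prod>l<D. 1 + 3 / real (Suc l * n i) / tree.ratio P l x)"
    by (intro prod_ge_1) (simp only: le_add_same_cancel1 nn)
  moreover have "0 \<le> (\<Sum>l<D. (1 - tree.ratio P l x) ^ Suc (Suc l * n i))"
    using tree.ratio_bounds by (intro sum_nonneg zero_le_power) auto
  ultimately show ?thesis
    by (simp add: ratio_error_def del: power_Suc mult_Suc)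
qed

lemma stop_error_nonneg: "0 \<le> stop_error i x"
  unfolding stop_error_def using tree.ratio_bounds
  by (intro sum_nonneg prod_nonneg divide_nonneg_nonneg add_nonneg_nonneg) auto

end

section \<open>Averaging the error over the tilt classes\<close>

locale accurate_sampling = sampling +
  fixes \<gamma> :: real
  assumes \<gamma>: "0 < \<gamma>" "\<gamma> < 1"
    and \<beta>_le: "\<beta> \<le> \<gamma> / 64"
    and I: "(1 / 2) ^ I \<le> \<beta>" "\<And>i. i < I \<Longrightarrow> \<beta> \<le> (1 / 2) ^ i"
    and n: "\<And>i. i < I \<Longrightarrow> (\<Sum>l<D. 1 / real (Suc l * n i)) \<le> 1 / 6"
      "\<And>i. i < I \<Longrightarrow> 16 * (\<Sum>l<D. 1 / real (Suc l * n i)) \<le> \<gamma>\<^sup>2 * 2 ^ i / (128 * (real I)\<^sup>2)"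
    and \<theta>: "\<theta> * (real I * (3 * real D)) \<le> \<gamma> / 16"
begin

text \<open>The weight that balances the two halves of the error in class i: with Q-mass at most 2 /
  2^i and mean square error at most
  \<open>\<gamma>\<^sup>2 * 2 ^ i / (128 * (real I)\<^sup>2)\<close>, each half comes to
  \<open>\<gamma> / (16 * real I)\<close>.\<close>

definition c :: "nat \<Rightarrow> real" where "c i = \<gamma> * 2 ^ i / (16 * real I)"

lemma c_pos: "c i > 0"
  using \<gamma> I_pos by (simp add: c_def)

definition err :: "int \<Rightarrow> real" where
  "err x = c (cl x) / 2 * deficit P Q x + 1 / (2 * c (cl x)) * ratio_error (cl x) x"

lemma sum_over_classes:
  fixes h :: "int \<Rightarrow> real"
  assumes "\<And>i. i < I \<Longrightarrow> (\<Sum>x\<in>{x\<in>T. cl x = i}. h x) \<le> b"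
  shows "(\<Sum>x\<in>T. h x) \<le> real I * b"
proof -
  have "(\<Sum>x\<in>T. h x) = (\<Sum>i<I. \<Sum>x\<in>{x\<in>T. cl x = i}. h x)"
    using finite_T tilt_class_less[OF _ I_pos] by (intro sum.group[symmetric]) (auto simp: T_def)
  also have "\<dots> \<le> (\<Sum>i<I. b)"
    using assms by (intro sum_mono) auto
  finally show ?thesis by simp
qed

lemma T_class: "{x\<in>T. cl x = i} = {x\<in>J. Tested x \<and> cl x = i}"
  by (auto simp: T_def)

lemma finite_J: "finite J"
  by (simp add: window_def)

text \<open>The P-average of \<open>deficit\<close> over a class is at most its Q-mass, which
  \<open>prob_class_le\<close> bounds; the squared relative error is averaged over the whole window
  instead.\<close>

lemma sum_err: "(\<Sum>x\<in>T. pmf P x * err x) \<le> \<gamma> / 8"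
proof -
  have "(\<Sum>x\<in>{x\<in>T. cl x = i}. pmf P x * err x) \<le> \<gamma> / (8 * real I)" if i: "i < I" for i
  proof -
    let ?Ti = "{x\<in>T. cl x = i}"
    have "(\<Sum>x\<in>?Ti. pmf P x * err x)
        = c i / 2 * (\<Sum>x\<in>?Ti. pmf P x * deficit P Q x) + 1 / (2 * c i) * (\<Sum>x\<in>?Ti. pmf P x * ratio_error i x)"
      unfolding sum_distrib_left sum.distrib[symmetric] by (intro sum.cong refl) (auto simp: err_def algebra_simps)
    also have "\<dots> \<le> c i / 2 * (2 * (1 / 2) ^ i) + 1 / (2 * c i) * (\<gamma>\<^sup>2 * 2 ^ i / (128 * (real I)\<^sup>2))"
    proof (intro add_mono mult_left_mono)
      have "(\<Sum>x\<in>?Ti. pmf P x * deficit P Q x) \<le> (\<Sum>x\<in>?Ti. pmf Q x)"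
        by (intro sum_mono pmf_mult_deficit_le)
      also have "\<dots> \<le> 2 * (1 / 2) ^ i"
        unfolding T_class using \<beta>_pos I(2)[OF i] I_pos by (intro prob_class_le) auto
      finally show "(\<Sum>x\<in>?Ti. pmf P x * deficit P Q x) \<le> 2 * (1 / 2) ^ i" .
      have "(\<Sum>x\<in>?Ti. pmf P x * ratio_error i x) \<le> (\<Sum>x\<in>J. pmf P x * ratio_error i x)"
        using finite_J ratio_error_nonneg by (intro sum_mono2) (auto simp: T_def)
      also have "\<dots> \<le> 16 * (\<Sum>l<D. 1 / real (Suc l * n i))"
        by (rule sum_ratio_error[OF n(1)[OF i]])
      also have "\<dots> \<le> \<gamma>\<^sup>2 * 2 ^ i / (128 * (real I)\<^sup>2)"
        by (rule n(2)[OF i])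
      finally show "(\<Sum>x\<in>?Ti. pmf P x * ratio_error i x) \<le> \<gamma>\<^sup>2 * 2 ^ i / (128 * (real I)\<^sup>2)" .
    qed (use c_pos[of i] in auto)
    also have "\<dots> = \<gamma> / (8 * real I)"
      using \<gamma> I_pos by (simp add: c_def power_divide power2_eq_square field_simps)
    finally show ?thesis .
  qed
  then have "(\<Sum>x\<in>T. pmf P x * err x) \<le> real I * (\<gamma> / (8 * real I))"
    by (rule sum_over_classes)
  then show ?thesis
    using I_pos by simp
qed

lemma sum_stop: "(\<Sum>x\<in>T. pmf P x * (deficit P Q x * (\<theta> * stop_error (cl x) x))) \<le> \<gamma> / 16"
proof -
  have "(\<Sum>x\<in>{x\<in>T. cl x = i}. pmf P x * (deficit P Q x * (\<theta> * stop_error (cl x) x))) \<le> \<theta> * (3 * real D)" if i: "i < I" for i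
  proof -
    let ?Ti = "{x\<in>T. cl x = i}"
    have "(\<Sum>x\<in>?Ti. pmf P x * (deficit P Q x * (\<theta> * stop_error (cl x) x)))
      \<le> (\<Sum>x\<in>?Ti. \<theta> * (pmf Q x * stop_error i x))"
    proof (intro sum_mono)
      fix x assume x: "x \<in> ?Ti"
      have "pmf P x * (deficit P Q x * (\<theta> * stop_error (cl x) x)) = (pmf P x * deficit P Q x) * (\<theta> * stop_error i x)"
        using x by simp
      also have "\<dots> \<le> pmf Q x * (\<theta> * stop_error i x)"
        using \<theta>_pos stop_error_nonneg by (intro mult_right_mono pmf_mult_deficit_le) auto
      finally show "pmf P x * (deficit P Q x * (\<theta> * stop_error (cl x) x)) \<le> \<theta> * (pmf Q x * stop_error i x)"
        by (simp add: mult_ac)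
    qed
    also have "\<dots> \<le> (\<Sum>x\<in>J. \<theta> * (pmf Q x * stop_error i x))"
      using finite_J stop_error_nonneg \<theta>_pos by (intro sum_mono2) (auto simp: T_def)
    also have "\<dots> = \<theta> * (\<Sum>x\<in>J. pmf Q x * stop_error i x)"
      by (simp add: sum_distrib_left)
    also have "\<dots> \<le> \<theta> * (3 * real D)"
      using \<theta>_pos by (intro mult_left_mono sum_stop_error n(1)[OF i]) auto
    finally show ?thesis .
  qed
  then have "(\<Sum>x\<in>T. pmf P x * (deficit P Q x * (\<theta> * stop_error (cl x) x))) \<le> real I * (\<theta> * (3 * real D))"
    by (rule sum_over_classes)
  then show ?thesis
    using \<theta> by (simp add: mult_ac)
qed

lemma integrable_deficit: "integrable (measure_pmf P) (deficit P Q)"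
  "integrable (measure_pmf P) (\<lambda>x. indicator S x * deficit P Q x)"
  using deficit_bounds[of P Q] by (intro integrable_unit; auto simp: indicator_def)+

lemma sample_mean_upper:
  "expect (sem P smp) fst \<le> tv_dist P Q + \<gamma> / 4"
proof -
  let ?r = "\<lambda>x. err x + deficit P Q x * (\<theta> * stop_error (cl x) x)"
  let ?B = "{x. \<not> tested Q \<beta> I x}"
  let ?g = "\<lambda>x. if Tested x then expect (sem P (est x)) fst else fst (1::real, 0::nat)"
  let ?bound = "\<lambda>x. (1 - deficit P Q x) + (indicator ?B x * deficit P Q x + (\<Sum>y\<in>T. ?r y * indicator {y} x))"
  have "expect (sem P smp) fst
    = expect P ?g"
    by (rule expectation_sample) auto
  also have "\<dots> \<le> expect P ?bound"
  proof (intro integral_mono_AE)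
    show "integrable (measure_pmf P) ?g"
      by (rule integrable_estimate) auto
    show "integrable (measure_pmf P) ?bound"
      by (intro Bochner_Integration.integrable_add Bochner_Integration.integrable_diff integrable_deficit
          integrable_finite_combination) simp
    show "AE x in P. ?g x
      \<le> ?bound x"
      unfolding AE_measure_pmf_iff
    proof
      fix x assume "x \<in> set_pmf P"
      then have x: "pmf P x > 0"
        by (simp add: set_pmf_iff pmf_pos)
      show "?g x
        \<le> ?bound x"
        unfolding finite_combination_eq[OF finite_T]
        using estimate_bounds(1)[OF _ x c_pos[of "cl x"]] by (auto simp: Tested_iff_T err_def)
    qed
  qed
  also have "\<dots> = (1 - expect P (deficit P Q))
      + (expect P (\<lambda>x. indicator ?B x * deficit P Q x) + (\<Sum>y\<in>T. pmf P y * ?r y))"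
    unfolding expectation_finite_combination[symmetric]
    by (subst Bochner_Integration.integral_add Bochner_Integration.integral_diff;
        (intro Bochner_Integration.integrable_add Bochner_Integration.integrable_diff integrable_deficit
          integrable_finite_combination)?; simp?)+
  also have "\<dots> \<le> (1 - (1 - tv_dist P Q)) + (3 * \<beta> + (\<gamma> / 8 + \<gamma> / 16))"
  proof (intro add_mono diff_left_mono)
    show "expect P (\<lambda>x. indicator ?B x * deficit P Q x) \<le> 3 * \<beta>"
      using expectation_deficit_indicator_le[of P ?B Q] prob_untested_le[OF \<beta>_pos I(1), of Q] by linarith
    show "(\<Sum>y\<in>T. pmf P y * ?r y) \<le> \<gamma> / 8 + \<gamma> / 16"
      unfolding distrib_left sum.distrib by (intro add_mono sum_err sum_stop)
  qed (simp add: expectation_deficit)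
  also have "\<dots> \<le> tv_dist P Q + \<gamma> / 4"
    using \<beta>_le \<gamma> by simp
  finally show ?thesis .
qed

text \<open>Untested points and early stops only raise the estimate, so the sampling error is the
  only loss in this direction.\<close>

lemma sample_mean_lower:
  "tv_dist P Q - \<gamma> / 4
    \<le> expect (sem P smp) (\<lambda>a. fst a + real (snd a))"
proof -
  let ?h = "\<lambda>a. fst a + real (snd a)"
  let ?g = "\<lambda>x. if Tested x then expect (sem P (est x)) ?h else ?h (1, 0)"
  let ?bound = "\<lambda>x. (1 - deficit P Q x) - (\<Sum>y\<in>T. err y * indicator {y} x)"
  have "tv_dist P Q - \<gamma> / 4 \<le> (1 - expect P (deficit P Q)) - (\<Sum>y\<in>T. pmf P y * err y)"
    using sum_err \<gamma> by (simp add: expectation_deficit)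
  also have "\<dots> = expect P ?bound"
    unfolding expectation_finite_combination[symmetric]
    by (subst Bochner_Integration.integral_diff;
        (intro Bochner_Integration.integrable_diff integrable_deficit integrable_finite_combination)?; simp?)+
  also have "\<dots> \<le> expect P ?g"
  proof (intro integral_mono_AE)
    show "integrable (measure_pmf P) ?bound"
      by (intro Bochner_Integration.integrable_diff integrable_deficit integrable_finite_combination) simp
    show "integrable (measure_pmf P) ?g"
      by (rule integrable_estimate) auto
    show "AE x in P. ?bound x
        \<le> ?g x"
      unfolding AE_measure_pmf_iff
    proof
      fix x assume "x \<in> set_pmf P"
      then have x: "pmf P x > 0"
        by (simp add: set_pmf_iff pmf_pos)
      show "?bound x
        \<le> ?g x"
        unfolding finite_combination_eq[OF finite_T]
        using estimate_bounds(2)[OF _ x c_pos[of "cl x"]] deficit_bounds(1)[of P Q x]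
        by (auto simp: Tested_iff_T err_def)
    qed
  qed
  also have "\<dots> = expect (sem P smp) ?h"
    by (rule expectation_sample[symmetric]) auto
  finally show ?thesis .
qed

end

section \<open>Query cost of one sample\<close>

text \<open>The bound common to both parts: the truncated tilt is at most the tilt, which serves
  part (2), and at most 1, which serves part (1).\<close>

definition truncated_cost :: "int pmf \<Rightarrow> int pmf \<Rightarrow> ennreal" where
  "truncated_cost P Q =
     (\<integral>\<^sup>+ x. min 1 (tilt Q x) * min (sq_log_inv (pmf P x)) (sq_log_inv (pmf Q x)) \<partial>measure_pmf P)"

lemma level_cost_sum_le_square:
  "(\<Sum>m<d. (real m + 1) * min 1 (z m)) \<le> (real d)\<^sup>2"
proof (induction d)
  case (Suc d)
  have "(real d + 1) * min 1 (z d) \<le> (real d + 1) * 1"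
    by (intro mult_left_mono) auto
  with Suc show ?case
    by (simp add: power2_eq_square algebra_simps)
qed simp

text \<open>The first \<kappa> levels cost at most \<kappa> squared; beyond them the weights decay
  geometrically.\<close>

lemma level_cost_sum_le:
  "(\<Sum>m<d. (real m + 1) * min 1 (2 ^ \<kappa> / 2 ^ m)) \<le> (real \<kappa> + 2)\<^sup>2"
proof -
  let ?S = "\<lambda>d. \<Sum>m<d. (real m + 1) * min 1 ((2::real) ^ \<kappa> / 2 ^ m)"
  \<comment> \<open>The subtracted term is an exact potential: from t to t + 1 it falls by (\<kappa>
    + t + 1) / 2^t, the bound for the new level.\<close>
  have tail: "?S (\<kappa> + t) \<le> (real \<kappa>)\<^sup>2 + 2 * (real \<kappa> + 2) - 2 * (real \<kappa> + real t + 2) / 2 ^ t" for t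
  proof (induction t)
    case 0
    then show ?case
      using level_cost_sum_le_square[of "\<lambda>m. 2 ^ \<kappa> / 2 ^ m" \<kappa>] by simp
  next
    case (Suc t)
    have "(real (\<kappa> + t) + 1) * min 1 (2 ^ \<kappa> / 2 ^ (\<kappa> + t)) \<le> (real (\<kappa> + t) + 1) * (1 / 2 ^ t)"
      by (intro mult_left_mono) (auto simp: power_add)
    then have "?S (\<kappa> + Suc t) \<le> ?S (\<kappa> + t) + (real (\<kappa> + t) + 1) / 2 ^ t"
      by simp
    also have "\<dots> \<le> (real \<kappa>)\<^sup>2 + 2 * (real \<kappa> + 2) - 2 * (real \<kappa> + real t + 2) / 2 ^ t + (real (\<kappa> + t) + 1) / 2 ^ t"
      by (intro add_right_mono Suc)
    also have "\<dots> = (real \<kappa>)\<^sup>2 + 2 * (real \<kappa> + 2) - 2 * (real \<kappa> + real (Suc t) + 2) / 2 ^ Suc t"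
      by (simp add: field_simps)
    finally show ?case .
  qed
  have "?S d \<le> ?S (\<kappa> + d)"
    by (intro sum_mono2) auto
  also have "\<dots> \<le> (real \<kappa>)\<^sup>2 + 2 * (real \<kappa> + 2) - 2 * (real \<kappa> + real d + 2) / 2 ^ d"
    by (rule tail)
  also have "\<dots> \<le> (real \<kappa>)\<^sup>2 + 2 * (real \<kappa> + 2)"
    by simp
  also have "\<dots> \<le> (real \<kappa> + 2)\<^sup>2"
    by (simp add: power2_eq_square algebra_simps)
  finally show ?thesis .
qed

lemma ex_power_2_between:
  fixes y :: real
  assumes "1 \<le> y"
  obtains \<kappa> where "y \<le> 2 ^ \<kappa>" "real \<kappa> \<le> 2 * ln y + 1"
proof -
  define \<kappa> where "\<kappa> = nat \<lceil>log 2 y\<rceil>"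
  have nonneg: "0 \<le> log 2 y"
    using assms by simp
  have k1: "log 2 y \<le> real \<kappa>" "real \<kappa> \<le> log 2 y + 1"
    using nonneg by (simp_all add: \<kappa>_def)
  have "y = 2 powr log 2 y"
    using assms by simp
  also have "\<dots> \<le> 2 powr real \<kappa>"
    using k1(1) by (intro powr_mono) auto
  finally have "y \<le> 2 ^ \<kappa>"
    by (simp add: powr_realpow)
  moreover have "log 2 y \<le> ln y / (1 / 2)"
    unfolding log_def using assms ln_2_ge_half by (intro divide_left_mono) auto
  ultimately show ?thesis
    using k1(2) by (intro that[of \<kappa>]) auto
qed

context descent
begin

lemma prog_snd_0:
  assumes "\<And>v. snd (leaf v) = 0" "a \<in> set_pmf (sem P (prog r k v))"
  shows "snd a = 0"
  using assms(2)
proof (induction r arbitrary: k v)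
  case (Suc r)
  then show ?case
    by (auto simp: sem_prog_Suc simp del: descend.simps(2) split: if_splits)
qed (simp add: assms(1))

end

context sampling
begin

definition w :: real where "w = 1 + ln (4 / \<theta>)"

lemma w_ge_1: "1 \<le> w"
  using \<theta>_pos \<theta>_le by (simp add: w_def)

text \<open>Level m is reached with probability at most y / 2^m, because the node has Q-mass at most
  4 / 2^m and P-mass at least P(x). The cost is thus quadratic in ln y; the competing bound is the
  squared depth.\<close>

lemma cost_estimate:
  assumes x: "Tested x" "pmf P x > 0"
  shows "cost P (est x) \<le> ennreal (real (n (cl x))
    * (8 * min ((ln (1 / pmf P x))\<^sup>2) ((ln (1 / pmf Q x))\<^sup>2) + 18 * w\<^sup>2))"
proof -
  interpret d: descent P "\<lambda>k. node Q J k x" "mass_ratio Q J x" "n (cl x)" \<theta> "leaf D (depth Q x)"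
    by (rule descent[OF x])
  define y where "y = 4 / (\<theta> * pmf P x)"
  define LP where "LP = ln (1 / pmf P x)"
  define LQ where "LQ = ln (1 / pmf Q x)"
  have Qx: "pmf Q x > 0" "x \<in> J"
    using Tested_imp x by auto
  have L: "0 \<le> LP" "0 \<le> LQ"
    using x Qx pmf_le_1[of P x] pmf_le_1[of Q x] by (auto simp: LP_def LQ_def)
  have "\<theta> * pmf P x \<le> 1 * 1"
    using \<theta>_pos \<theta>_le pmf_le_1[of P x] by (intro mult_mono) auto
  then have y1: "1 \<le> y"
    using x \<theta>_pos unfolding y_def by (simp add: le_divide_eq)
  have "ln y = ln (4 / \<theta>) + ln (1 / pmf P x)"
    using x \<theta>_pos by (subst ln_mult_pos[symmetric]) (auto simp: y_def)
  then have ln_y: "ln y = w - 1 + LP"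
    by (simp add: w_def LP_def)
  obtain \<kappa> where \<kappa>: "y \<le> 2 ^ \<kappa>" "real \<kappa> \<le> 2 * ln y + 1"
    using ex_power_2_between[OF y1] .
  define S where "S = (\<Sum>m<R x. (real m + 1) * min 1 (y / 2 ^ m))"
  have "cost P (est x)
    \<le> ennreal (\<Sum>m<R x. real (d.N (0 + m)) * min 1 (1 / \<theta> * d.drift (\<lambda>l. mass_ratio Q J x l / d.p l) 0 m))"
    unfolding estimate_def by (rule d.cost_prog[OF \<theta>_le])
  also have "\<dots> \<le> ennreal (real (n (cl x)) * S)"
    unfolding S_def sum_distrib_left
  proof (intro ennreal_leI sum_mono)
    fix m assume m: "m \<in> {..<R x}"
    have "d.drift (\<lambda>l. mass_ratio Q J x l / d.p l) 0 m
        = mass Q (node Q J m x) / mass P (node Q J m x)"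
      using drift_ratio[OF x] by (simp add: d.drift_def q_eq[OF x] p_eq[OF x] atLeast0LessThan)
    also have "\<dots> \<le> (4 / 2 ^ m) / pmf P x"
    proof (intro frac_le)
      show "mass Q (node Q J m x) \<le> 4 / 2 ^ m"
        using Qx m unfolding window_def by (intro prob_node_le) auto
      show "pmf P x \<le> mass P (node Q J m x)"
        using tree.A_self[OF Qx(2)] by (rule pmf_le_prob)
    qed (use x in auto)
    finally have "1 / \<theta> * d.drift (\<lambda>l. mass_ratio Q J x l / d.p l) 0 m \<le> 1 / \<theta> * ((4 / 2 ^ m) / pmf P x)"
      using \<theta>_pos by (intro mult_left_mono) auto
    also have "\<dots> = y / 2 ^ m"
      by (simp add: y_def field_simps)
    finally have "min 1 (1 / \<theta> * d.drift (\<lambda>l. mass_ratio Q J x l / d.p l) 0 m) \<le> min 1 (y / 2 ^ m)"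
      by simp
    then have "real (d.N (0 + m)) * min 1 (1 / \<theta> * d.drift (\<lambda>l. mass_ratio Q J x l / d.p l) 0 m)
        \<le> real (d.N (0 + m)) * min 1 (y / 2 ^ m)"
      by (intro mult_left_mono) auto
    also have "\<dots> = real (n (cl x)) * ((real m + 1) * min 1 (y / 2 ^ m))"
      by (simp add: N_eq[OF x] algebra_simps)
    finally show "real (d.N (0 + m)) * min 1 (1 / \<theta> * d.drift (\<lambda>l. mass_ratio Q J x l / d.p l) 0 m)
        \<le> real (n (cl x)) * ((real m + 1) * min 1 (y / 2 ^ m))" .
  qed
  also have "real (n (cl x)) * S \<le> real (n (cl x)) * (8 * min (LP\<^sup>2) (LQ\<^sup>2) + 18 * w\<^sup>2)"
  proof (intro mult_left_mono)
    have "S \<le> (\<Sum>m<R x. (real m + 1) * min 1 (2 ^ \<kappa> / 2 ^ m))"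
      unfolding S_def using \<kappa>(1) by (intro sum_mono mult_left_mono min.mono divide_right_mono) auto
    also have "\<dots> \<le> (real \<kappa> + 2)\<^sup>2"
      by (rule level_cost_sum_le)
    also have "\<dots> \<le> (2 * LP + 3 * w)\<^sup>2"
      using \<kappa>(2) ln_y w_ge_1 by (intro power_mono) auto
    finally have SP: "S \<le> (2 * LP + 3 * w)\<^sup>2" .
    have "S \<le> (real (R x))\<^sup>2"
      unfolding S_def by (rule level_cost_sum_le_square)
    also have "\<dots> \<le> (2 * LQ + 3 * w)\<^sup>2"
      using depth_le[OF Qx(1)] w_ge_1 by (intro power_mono) (auto simp: LQ_def)
    finally have SQ: "S \<le> (2 * LQ + 3 * w)\<^sup>2" .
    have sq: "(2 * a + 3 * w)\<^sup>2 \<le> 8 * a\<^sup>2 + 18 * w\<^sup>2" for a :: real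
      using zero_le_power2[of "2 * a - 3 * w"] by (simp add: power2_eq_square algebra_simps)
    show "S \<le> 8 * min (LP\<^sup>2) (LQ\<^sup>2) + 18 * w\<^sup>2"
      using SP SQ sq[of LP] sq[of LQ] by (auto simp: min_def)
  qed simp
  finally show ?thesis
    by (simp add: LP_def LQ_def ennreal_leI)
qed

text \<open>For a light point of class i the factor (1/2)^i of the sample size is at most twice the
  truncated tilt, which turns 8 into 16. For a point of mass at least \<open>\<beta>\<close> the
  logarithm itself is bounded.\<close>

lemma cost_estimate_tilt:
  assumes x: "Tested x" "pmf P x > 0"
    and \<nu>: "0 \<le> \<nu>" "real (n (cl x)) \<le> \<nu> * (1 / 2) ^ cl x" and \<beta>: "\<beta> \<le> 1"
  shows "cost P (est x) \<le> ennreal \<nu> *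
    (16 * (min 1 (tilt Q x) * min (sq_log_inv (pmf P x)) (sq_log_inv (pmf Q x)))
      + ennreal (8 * (ln (1 / \<beta>))\<^sup>2 + 18 * w\<^sup>2))"
proof -
  define K where "K = min ((ln (1 / pmf P x))\<^sup>2) ((ln (1 / pmf Q x))\<^sup>2)"
  have Qx: "pmf Q x > 0"
    using Tested_imp x by auto
  have K: "0 \<le> K" "min (sq_log_inv (pmf P x)) (sq_log_inv (pmf Q x)) = ennreal K"
    using x Qx by (auto simp: K_def sq_log_inv_def min_def ennreal_le_iff)
  have le1: "(1 / 2 :: real) ^ cl x \<le> 1"
    by (intro power_le_one) auto
  have half: "ennreal ((1 / 2) ^ cl x * (8 * K)) \<le> 16 * (min 1 (tilt Q x) * ennreal K) + ennreal (8 * (ln (1 / \<beta>))\<^sup>2)"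
  proof (cases "pmf Q x < \<beta>")
    case True
    have "ennreal ((1 / 2) ^ Suc (cl x)) \<le> min 1 (tilt Q x)"
      using tilt_class_light(2)[OF x(1) True I_pos] le1 by (auto simp: ennreal_le_1 intro: less_imp_le)
    then have "ennreal (16 * K) * ennreal ((1 / 2) ^ Suc (cl x)) \<le> ennreal (16 * K) * min 1 (tilt Q x)"
      by (rule mult_left_mono) simp
    moreover have "ennreal (16 * K) * ennreal ((1 / 2) ^ Suc (cl x)) = ennreal ((1 / 2) ^ cl x * (8 * K))"
      using K by (subst ennreal_mult[symmetric]) auto
    moreover have "ennreal (16 * K) * min 1 (tilt Q x) = 16 * (min 1 (tilt Q x) * ennreal K)"
      using K by (simp add: ennreal_mult mult_ac)
    ultimately show ?thesis
      by (simp add: add_increasing2)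
  next
    case False
    have "K \<le> (ln (1 / pmf Q x))\<^sup>2"
      by (simp add: K_def)
    also have "\<dots> \<le> (ln (1 / \<beta>))\<^sup>2"
      using False Qx \<beta>_pos pmf_le_1[of Q x] by (intro power_mono) (auto simp: ln_div)
    finally have "(1 / 2) ^ cl x * (8 * K) \<le> 1 * (8 * (ln (1 / \<beta>))\<^sup>2)"
      using le1 K by (intro mult_mono) auto
    then have "ennreal ((1 / 2) ^ cl x * (8 * K)) \<le> ennreal (8 * (ln (1 / \<beta>))\<^sup>2)"
      by (intro ennreal_leI) simp
    then show ?thesis
      by (simp add: add_increasing)
  qed
  have "cost P (est x) \<le> ennreal (real (n (cl x)) * (8 * K + 18 * w\<^sup>2))"
    using cost_estimate[OF x] by (simp add: K_def)
  also have "\<dots> \<le> ennreal (\<nu> * (1 / 2) ^ cl x * (8 * K + 18 * w\<^sup>2))"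
    using \<nu> K by (intro ennreal_leI mult_right_mono) auto
  also have "\<dots> \<le> ennreal (\<nu> * ((1 / 2) ^ cl x * (8 * K) + 18 * w\<^sup>2))"
  proof (intro ennreal_leI)
    have "(1 / 2) ^ cl x * (18 * w\<^sup>2) \<le> 1 * (18 * w\<^sup>2)"
      using le1 by (intro mult_right_mono) auto
    then show "\<nu> * (1 / 2) ^ cl x * (8 * K + 18 * w\<^sup>2) \<le> \<nu> * ((1 / 2) ^ cl x * (8 * K) + 18 * w\<^sup>2)"
      using \<nu> by (simp only: mult.assoc distrib_left) (intro add_left_mono mult_left_mono, auto)
  qed
  also have "\<dots> = ennreal \<nu> * (ennreal ((1 / 2) ^ cl x * (8 * K)) + ennreal (18 * w\<^sup>2))"
    using \<nu> K by (simp add: ennreal_mult)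
  also have "\<dots> \<le> ennreal \<nu> * (16 * (min 1 (tilt Q x) * ennreal K) + ennreal (8 * (ln (1 / \<beta>))\<^sup>2) + ennreal (18 * w\<^sup>2))"
    by (intro mult_left_mono add_right_mono half) auto
  also have "\<dots> = ennreal \<nu> * (16 * (min 1 (tilt Q x) * ennreal K) + ennreal (8 * (ln (1 / \<beta>))\<^sup>2 + 18 * w\<^sup>2))"
    by (simp add: add.assoc)
  finally show ?thesis
    unfolding K(2) .
qed

lemma cost_sample:
  assumes \<nu>: "0 \<le> \<nu>" "\<And>i. i < I \<Longrightarrow> real (n i) \<le> \<nu> * (1 / 2) ^ i" and \<beta>: "\<beta> \<le> 1"
  shows "cost P smp
    \<le> 1 + ennreal \<nu> * (16 * truncated_cost P Q + ennreal (8 * (ln (1 / \<beta>))\<^sup>2 + 18 * w\<^sup>2))"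
proof -
  let ?k = "ennreal (8 * (ln (1 / \<beta>))\<^sup>2 + 18 * w\<^sup>2)"
  have "(\<integral>\<^sup>+ x. (if Tested x then cost P (est x) else 0) \<partial>measure_pmf P)
    \<le> (\<integral>\<^sup>+ x. ennreal \<nu> * (16 * (min 1 (tilt Q x) * min (sq_log_inv (pmf P x)) (sq_log_inv (pmf Q x))) + ?k) \<partial>measure_pmf P)"
  proof (intro nn_integral_mono_AE, unfold AE_measure_pmf_iff, rule ballI)
    fix x assume "x \<in> set_pmf P"
    then have x: "pmf P x > 0"
      by (simp add: set_pmf_iff pmf_pos)
    show "(if Tested x then cost P (est x) else 0)
      \<le> ennreal \<nu> * (16 * (min 1 (tilt Q x) * min (sq_log_inv (pmf P x)) (sq_log_inv (pmf Q x))) + ?k)"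
      using cost_estimate_tilt[OF _ x \<nu>(1) \<nu>(2) \<beta>] tilt_class_less[OF _ I_pos] by auto
  qed
  also have "\<dots> = ennreal \<nu> * (16 * truncated_cost P Q + ?k)"
    by (simp add: nn_integral_cmult nn_integral_add truncated_cost_def)
  finally show ?thesis
    unfolding cost_sample_prog by (rule add_left_mono)
qed

text \<open>Only points deeper than D can be undecided; their undecided walks have passed D levels,
  which cost at least 1 + ... + D \<ge> D^2 / 2.\<close>

lemma unfinished_estimate:
  assumes x: "Tested x" "pmf P x > 0"
  shows "(\<integral>\<^sup>+ a. of_nat (snd a) \<partial>(sem P (est x))) * of_nat (D\<^sup>2)
    \<le> 2 * cost P (est x)"
proof -
  interpret d: descent P "\<lambda>k. node Q J k x" "mass_ratio Q J x" "n (cl x)" \<theta> "leaf D (depth Q x)"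
    by (rule descent[OF x])
  let ?U = "\<integral>\<^sup>+ a. of_nat (snd a) \<partial>(sem P (est x)) :: ennreal"
  show ?thesis
  proof (cases "depth Q x \<le> D")
    case True
    then have "snd (leaf D (depth Q x) v) = 0" for v
      by (simp add: leaf_def)
    from d.prog_snd_0[OF this] have "AE a in measure_pmf (sem P (est x)). of_nat (snd a) = (0::ennreal)"
      unfolding AE_measure_pmf_iff estimate_def by auto
    then have "?U = (\<integral>\<^sup>+ a. 0 \<partial>(sem P (est x)))"
      by (rule nn_integral_cong_AE)
    then show ?thesis by simp
  next
    case False
    have "D\<^sup>2 \<le> 2 * (\<Sum>m<D. Suc m)"
      by (induction D) (auto simp: power2_eq_square)
    also have "\<dots> \<le> 2 * (\<Sum>m<D. d.N (0 + m))"
      unfolding N_eq[OF x]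
    proof (intro mult_left_mono sum_mono)
      show "Suc m \<le> Suc (0 + m) * n (cl x)" for m
        using n_pos[of "cl x"] mult_le_mono2[of 1 "n (cl x)" "Suc m"] by simp
    qed simp
    finally have "of_nat (D\<^sup>2) \<le> (of_nat (2 * (\<Sum>m<D. d.N (0 + m))) :: ennreal)"
      by (simp only: of_nat_le_iff)
    then have "?U * of_nat (D\<^sup>2) \<le> ?U * (2 * of_nat (\<Sum>m<D. d.N (0 + m)))"
      by (intro mult_left_mono) auto
    also have "\<dots> = 2 * (?U * of_nat (\<Sum>m<D. d.N (0 + m)))"
      by (simp only: mult.left_commute)
    also have "\<dots> \<le> 2 * cost P (est x)"
      using False unfolding estimate_def by (intro mult_left_mono) (auto intro: d.unfinished_cost[of D 0 1, simplified])
    finally show ?thesis .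
  qed
qed

lemma unfinished_sample:
  "(\<integral>\<^sup>+ a. of_nat (snd a) \<partial>(sem P smp)) * of_nat (D\<^sup>2)
    \<le> 2 * cost P smp"
proof -
  let ?U = "\<lambda>x. \<integral>\<^sup>+ a. of_nat (snd a) \<partial>(sem P (est x)) :: ennreal"
  have "(\<integral>\<^sup>+ a. of_nat (snd a) \<partial>(sem P smp))
    = (\<integral>\<^sup>+ x. (if Tested x then ?U x else 0) \<partial>measure_pmf P)"
    unfolding sem_sample_prog nn_integral_bind_pmf by (intro nn_integral_cong) auto
  also have "\<dots> * of_nat (D\<^sup>2) = (\<integral>\<^sup>+ x. (if Tested x then ?U x else 0) * of_nat (D\<^sup>2) \<partial>measure_pmf P)"
    by (simp add: nn_integral_multc)
  also have "\<dots> \<le> (\<integral>\<^sup>+ x. 2 * (if Tested x then cost P (est x) else 0) \<partial>measure_pmf P)"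
  proof (intro nn_integral_mono_AE, unfold AE_measure_pmf_iff, rule ballI)
    fix x assume "x \<in> set_pmf P"
    then have x: "pmf P x > 0"
      by (simp add: set_pmf_iff pmf_pos)
    show "(if Tested x then ?U x else 0) * of_nat (D\<^sup>2) \<le> 2 * (if Tested x then cost P (est x) else 0)"
      using unfinished_estimate[OF _ x] by auto
  qed
  also have "\<dots> \<le> 2 * cost P smp"
    unfolding cost_sample_prog by (simp add: nn_integral_cmult distrib_left add_increasing)
  finally show ?thesis .
qed

lemma sample_finished:
  assumes D: "\<And>x. Tested x \<Longrightarrow> depth Q x \<le> D"
    and a: "a \<in> set_pmf (sem P smp)"
  shows "snd a = 0"
proof -
  obtain x where x: "x \<in> set_pmf P"
    "a \<in> set_pmf (if Tested x then sem P (est x) else return_pmf (1, 0))"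
    using a by (auto simp: sem_sample_prog)
  show ?thesis
  proof (cases "Tested x")
    case True
    have "pmf P x > 0"
      using x(1) by (simp add: set_pmf_iff pmf_pos)
    then show ?thesis
      using x(2) True descent.prog_snd_0[OF descent[OF True]] D[OF True]
      by (auto simp: estimate_def leaf_def)
  qed (use x in auto)
qed

lemma legal_sample: "legal P smp"
proof -
  have "legal_query P UNIV"
    by (simp add: legal_query_def)
  moreover have "legal P (est x)" if "Tested x" "x \<in> set_pmf P" for x
  proof -
    have "pmf P x > 0"
      using that(2) by (simp add: set_pmf_iff pmf_pos)
    then show ?thesis
      using Tested_imp(1)[OF that(1)] unfolding estimate_def
      by (intro descent.legal_prog[OF descent[OF that(1)]]) (auto simp: window_def intro!: legal_node)
  qed
  ultimately show ?thesis
    unfolding sample_prog_def by (auto simp: cond_pmf_UNIV)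
qed

end

section \<open>Comparison of distances and query bounds\<close>

text \<open>Pointwise |P(x) - Q(x)| \<le> 2\<epsilon> Q(x), because a finite distance forces P(x) =
  0 where Q(x) = 0; summation gives 2\<epsilon>, which \<open>tv_dist\<close> halves.\<close>

lemma tv_dist_le_of_linf_dist:
  assumes "linf_dist P Q \<le> ennreal (2 * \<epsilon>)" "0 \<le> \<epsilon>"
  shows "tv_dist P Q \<le> \<epsilon>"
proof -
  have le: "\<bar>pmf P x - pmf Q x\<bar> \<le> 2 * \<epsilon> * pmf Q x" for x
  proof -
    have x: "(if pmf Q x > 0 then ennreal \<bar>pmf P x / pmf Q x - 1\<bar> else if pmf P x > 0 then \<infinity> else 0) \<le> ennreal (2 * \<epsilon>)"
      using assms(1) unfolding linf_dist_def by (rule order.trans[OF SUP_upper, rotated]) simp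
    show ?thesis
    proof (cases "pmf Q x > 0")
      case True
      then have "\<bar>pmf P x / pmf Q x - 1\<bar> \<le> 2 * \<epsilon>"
        using x assms(2) by simp
      moreover have "\<bar>pmf P x - pmf Q x\<bar> = \<bar>pmf P x / pmf Q x - 1\<bar> * pmf Q x"
        using True by (simp add: abs_if field_simps)
      ultimately show ?thesis
        using True by (metis mult_right_mono less_imp_le)
    next
      case False
      then have "pmf P x = 0" "pmf Q x = 0"
        using x pmf_nonneg[of Q x] pmf_nonneg[of P x] by (auto split: if_splits simp: top_unique less_le)
      then show ?thesis by simp
    qed
  qed
  have int: "integrable (count_space UNIV) (\<lambda>x. 2 * \<epsilon> * pmf Q x)"
    by (intro integrable_mult_right integrable_pmf)
  have int': "integrable (count_space UNIV) (\<lambda>x. \<bar>pmf P x - pmf Q x\<bar>)"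
    by (rule Bochner_Integration.integrable_bound[OF int]) (use le assms(2) in auto)
  have "(\<Sum>\<^sub>\<infinity>x. \<bar>pmf P x - pmf Q x\<bar>) = infsetsum (\<lambda>x. \<bar>pmf P x - pmf Q x\<bar>) UNIV"
    using int' by (intro infsetsum_infsum[symmetric]) (simp add: abs_summable_on_def)
  also have "\<dots> \<le> (\<integral>x. 2 * \<epsilon> * pmf Q x \<partial>count_space UNIV)"
    unfolding infsetsum_def by (intro integral_mono int int' le)
  also have "\<dots> = 2 * \<epsilon>"
    by (simp add: integral_pmf)
  finally show ?thesis
    by (simp add: tv_dist_def)
qed

lemma sq_log_inv_antimono:
  assumes "0 < p" "p \<le> q" "q \<le> 1"
  shows "sq_log_inv q \<le> sq_log_inv p"
proof -
  have "ln (1 / q) \<le> ln (1 / p)" "0 \<le> ln (1 / q)"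
    using assms by (auto simp: divide_left_mono)
  then show ?thesis
    using assms by (simp add: sq_log_inv_def ennreal_leI power_mono)
qed

text \<open>The mixture R is a mean, so R(x) is at most the larger of P(x) and Q(x), which has the
  smaller squared logarithm. P \<le> 2R allows the change of measure.\<close>

lemma nn_integral_min_sq_log_inv_le:
  "(\<integral>\<^sup>+ x. min (sq_log_inv (pmf P x)) (sq_log_inv (pmf Q x)) \<partial>measure_pmf P)
    \<le> 2 * (\<integral>\<^sup>+ x. sq_log_inv (pmf (P \<diamondop> Q) x) \<partial>(P \<diamondop> Q))"
proof -
  have "(\<integral>\<^sup>+ x. min (sq_log_inv (pmf P x)) (sq_log_inv (pmf Q x)) \<partial>measure_pmf P)
    = (\<integral>\<^sup>+ x. ennreal (pmf P x) * min (sq_log_inv (pmf P x)) (sq_log_inv (pmf Q x)) \<partial>count_space UNIV)"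
    by (rule nn_integral_measure_pmf)
  also have "\<dots> \<le> (\<integral>\<^sup>+ x. ennreal (2 * pmf (P \<diamondop> Q) x) * sq_log_inv (pmf (P \<diamondop> Q) x) \<partial>count_space UNIV)"
  proof (intro nn_integral_mono)
    fix x
    let ?R = "pmf (P \<diamondop> Q) x"
    show "ennreal (pmf P x) * min (sq_log_inv (pmf P x)) (sq_log_inv (pmf Q x)) \<le> ennreal (2 * ?R) * sq_log_inv ?R"
    proof (cases "pmf P x = 0")
      case False
      then have P: "pmf P x > 0"
        by (simp add: pmf_pos)
      then have R: "0 < ?R" "pmf P x \<le> 2 * ?R"
        unfolding pmf_mix by (simp_all add: add_pos_nonneg)
      have "min (sq_log_inv (pmf P x)) (sq_log_inv (pmf Q x)) \<le> sq_log_inv ?R"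
      proof (cases "pmf Q x \<le> pmf P x")
        case True
        then have "sq_log_inv (pmf P x) \<le> sq_log_inv ?R"
          using R by (intro sq_log_inv_antimono pmf_le_1) (auto simp: pmf_mix)
        then show ?thesis by (rule min.coboundedI1)
      next
        case False
        then have "sq_log_inv (pmf Q x) \<le> sq_log_inv ?R"
          using R by (intro sq_log_inv_antimono pmf_le_1) (auto simp: pmf_mix)
        then show ?thesis by (rule min.coboundedI2)
      qed
      then show ?thesis
        using R by (intro mult_mono ennreal_leI) auto
    qed simp
  qed
  also have "\<dots> = (\<integral>\<^sup>+ x. 2 * (ennreal (pmf (P \<diamondop> Q) x) * sq_log_inv (pmf (P \<diamondop> Q) x)) \<partial>count_space UNIV)"
    by (simp add: ennreal_mult mult.assoc)
  also have "\<dots> = 2 * (\<integral>\<^sup>+ x. sq_log_inv (pmf (P \<diamondop> Q) x) \<partial>(P \<diamondop> Q))"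
    by (simp add: nn_integral_cmult nn_integral_measure_pmf)
  finally show ?thesis .
qed

text \<open>If \<open>x\<close> has tilt less than \<open>1\<close>, then the nearest point \<open>y\<close> of the support is lighter, and its
  tilt makes up for it: \<open>R(y) tilt(y) \<ge> R(x)\<close>.\<close>

lemma low_tilt_neighbour:
  assumes x: "pmf R x > 0" "tilt R x < 1" and y: "pmf R y > 0" "x \<noteq> y"
    and adjacent: "\<And>z. min x y < z \<Longrightarrow> z < max x y \<Longrightarrow> pmf R z = 0"
  shows "ennreal (pmf R x) * sq_log_inv (pmf R x) \<le> ennreal (pmf R y) * (tilt R y * sq_log_inv (pmf R y))"
proof -
  have single: "mass R S = pmf R u" if "u \<in> S" "\<And>z. z \<in> S \<Longrightarrow> z \<noteq> u \<Longrightarrow> pmf R z = 0" for S u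
  proof -
    have "mass R S = mass R (S \<inter> set_pmf R)"
      by (simp add: measure_Int_set_pmf)
    also have "S \<inter> set_pmf R = {u} \<inter> set_pmf R"
    proof (rule set_eqI)
      show "z \<in> S \<inter> set_pmf R \<longleftrightarrow> z \<in> {u} \<inter> set_pmf R" for z
        using that(1) that(2)[of z] by (auto simp: set_pmf_iff)
    qed
    finally show ?thesis
      by (simp add: measure_Int_set_pmf measure_pmf_single)
  qed
  have bounds: "ennreal (pmf R y / pmf R x) \<le> tilt R x \<and> ennreal (pmf R x / pmf R y) \<le> tilt R y"
  proof -
    consider "x < y" | "y < x"
      using y(2) by linarith
    then show ?thesis
    proof cases
      case 1
      have "mass R {x..y - 1} = pmf R x" "mass R {x + 1..y} = pmf R y"
        using 1 adjacent by (auto intro!: single)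
      then have "ennreal (pmf R y / pmf R x) = ennreal (pmf R y) / ennreal (mass R {x..y - 1})"
        "ennreal (pmf R x / pmf R y) = ennreal (pmf R x) / ennreal (mass R {x + 1..y})"
        using x y by (simp_all add: divide_ennreal)
      note eqs = this
      have "ennreal (pmf R y / pmf R x) \<le> tilt R x"
        using 1 unfolding tilt_def eqs(1) by (intro max.coboundedI2 SUP_upper) auto
      moreover have "ennreal (pmf R x / pmf R y) \<le> tilt R y"
        using 1 unfolding tilt_def eqs(2) by (intro max.coboundedI1 SUP_upper) auto
      ultimately show ?thesis ..
    next
      case 2
      have "mass R {y + 1..x} = pmf R x" "mass R {y..x - 1} = pmf R y"
        using 2 adjacent by (auto intro!: single)
      then have "ennreal (pmf R y / pmf R x) = ennreal (pmf R y) / ennreal (mass R {y + 1..x})"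
        "ennreal (pmf R x / pmf R y) = ennreal (pmf R x) / ennreal (mass R {y..x - 1})"
        using x y by (simp_all add: divide_ennreal)
      note eqs = this
      have "ennreal (pmf R y / pmf R x) \<le> tilt R x"
        using 2 unfolding tilt_def eqs(1) by (intro max.coboundedI1 SUP_upper) auto
      moreover have "ennreal (pmf R x / pmf R y) \<le> tilt R y"
        using 2 unfolding tilt_def eqs(2) by (intro max.coboundedI2 SUP_upper) auto
      ultimately show ?thesis ..
    qed
  qed
  have "ennreal (pmf R y / pmf R x) < 1"
    using conjunct1[OF bounds] x(2) by (rule le_less_trans)
  then have "pmf R y \<le> pmf R x"
    using x by (simp add: ennreal_less_one_iff divide_less_eq)
  then have sq: "sq_log_inv (pmf R x) \<le> sq_log_inv (pmf R y)"
    using y by (intro sq_log_inv_antimono pmf_le_1) auto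
  have "ennreal (pmf R x) = ennreal (pmf R y) * ennreal (pmf R x / pmf R y)"
    using y by (subst ennreal_mult[symmetric]) auto
  also have "\<dots> \<le> ennreal (pmf R y) * tilt R y"
    by (intro mult_left_mono conjunct2[OF bounds]) auto
  finally show ?thesis
    using sq by (subst mult.assoc[symmetric]) (intro mult_mono, auto)
qed

lemma ex_next_int:
  fixes S :: "int set"
  assumes "y \<in> S" "x < y"
  shows "\<exists>y\<in>S. x < y \<and> (\<forall>z\<in>S. x < z \<longrightarrow> y \<le> z)"
proof -
  define k where "k = (LEAST k. x + 1 + int k \<in> S)"
  have ex: "x + 1 + int (nat (y - x - 1)) \<in> S"
    using assms by simp
  have "x + 1 + int k \<in> S"
    unfolding k_def by (rule LeastI[of "\<lambda>k. x + 1 + int k \<in> S", OF ex])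
  moreover have "x + 1 + int k \<le> z" if "z \<in> S" "x < z" for z
  proof -
    have "k \<le> nat (z - x - 1)"
      unfolding k_def using that by (intro Least_le) simp
    then show ?thesis
      using that by linarith
  qed
  ultimately show ?thesis
    by (intro bexI[of _ "x + 1 + int k"]) auto
qed

lemma ex_prev_int:
  fixes S :: "int set"
  assumes "y \<in> S" "y < x"
  shows "\<exists>y\<in>S. y < x \<and> (\<forall>z\<in>S. z < x \<longrightarrow> z \<le> y)"
proof -
  have "\<exists>y\<in>uminus ` S. - x < y \<and> (\<forall>z\<in>uminus ` S. - x < z \<longrightarrow> y \<le> z)"
    using assms by (intro ex_next_int[of "- y"]) auto
  then show ?thesis
    by auto
qed

text \<open>A point of tilt below 1 is charged to the next point of the support on its right, or on
  its left if it is the last one. Both charges are injective, so every point pays at most three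
  times, once for itself.\<close>

lemma nn_integral_sq_log_inv_le:
  "(\<integral>\<^sup>+ x. sq_log_inv (pmf R x) \<partial>measure_pmf R)
    \<le> 3 * (\<integral>\<^sup>+ x. tilt R x * sq_log_inv (pmf R x) \<partial>measure_pmf R)"
proof -
  define F where "F x = ennreal (pmf R x) * (tilt R x * sq_log_inv (pmf R x))" for x
  define G where "G x = ennreal (pmf R x) * sq_log_inv (pmf R x)" for x
  define S where "S = set_pmf R"
  have S: "x \<in> S \<longleftrightarrow> pmf R x > 0" for x
    by (simp add: S_def set_pmf_iff pmf_pos less_le)
  define A where "A = {x\<in>S. tilt R x < 1 \<and> (\<exists>y\<in>S. x < y)}"
  define B where "B = {x\<in>S. tilt R x < 1 \<and> \<not> (\<exists>y\<in>S. x < y) \<and> (\<exists>y\<in>S. y < x)}"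
  have "\<forall>x\<in>A. \<exists>y\<in>S. x < y \<and> (\<forall>z\<in>S. x < z \<longrightarrow> y \<le> z)"
    unfolding A_def using ex_next_int by blast
  then obtain nxt where nxt: "\<And>x. x \<in> A \<Longrightarrow> nxt x \<in> S \<and> x < nxt x \<and> (\<forall>z\<in>S. x < z \<longrightarrow> nxt x \<le> z)"
    by metis
  have "\<forall>x\<in>B. \<exists>y\<in>S. y < x \<and> (\<forall>z\<in>S. z < x \<longrightarrow> z \<le> y)"
    unfolding B_def using ex_prev_int by blast
  then obtain prv where prv: "\<And>x. x \<in> B \<Longrightarrow> prv x \<in> S \<and> prv x < x \<and> (\<forall>z\<in>S. z < x \<longrightarrow> z \<le> prv x)"
    by metis
  have inj_nxt: "inj_on nxt A"
  proof (rule inj_onI)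
    fix x x' assume *: "x \<in> A" "x' \<in> A" "nxt x = nxt x'"
    have "x \<in> S" "x' \<in> S"
      using *(1,2) by (auto simp: A_def)
    then show "x = x'"
      using nxt[OF *(1)] nxt[OF *(2)] *(3) by (metis leD linorder_neqE)
  qed
  \<comment> \<open>\<open>B\<close> contains at most the maximum of the support.\<close>
  have inj_prv: "inj_on prv B"
    by (rule inj_onI) (auto simp: B_def not_less intro: order.antisym)
  have shift: "(\<integral>\<^sup>+ x. F (f x) * indicator X x \<partial>count_space UNIV) \<le> (\<integral>\<^sup>+ x. F x \<partial>count_space UNIV)"
    if "inj_on f X" for f X
  proof -
    have "(\<integral>\<^sup>+ x. F (f x) * indicator X x \<partial>count_space UNIV) = (\<integral>\<^sup>+ x. F (f x) \<partial>count_space X)"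
      by (simp add: nn_integral_count_space_indicator)
    also have "\<dots> = (\<integral>\<^sup>+ y. F y \<partial>count_space (f ` X))"
      by (rule nn_integral_bij_count_space[OF inj_on_imp_bij_betw[OF that]])
    also have "\<dots> \<le> (\<integral>\<^sup>+ y. F y \<partial>count_space UNIV)"
      by (simp add: nn_integral_count_space_indicator) (intro nn_integral_mono, simp add: indicator_def)
    finally show ?thesis .
  qed
  have point: "G x \<le> F x + (F (nxt x) * indicator A x + F (prv x) * indicator B x)" for x
  proof (cases "x \<in> S")
    case False
    then show ?thesis
      using S pmf_nonneg[of R x] by (auto simp: G_def less_le)
  next
    case x: True
    have "tilt R x \<ge> 1 \<or> x \<in> A \<or> x \<in> B \<or> S = {x}"
    proof (rule ccontr)
      assume contra: "\<not> (tilt R x \<ge> 1 \<or> x \<in> A \<or> x \<in> B \<or> S = {x})"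
      then obtain y where "y \<in> S" "y \<noteq> x"
        using x by blast
      then show False
        using contra x unfolding A_def B_def by (auto simp: not_le neq_iff)
    qed
    then consider "tilt R x \<ge> 1" | "x \<in> A" | "x \<in> B" | "S = {x}"
      by blast
    then show ?thesis
    proof cases
      case 1
      then have "1 * sq_log_inv (pmf R x) \<le> tilt R x * sq_log_inv (pmf R x)"
        by (rule mult_right_mono) simp
      then have "G x \<le> F x"
        unfolding F_def G_def by (intro mult_left_mono) auto
      then show ?thesis
        by (simp add: add_increasing2)
    next
      case 2
      have "G x \<le> F (nxt x)"
        unfolding F_def G_def
      proof (rule low_tilt_neighbour)
        fix z assume "min x (nxt x) < z" "z < max x (nxt x)"
        then have "z \<notin> S"
          using nxt[OF 2] by auto
        then show "pmf R z = 0"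
          by (simp add: S_def set_pmf_iff)
      qed (use 2 nxt[OF 2] S in \<open>auto simp: A_def\<close>)
      then show ?thesis
        using 2 by (simp add: add_increasing add_increasing2)
    next
      case 3
      have "G x \<le> F (prv x)"
        unfolding F_def G_def
      proof (rule low_tilt_neighbour)
        fix z assume "min x (prv x) < z" "z < max x (prv x)"
        then have "z \<notin> S"
          using prv[OF 3] by auto
        then show "pmf R z = 0"
          by (simp add: S_def set_pmf_iff)
      qed (use 3 prv[OF 3] S in \<open>auto simp: B_def\<close>)
      then show ?thesis
        using 3 by (simp add: add_increasing)
    next
      \<comment> \<open>A point mass has no neighbour to charge, but its logarithm is 0.\<close>
      case 4
      have "mass R S = 1"
        by (simp add: S_def measure_pmf.prob_eq_1 AE_measure_pmf_iff)
      then have "pmf R x = 1"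
        using 4 by (simp add: measure_pmf_single)
      then show ?thesis
        by (simp add: G_def sq_log_inv_def)
    qed
  qed
  have "(\<integral>\<^sup>+ x. sq_log_inv (pmf R x) \<partial>measure_pmf R) = (\<integral>\<^sup>+ x. G x \<partial>count_space UNIV)"
    by (simp add: nn_integral_measure_pmf G_def)
  also have "\<dots> \<le> (\<integral>\<^sup>+ x. F x + (F (nxt x) * indicator A x + F (prv x) * indicator B x) \<partial>count_space UNIV)"
    by (intro nn_integral_mono point)
  also have "\<dots> = (\<integral>\<^sup>+ x. F x \<partial>count_space UNIV) + ((\<integral>\<^sup>+ x. F (nxt x) * indicator A x \<partial>count_space UNIV)
      + (\<integral>\<^sup>+ x. F (prv x) * indicator B x \<partial>count_space UNIV))"
    by (simp add: nn_integral_add)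
  also have "\<dots> \<le> (\<integral>\<^sup>+ x. F x \<partial>count_space UNIV) + ((\<integral>\<^sup>+ x. F x \<partial>count_space UNIV) + (\<integral>\<^sup>+ x. F x \<partial>count_space UNIV))"
    by (intro add_mono order.refl shift inj_nxt inj_prv)
  also have "\<dots> = 3 * (\<integral>\<^sup>+ x. F x \<partial>count_space UNIV)"
    by (simp add: distrib_right[of 1 2, simplified] mult_2[symmetric] flip: distrib_right)
  also have "(\<integral>\<^sup>+ x. F x \<partial>count_space UNIV) = (\<integral>\<^sup>+ x. tilt R x * sq_log_inv (pmf R x) \<partial>measure_pmf R)"
    by (simp add: nn_integral_measure_pmf F_def)
  finally show ?thesis .
qed

section \<open>Stages with doubling depth\<close>

text \<open>The quotient (j + 1)^4 / 2^j is largest at j = 5, where it is 40.5. From 6 on the fourth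
  power grows by a factor of at most (8/7)^4 < 2 per step.\<close>

lemma fourth_power_le: "(real j + 1) ^ 4 \<le> 41 * 2 ^ j"
proof (induction j rule: less_induct)
  case (less j)
  show ?case
  proof (cases "j \<le> 6")
    case True
    then have "j \<in> {0, 1, 2, 3, 4, 5, 6}" by auto
    then show ?thesis by auto
  next
    case False
    then obtain i where i: "j = Suc i" "6 \<le> i" by (cases j) auto
    have "(7 * (real i + 2)) ^ 4 \<le> (8 * (real i + 1)) ^ 4"
      using i by (intro power_mono) auto
    then have "2401 * (real i + 2) ^ 4 \<le> 4096 * (real i + 1) ^ 4"
      unfolding power_mult_distrib by simp
    moreover have "0 \<le> (real i + 1) ^ 4"
      by simp
    ultimately have "(real i + 2) ^ 4 \<le> 2 * (real i + 1) ^ 4"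
      by linarith
    also have "\<dots> \<le> 2 * (41 * 2 ^ i)"
      using less.IH[of i] i by simp
    finally show ?thesis
      using i by (simp add: add.commute)
  qed
qed

text \<open>From stage \<open>J\<close> on, the next stage is entered with probability at most 1/32
  while its cost bound grows at most 16-fold, so the remaining cost is at most twice the current
  bound. Each earlier stage is bounded by that of stage \<open>J\<close>; this makes J + 2 such
  terms.\<close>

lemma staged_cost:
  fixes K :: "nat \<Rightarrow> nat \<Rightarrow> ennreal" and C \<pi> :: "nat \<Rightarrow> ennreal" and B :: real
  assumes K: "\<And>j. K 0 j = 0" "\<And>r j. K (Suc r) j \<le> C j + \<pi> j * K r (Suc j)"
    and C: "\<And>j. C j \<le> ennreal ((real j + 1) ^ 4 * B)"
    and \<pi>: "\<And>j. \<pi> j \<le> 1" "\<And>j. \<pi> j * 4 ^ j \<le> 2 * C j"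
    and B: "0 \<le> B" and J: "\<And>j. J \<le> j \<Longrightarrow> 64 * ((real j + 1) ^ 4 * B) \<le> 4 ^ j"
  shows "K r 0 \<le> ennreal (3 * (real J + 1) ^ 5 * B)"
proof -
  have late: "K r j \<le> ennreal (2 * ((real j + 1) ^ 4 * B))" if "J \<le> j" for r j
    using that
  proof (induction r arbitrary: j)
    case (Suc r)
    define b where "b = (real j + 1) ^ 4 * B"
    have b: "0 \<le> b" using B by (simp add: b_def)
    obtain p where p: "\<pi> j = ennreal p" "0 \<le> p"
      using \<pi>(1)[of j] by (cases "\<pi> j") (auto simp: top_unique)
    have "ennreal (p * 4 ^ j) = \<pi> j * 4 ^ j"
      using p by (simp add: ennreal_mult ennreal_power[symmetric])
    also have "\<dots> \<le> 2 * C j"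
      by (rule \<pi>(2))
    also have "\<dots> \<le> 2 * ennreal b"
      using C[of j] unfolding b_def by (rule mult_left_mono) simp
    also have "\<dots> = ennreal (2 * b)"
      using b by (simp add: ennreal_mult)
    finally have "p * 4 ^ j \<le> 2 * b"
      using b by (subst (asm) ennreal_le_iff) auto
    also have "\<dots> \<le> 4 ^ j / 32"
      using J[OF Suc.prems] by (simp add: b_def)
    finally have p32: "p \<le> 1 / 32"
      by (simp add: field_simps)
    have "(real (Suc j) + 1) ^ 4 \<le> (2 * (real j + 1)) ^ 4"
      by (intro power_mono) auto
    then have "(real (Suc j) + 1) ^ 4 * B \<le> (2 * (real j + 1)) ^ 4 * B"
      using B by (rule mult_right_mono)
    then have next_b: "(real (Suc j) + 1) ^ 4 * B \<le> 16 * b"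
      unfolding power_mult_distrib by (simp add: b_def)
    have "p * (2 * ((real (Suc j) + 1) ^ 4 * B)) \<le> (1 / 32) * (2 * (16 * b))"
      by (rule mult_mono[OF p32]) (use next_b b B in \<open>auto simp: mult.commute\<close>)
    then have step: "p * (2 * ((real (Suc j) + 1) ^ 4 * B)) \<le> b"
      by simp
    have "K (Suc r) j \<le> C j + \<pi> j * K r (Suc j)"
      by (rule K)
    also have "\<dots> \<le> ennreal b + ennreal p * ennreal (2 * ((real (Suc j) + 1) ^ 4 * B))"
      using C[of j] Suc.IH[of "Suc j"] Suc.prems p by (intro add_mono mult_mono) (auto simp: b_def)
    also have "\<dots> = ennreal (b + p * (2 * ((real (Suc j) + 1) ^ 4 * B)))"
      using b p B by (subst ennreal_plus) (auto simp: ennreal_mult)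
    also have "\<dots> \<le> ennreal (2 * b)"
      using step by (intro ennreal_leI) simp
    finally show ?case
      by (simp add: b_def)
  qed (simp add: K)
  have early: "K r j \<le> ennreal (real (J - j) * ((real J + 1) ^ 4 * B) + 2 * ((real J + 1) ^ 4 * B))" if "j \<le> J" for r j
    using that
  proof (induction r arbitrary: j)
    case (Suc r)
    let ?b = "(real J + 1) ^ 4 * B"
    show ?case
    proof (cases "j = J")
      case True
      then show ?thesis using late[of j "Suc r"] by simp
    next
      case False
      then have j: "Suc j \<le> J" using Suc.prems by simp
      have "K (Suc r) j \<le> C j + \<pi> j * K r (Suc j)"
        by (rule K)
      also have "\<dots> \<le> ennreal ?b + 1 * ennreal (real (J - Suc j) * ?b + 2 * ?b)"
      proof (intro add_mono mult_mono Suc.IH j \<pi>)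
        have "(real j + 1) ^ 4 * B \<le> ?b"
          using Suc.prems B by (intro mult_right_mono power_mono) auto
        then show "C j \<le> ennreal ?b"
          using C[of j] by (meson ennreal_leI order.trans)
      qed auto
      also have "\<dots> = ennreal (?b + (real (J - Suc j) * ?b + 2 * ?b))"
        using B by (subst ennreal_plus) auto
      also have "?b + (real (J - Suc j) * ?b + 2 * ?b) = real (J - j) * ?b + 2 * ?b"
        using j by (simp add: of_nat_diff algebra_simps)
      finally show ?thesis .
    qed
  qed (simp add: K)
  have "K r 0 \<le> ennreal (real J * ((real J + 1) ^ 4 * B) + 2 * ((real J + 1) ^ 4 * B))"
    using early[of 0 r] by simp
  also have "\<dots> \<le> ennreal (3 * (real J + 1) ^ 5 * B)"
  proof (intro ennreal_leI)
    have "(real J + 2) * ((real J + 1) ^ 4 * B) \<le> (3 * (real J + 1)) * ((real J + 1) ^ 4 * B)"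
      using B by (intro mult_right_mono) auto
    then show "real J * ((real J + 1) ^ 4 * B) + 2 * ((real J + 1) ^ 4 * B) \<le> 3 * (real J + 1) ^ 5 * B"
      by (simp add: distrib_right numeral_eq_Suc mult.assoc)
  qed
  finally show ?thesis .
qed

text \<open>The constants split the admissible bias \<open>\<gamma> / 4\<close> of one sample into \<open>3 \<gamma> / 64\<close> for untested
  points, \<open>\<gamma> / 8\<close> for the sampling error and \<open>\<gamma> / 16\<close> for early stops.\<close>

definition classes :: "real \<Rightarrow> nat" where
  "classes \<gamma> = (LEAST i. (1 / 2) ^ i \<le> \<gamma> / 64)"

text \<open>The factor 1 + j bounds the harmonic sum up to depth 2^j, and 2048 = 16 * 128 meets the
  mean square error demanded by \<open>accurate_sampling\<close>.\<close>

definition level_samples :: "real \<Rightarrow> nat \<Rightarrow> nat \<Rightarrow> nat" where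
  "level_samples \<gamma> j i = nat \<lceil>2048 * (real (classes \<gamma>))\<^sup>2 * (1 + real j) * (1 / 2) ^ i / \<gamma>\<^sup>2\<rceil>"

text \<open>48 = 16 * 3, where 3 * 2^j is the bound of \<open>sum_stop_error\<close> for one
  class.\<close>

definition stop_threshold :: "real \<Rightarrow> nat \<Rightarrow> real" where
  "stop_threshold \<gamma> j = \<gamma> / (48 * real (classes \<gamma>) * 2 ^ j)"

text \<open>A deviation by \<open>\<gamma> / 4\<close> in stage j then has probability at most
  \<delta> / 2^(j+1), and these sum to at most \<delta> over all stages.\<close>

definition repetitions :: "real \<Rightarrow> real \<Rightarrow> nat \<Rightarrow> nat" where
  "repetitions \<gamma> \<delta> j = nat \<lceil>8 / \<gamma>\<^sup>2 * (ln (1 / \<delta>) + real j + 1)\<rceil>"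

definition stage_sample :: "int pmf \<Rightarrow> real \<Rightarrow> nat \<Rightarrow> (real \<times> nat) prog" where
  "stage_sample Q \<gamma> j =
     sample_prog Q (\<gamma> / 64) (classes \<gamma>) (level_samples \<gamma> j) (stop_threshold \<gamma> j) (2 ^ j)"

text \<open>The sums of \<open>fst\<close> and of \<open>fst\<close> plus \<open>snd\<close> bracket
  the estimate, and a verdict is given once both lie on the same side of the threshold. From stage
  \<open>last_stage\<close> on no walk is cut off, the two sums agree and one of the tests
  applies.\<close>

primrec stages :: "int pmf \<Rightarrow> real \<Rightarrow> real \<Rightarrow> real \<Rightarrow> nat \<Rightarrow> nat \<Rightarrow> verdict prog" where
  "stages Q \<gamma> m \<delta> 0 j = Ret Reject"
| "stages Q \<gamma> m \<delta> (Suc r) j = bind_prog (repeat_prog (repetitions \<gamma> \<delta> j) (stage_sample Q \<gamma> j)) (\<lambda>a.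
     if fst a + real (snd a) \<le> real (repetitions \<gamma> \<delta> j) * m then Ret Accept
     else if real (repetitions \<gamma> \<delta> j) * m < fst a then Ret Reject
     else stages Q \<gamma> m \<delta> r (Suc j))"

text \<open>Depends on the known Q and the accuracy only. The crude bound j < 2^j replaces a
  logarithm, since the number of stages does not enter the query bound.\<close>

definition last_stage :: "int pmf \<Rightarrow> real \<Rightarrow> nat" where
  "last_stage Q \<gamma> = Max (insert 0 (depth Q ` {x \<in> window Q (\<gamma> / 64). tested Q (\<gamma> / 64) (classes \<gamma>) x}))"

definition tester_prog :: "int pmf \<Rightarrow> real \<Rightarrow> real \<Rightarrow> real \<Rightarrow> verdict prog" where
  "tester_prog Q \<epsilon> \<eta> \<delta> = stages Q (\<eta> - \<epsilon>) ((\<epsilon> + \<eta>) / 2) \<delta> (Suc (last_stage Q (\<eta> - \<epsilon>))) 0"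

lemma nat_ceiling_bounds:
  assumes "1 \<le> (t::real)"
  shows "t \<le> real (nat \<lceil>t\<rceil>)" "real (nat \<lceil>t\<rceil>) \<le> 2 * t"
  using assms by (simp_all add: of_nat_nat) linarith+

section \<open>Correctness of the tester\<close>

locale testing =
  fixes P Q :: "int pmf" and \<epsilon> \<eta> \<delta> :: real
  assumes \<epsilon>: "0 < \<epsilon>" "\<epsilon> < \<eta>" "\<eta> < 1" and \<delta>: "0 < \<delta>" "\<delta> < 1"
begin

definition \<gamma> :: real where "\<gamma> = \<eta> - \<epsilon>"
abbreviation I :: nat where "I \<equiv> classes \<gamma>"
abbreviation M :: "nat \<Rightarrow> nat" where "M \<equiv> repetitions \<gamma> \<delta>"
abbreviation mid :: real where "mid \<equiv> (\<epsilon> + \<eta>) / 2"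
abbreviation smpl :: "nat \<Rightarrow> (real \<times> nat) prog" where "smpl \<equiv> stage_sample Q \<gamma>"

lemma \<gamma>: "0 < \<gamma>" "\<gamma> < 1"
  using \<epsilon> by (auto simp: \<gamma>_def)

lemma I_le: "(1 / 2) ^ I \<le> \<gamma> / 64"
proof -
  obtain i where "(1 / 2) ^ i < \<gamma> / 64"
    using real_arch_pow_inv[of "\<gamma> / 64" "1 / 2"] \<gamma> by auto
  then have "(1 / 2) ^ i \<le> \<gamma> / 64" by simp
  then show ?thesis
    unfolding classes_def by (rule LeastI)
qed

lemma less_I: "i < I \<Longrightarrow> \<gamma> / 64 < (1 / 2) ^ i"
  using not_less_Least[of i "\<lambda>i. (1 / 2) ^ i \<le> \<gamma> / 64"] by (simp add: classes_def)

lemma I_pos: "0 < I"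
  using I_le \<gamma> by (cases I) auto

lemma level_samples_bounds:
  fixes j :: nat
  assumes "i < I"
  defines "t \<equiv> 2048 * (real I)\<^sup>2 * (1 + real j) * (1 / 2) ^ i / \<gamma>\<^sup>2"
  shows "t \<le> real (level_samples \<gamma> j i)" "real (level_samples \<gamma> j i) \<le> 2 * t"
proof -
  have I1: "1 \<le> (real I)\<^sup>2"
    using I_pos by (simp add: one_le_power)
  have "\<gamma>\<^sup>2 \<le> \<gamma>"
    using \<gamma> by (simp add: power2_eq_square mult_le_cancel_right1)
  also have "\<dots> \<le> 64 * (1 / 2) ^ i"
    using less_I[OF assms(1)] by simp
  also have "\<dots> \<le> (2048 * (real I)\<^sup>2 * (1 + real j)) * (1 / 2) ^ i"
  proof (intro mult_right_mono)
    have "64 * 1 * 1 \<le> 2048 * (real I)\<^sup>2 * (1 + real j)"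
      using I1 by (intro mult_mono) auto
    then show "64 \<le> 2048 * (real I)\<^sup>2 * (1 + real j)" by simp
  qed simp
  finally have "1 \<le> t"
    using \<gamma> unfolding t_def by (simp add: le_divide_eq)
  then show "t \<le> real (level_samples \<gamma> j i)" "real (level_samples \<gamma> j i) \<le> 2 * t"
    using nat_ceiling_bounds unfolding level_samples_def t_def by blast+
qed

lemma stop_threshold: "0 < stop_threshold \<gamma> j" "stop_threshold \<gamma> j \<le> 1"
proof -
  show "0 < stop_threshold \<gamma> j"
    using \<gamma> I_pos by (simp add: stop_threshold_def)
  have "1 * 1 * 1 \<le> 48 * real I * 2 ^ j"
    using I_pos by (intro mult_mono) auto
  then show "stop_threshold \<gamma> j \<le> 1"
    using \<gamma> by (simp add: stop_threshold_def divide_le_eq)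
qed

lemma harmonic_level_samples:
  assumes "i < I"
  shows "(\<Sum>l<2 ^ j. 1 / real (Suc l * level_samples \<gamma> j i)) \<le> \<gamma>\<^sup>2 * 2 ^ i / (2048 * (real I)\<^sup>2)"
proof -
  let ?n = "real (level_samples \<gamma> j i)"
  let ?t = "2048 * (real I)\<^sup>2 * (1 + real j) * (1 / 2) ^ i / \<gamma>\<^sup>2"
  have t: "0 < ?t"
    using \<gamma> I_pos by (auto intro!: divide_pos_pos mult_pos_pos)
  have "(\<Sum>l<2 ^ j. 1 / real (Suc l * level_samples \<gamma> j i)) = (\<Sum>l<2 ^ j. 1 / real (Suc l)) / ?n"
    by (simp add: sum_divide_distrib del: mult_Suc of_nat_Suc)
  also have "\<dots> \<le> (1 + real j) / ?n"
    by (intro divide_right_mono harmonic_dyadic_le) simp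
  also have "\<dots> \<le> (1 + real j) / ?t"
    using t level_samples_bounds(1)[OF assms, of j] by (intro divide_left_mono mult_pos_pos) auto
  also have "\<dots> = \<gamma>\<^sup>2 * 2 ^ i / (2048 * (real I)\<^sup>2)"
  proof -
    have cancel: "x / (2048 * k * x * (1 / 2) ^ i / g) = g * 2 ^ i / (2048 * k)" if "x \<noteq> 0" "k \<noteq> 0" "g \<noteq> 0" for x k g :: real
      using that by (simp add: power_divide field_simps)
    show ?thesis
      by (rule cancel) (use \<gamma> I_pos in auto)
  qed
  finally show ?thesis .
qed

lemma accurate: "accurate_sampling (\<gamma> / 64) I (level_samples \<gamma> j) (stop_threshold \<gamma> j) (2 ^ j) \<gamma>"
proof
  show "0 < level_samples \<gamma> j i" for i
    using \<gamma> I_pos unfolding level_samples_def by (auto intro!: divide_pos_pos mult_pos_pos)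
  show "(\<Sum>l<2 ^ j. 1 / real (Suc l * level_samples \<gamma> j i)) \<le> 1 / 6" if i: "i < I" for i
  proof -
    have I1: "1 \<le> (real I)\<^sup>2"
      using I_pos by (simp add: one_le_power)
    have "\<gamma> * (\<gamma> * 2 ^ i) \<le> 1 * 64"
      using less_I[OF i] \<gamma> by (intro mult_mono) (auto simp: field_simps)
    then have "\<gamma>\<^sup>2 * 2 ^ i / (2048 * (real I)\<^sup>2) \<le> 64 / (2048 * 1)"
      using I1 by (intro frac_le) (auto simp: power2_eq_square)
    then show ?thesis
      using harmonic_level_samples[OF i, of j] by linarith
  qed
  show "16 * (\<Sum>l<2 ^ j. 1 / real (Suc l * level_samples \<gamma> j i)) \<le> \<gamma>\<^sup>2 * 2 ^ i / (128 * (real I)\<^sup>2)" if i: "i < I" for i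
    using harmonic_level_samples[OF i, of j] by simp
  show "stop_threshold \<gamma> j * (real I * (3 * real (2 ^ j))) \<le> \<gamma> / 16"
    using I_pos by (simp add: stop_threshold_def)
qed (use \<gamma> I_pos I_le less_I stop_threshold in \<open>auto intro: less_imp_le\<close>)

lemma M_ge: "8 / \<gamma>\<^sup>2 * (ln (1 / \<delta>) + real j + 1) \<le> real (M j)"
  unfolding repetitions_def by (rule real_nat_ceiling_ge)

lemma exp_M: "exp (- 2 * real (M j) * (\<gamma> / 4)\<^sup>2) \<le> \<delta> * (1 / 2) ^ Suc j"
proof -
  have "(8 / \<gamma>\<^sup>2 * (ln (1 / \<delta>) + real j + 1)) * (\<gamma>\<^sup>2 / 8) \<le> real (M j) * (\<gamma>\<^sup>2 / 8)"
    by (intro mult_right_mono M_ge) simp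
  then have "exp (- 2 * real (M j) * (\<gamma> / 4)\<^sup>2) \<le> exp (- (ln (1 / \<delta>) + real j + 1))"
    using \<gamma> by (simp add: power_divide)
  also have "\<dots> = \<delta> * exp (- real (Suc j) * 1)"
    using \<delta> by (simp add: exp_diff exp_minus exp_add ln_div algebra_simps divide_inverse)
  also have "exp (- real (Suc j) * 1) \<le> exp (- real (Suc j) * ln 2)"
    using ln_2_less_1 by (simp only: exp_le_cancel_iff) (intro mult_left_mono_neg, auto)
  also have "exp (- real (Suc j) * ln 2) = (1 / 2) ^ Suc j"
    by (simp only: mult_minus_left exp_minus exp_of_nat_mult exp_ln zero_less_numeral)
       (simp add: power_divide inverse_eq_divide)
  finally show ?thesis
    using \<delta> by simp
qed

lemma smpl_range:
  assumes "a \<in> set_pmf (sem P (smpl j))"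
  shows "0 \<le> fst a" "fst a + real (snd a) \<le> 1" "fst a \<le> 1"
proof -
  interpret accurate_sampling P Q "\<gamma> / 64" I "level_samples \<gamma> j" "stop_threshold \<gamma> j" "2 ^ j" \<gamma>
    by (rule accurate)
  show "0 \<le> fst a" "fst a + real (snd a) \<le> 1"
    using sample_range assms unfolding stage_sample_def by blast+
  then show "fst a \<le> 1"
    using of_nat_0_le_iff[of "snd a", where 'a = real] by linarith
qed

lemma accept_stage_error:
  assumes "tv_dist P Q \<le> \<epsilon>"
  shows "mass (sem P (repeat_prog (M j) (smpl j))) {a. real (M j) * mid < fst a} \<le> \<delta> * (1 / 2) ^ Suc j"
proof -
  interpret accurate_sampling P Q "\<gamma> / 64" I "level_samples \<gamma> j" "stop_threshold \<gamma> j" "2 ^ j" \<gamma>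
    by (rule accurate)
  \<comment> \<open>The threshold is \<open>\<gamma> / 2\<close> away from either case: half of this
    covers the bias of one sample, half the deviation of the sum.\<close>
  have mid: "mid = (\<epsilon> + \<gamma> / 4) + \<gamma> / 4"
    by (simp add: \<gamma>_def field_simps)
  have "mass (sem P (repeat_prog (M j) (smpl j))) {a. real (M j) * mid < fst a}
    \<le> mass (sem P (repeat_prog (M j) (smpl j))) {a. fst a \<ge> real (M j) * ((\<epsilon> + \<gamma> / 4) + \<gamma> / 4)}"
    unfolding mid by (intro measure_pmf.finite_measure_mono) auto
  also have "\<dots> \<le> exp (- 2 * real (M j) * (\<gamma> / 4)\<^sup>2)"
  proof (rule repeat_tail[where l = 0])
    show "expect (sem P (smpl j)) fst \<le> \<epsilon> + \<gamma> / 4"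
      using sample_mean_upper assms unfolding stage_sample_def by linarith
  qed (use smpl_range \<gamma> in auto)
  also have "\<dots> \<le> \<delta> * (1 / 2) ^ Suc j"
    by (rule exp_M)
  finally show ?thesis .
qed

lemma reject_stage_error:
  assumes "\<eta> \<le> tv_dist P Q"
  shows "mass (sem P (repeat_prog (M j) (smpl j))) {a. fst a + real (snd a) \<le> real (M j) * mid}
    \<le> \<delta> * (1 / 2) ^ Suc j"
proof -
  interpret accurate_sampling P Q "\<gamma> / 64" I "level_samples \<gamma> j" "stop_threshold \<gamma> j" "2 ^ j" \<gamma>
    by (rule accurate)
  let ?h = "\<lambda>a::real \<times> nat. - (fst a + real (snd a))"
  have mid: "mid = - ((\<gamma> / 4 - \<eta>) + \<gamma> / 4)"
    by (simp add: \<gamma>_def field_simps)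
  have "mass (sem P (repeat_prog (M j) (smpl j))) {a. fst a + real (snd a) \<le> real (M j) * mid}
    \<le> mass (sem P (repeat_prog (M j) (smpl j))) {a. ?h a \<ge> real (M j) * ((\<gamma> / 4 - \<eta>) + \<gamma> / 4)}"
    unfolding mid by (intro measure_pmf.finite_measure_mono) (auto simp: algebra_simps)
  also have "\<dots> \<le> exp (- 2 * real (M j) * (\<gamma> / 4)\<^sup>2)"
  proof (rule repeat_tail[where l = "- 1"])
    have "expect (sem P (smpl j)) ?h = - expect (sem P (smpl j)) (\<lambda>a. fst a + real (snd a))"
      by (rule Bochner_Integration.integral_minus)
    then show "expect (sem P (smpl j)) ?h \<le> \<gamma> / 4 - \<eta>"
      using sample_mean_lower assms unfolding stage_sample_def by linarith
    show "?h a \<in> {- 1..- 1 + 1}" if "a \<in> set_pmf (sem P (smpl j))" for a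
      using smpl_range[OF that] by auto
  qed (use \<gamma> in auto)
  also have "\<dots> \<le> \<delta> * (1 / 2) ^ Suc j"
    by (rule exp_M)
  finally show ?thesis .
qed

lemma repeat_finished:
  assumes "last_stage Q \<gamma> \<le> j" "a \<in> set_pmf (sem P (repeat_prog m (smpl j)))"
  shows "snd a = 0"
proof -
  interpret accurate_sampling P Q "\<gamma> / 64" I "level_samples \<gamma> j" "stop_threshold \<gamma> j" "2 ^ j" \<gamma>
    by (rule accurate)
  have "depth Q x \<le> 2 ^ j" if "tested Q (\<gamma> / 64) I x" for x
  proof -
    have fin: "finite {x \<in> window Q (\<gamma> / 64). tested Q (\<gamma> / 64) I x}"
      by (rule finite_subset[of _ "window Q (\<gamma> / 64)"]) (auto simp: window_def)
    have "depth Q x \<le> last_stage Q \<gamma>"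
      unfolding last_stage_def using fin that by (intro Max_ge) (auto simp: tested_def)
    then show ?thesis
      using assms(1) less_exp[of j] by linarith
  qed
  then have one: "snd b = 0" if "b \<in> set_pmf (sem P (smpl j))" for b
    using sample_finished that unfolding stage_sample_def by blast
  show ?thesis
    using assms(2)
  proof (induction m arbitrary: a)
    case (Suc m)
    then show ?case using one by (auto simp: sem_bind)
  qed simp
qed

text \<open>Outside \<open>E j\<close>, stage j does not give the wrong verdict v. The bounds halve
  from stage to stage, so those from stage j on sum to \<delta> / 2^j; at the end
  \<open>repeat_finished\<close> forces a decision.\<close>

lemma stages_error:
  assumes E: "\<And>j. mass (sem P (repeat_prog (M j) (smpl j))) (E j) \<le> \<delta> * (1 / 2) ^ Suc j"
    and wrong: "\<And>j a. a \<notin> E j \<Longrightarrow>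
      (if fst a + real (snd a) \<le> real (M j) * mid then v \<noteq> Accept
       else real (M j) * mid < fst a \<longrightarrow> v \<noteq> Reject)"
    and last: "last_stage Q \<gamma> \<le> j + r"
  shows "emeasure (measure_pmf (sem P (stages Q \<gamma> mid \<delta> (Suc r) j))) {v} \<le> ennreal (\<delta> * (1 / 2) ^ j)"
  using last
proof (induction r arbitrary: j)
  case (0 j)
  let ?S = "sem P (repeat_prog (M j) (smpl j))"
  have "emeasure (measure_pmf (sem P (stages Q \<gamma> mid \<delta> (Suc 0) j))) {v} \<le> (\<integral>\<^sup>+ a. indicator (E j) a \<partial>measure_pmf ?S)"
    unfolding stages.simps sem_bind emeasure_bind_pmf
  proof (intro nn_integral_mono_AE, unfold AE_measure_pmf_iff, rule ballI)
    fix a assume "a \<in> set_pmf ?S"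
    then have "snd a = 0"
      using repeat_finished[of j a] 0 by simp
    then show "emeasure (measure_pmf (sem P (if fst a + real (snd a) \<le> real (M j) * mid then Ret Accept
        else if real (M j) * mid < fst a then Ret Reject else Ret Reject))) {v} \<le> indicator (E j) a"
      using wrong[of a j] by (cases "a \<in> E j") (auto simp: measure_pmf.emeasure_le_1 split: if_splits)
  qed
  also have "\<dots> \<le> ennreal (\<delta> * (1 / 2) ^ Suc j)"
    using E[of j] by (simp add: measure_pmf.emeasure_eq_measure ennreal_leI)
  also have "\<dots> \<le> ennreal (\<delta> * (1 / 2) ^ j)"
    using \<delta> by (intro ennreal_leI) auto
  finally show ?case .
next
  case (Suc r j)
  let ?S = "sem P (repeat_prog (M j) (smpl j))"
  have "emeasure (measure_pmf (sem P (stages Q \<gamma> mid \<delta> (Suc (Suc r)) j))) {v}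
    \<le> (\<integral>\<^sup>+ a. indicator (E j) a + ennreal (\<delta> * (1 / 2) ^ Suc j) \<partial>measure_pmf ?S)"
    unfolding stages.simps(2)[of Q \<gamma> mid \<delta> "Suc r"] sem_bind emeasure_bind_pmf
  proof (intro nn_integral_mono)
    fix a
    have "emeasure (measure_pmf (sem P (stages Q \<gamma> mid \<delta> (Suc r) (Suc j)))) {v} \<le> ennreal (\<delta> * (1 / 2) ^ Suc j)"
      using Suc.prems by (intro Suc.IH) simp
    then show "emeasure (measure_pmf (sem P (if fst a + real (snd a) \<le> real (M j) * mid then Ret Accept
        else if real (M j) * mid < fst a then Ret Reject else stages Q \<gamma> mid \<delta> (Suc r) (Suc j)))) {v}
      \<le> indicator (E j) a + ennreal (\<delta> * (1 / 2) ^ Suc j)"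
      using wrong[of a j]
      by (cases "a \<in> E j")
        (auto simp: indicator_def add_increasing2 add_increasing simp del: stages.simps power_Suc
          intro: order.trans[OF measure_pmf.emeasure_le_1] split: if_splits)
  qed
  also have "\<dots> = emeasure (measure_pmf ?S) (E j) + ennreal (\<delta> * (1 / 2) ^ Suc j)"
    by (simp add: nn_integral_add measure_pmf.emeasure_space_1 del: power_Suc)
  also have "\<dots> \<le> ennreal (\<delta> * (1 / 2) ^ Suc j) + ennreal (\<delta> * (1 / 2) ^ Suc j)"
    using E[of j] by (intro add_right_mono) (simp add: measure_pmf.emeasure_eq_measure ennreal_leI del: power_Suc)
  also have "\<dots> = ennreal (\<delta> * (1 / 2) ^ j)"
    using \<delta> by (subst ennreal_plus[symmetric]) auto
  finally show ?case .
qed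

lemma tester_correct:
  assumes "v \<noteq> v'"
    and "emeasure (measure_pmf (sem P (tester_prog Q \<epsilon> \<eta> \<delta>))) {v'} \<le> ennreal \<delta>"
  shows "1 - \<delta> \<le> prob_output P (alg (tester_prog Q \<epsilon> \<eta> \<delta>)) v"
proof -
  let ?S = "sem P (tester_prog Q \<epsilon> \<eta> \<delta>)"
  have "- {v} = {v'}"
    using assms(1) by (auto intro: verdict.exhaust) (metis verdict.exhaust)+
  then have "mass ?S {v'} = 1 - mass ?S {v}"
    using measure_pmf.prob_compl[of "{v}" ?S] by (simp add: Compl_eq_Diff_UNIV)
  moreover have "mass ?S {v'} \<le> \<delta>"
    using assms(2) \<delta> by (simp add: measure_pmf.emeasure_eq_measure)
  ultimately show ?thesis
    using prob_output_alg[of P "tester_prog Q \<epsilon> \<eta> \<delta>" v] by linarith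
qed

lemma tester_accept:
  assumes "tv_dist P Q \<le> \<epsilon>"
  shows "1 - \<delta> \<le> prob_output P (alg (tester_prog Q \<epsilon> \<eta> \<delta>)) Accept"
proof (rule tester_correct[where v' = Reject])
  have "emeasure (measure_pmf (sem P (stages Q \<gamma> mid \<delta> (Suc (last_stage Q \<gamma>)) 0))) {Reject} \<le> ennreal (\<delta> * (1 / 2) ^ 0)"
    by (rule stages_error[where E = "\<lambda>j. {a. real (M j) * mid < fst a}", OF accept_stage_error[OF assms]]) auto
  then show "emeasure (measure_pmf (sem P (tester_prog Q \<epsilon> \<eta> \<delta>))) {Reject} \<le> ennreal \<delta>"
    by (simp add: tester_prog_def \<gamma>_def del: stages.simps)
qed simp

lemma tester_reject:
  assumes "\<eta> \<le> tv_dist P Q"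
  shows "1 - \<delta> \<le> prob_output P (alg (tester_prog Q \<epsilon> \<eta> \<delta>)) Reject"
proof (rule tester_correct[where v' = Accept])
  have "emeasure (measure_pmf (sem P (stages Q \<gamma> mid \<delta> (Suc (last_stage Q \<gamma>)) 0))) {Accept} \<le> ennreal (\<delta> * (1 / 2) ^ 0)"
    by (rule stages_error[where E = "\<lambda>j. {a. fst a + real (snd a) \<le> real (M j) * mid}", OF reject_stage_error[OF assms]]) auto
  then show "emeasure (measure_pmf (sem P (tester_prog Q \<epsilon> \<eta> \<delta>))) {Accept} \<le> ennreal \<delta>"
    by (simp add: tester_prog_def \<gamma>_def del: stages.simps)
qed simp

lemma legal_tester: "legal P (tester_prog Q \<epsilon> \<eta> \<delta>)"
proof -
  have one: "legal P (smpl j)" for j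
  proof -
    interpret accurate_sampling P Q "\<gamma> / 64" I "level_samples \<gamma> j" "stop_threshold \<gamma> j" "2 ^ j" \<gamma>
      by (rule accurate)
    show ?thesis
      unfolding stage_sample_def by (rule legal_sample)
  qed
  have "legal P (stages Q \<gamma> m \<delta> r j)" for m r j
    by (induction r arbitrary: j) (auto simp: legal_bind intro!: legal_repeat one)
  then show ?thesis
    unfolding tester_prog_def \<gamma>_def[symmetric] .
qed

section \<open>Expected number of queries of the tester\<close>

definition C :: "nat \<Rightarrow> ennreal" where "C j = cost P (repeat_prog (M j) (smpl j))"

definition \<pi> :: "nat \<Rightarrow> ennreal" where
  "\<pi> j = emeasure (measure_pmf (sem P (repeat_prog (M j) (smpl j)))) {a. snd a \<noteq> 0}"

text \<open>If no walk was cut off, the two tests are complementary, so the next stage is entered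
  only for \<open>snd a\<close> nonzero; its cost is independent of a.\<close>

lemma cost_stages_Suc:
  "cost P (stages Q \<gamma> m \<delta> (Suc r) j) \<le> C j + \<pi> j * cost P (stages Q \<gamma> m \<delta> r (Suc j))"
proof -
  let ?S = "sem P (repeat_prog (M j) (smpl j))" and ?K = "cost P (stages Q \<gamma> m \<delta> r (Suc j))"
  have "cost P (stages Q \<gamma> m \<delta> (Suc r) j) = C j + (\<integral>\<^sup>+ a. cost P
      (if fst a + real (snd a) \<le> real (M j) * m then Ret Accept
       else if real (M j) * m < fst a then Ret Reject else stages Q \<gamma> m \<delta> r (Suc j)) \<partial>measure_pmf ?S)"
    by (simp add: cost_bind C_def)
  also have "\<dots> \<le> C j + (\<integral>\<^sup>+ a. indicator {a. snd a \<noteq> 0} a * ?K \<partial>measure_pmf ?S)"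
    by (intro add_left_mono nn_integral_mono) (auto simp: indicator_def)
  also have "\<dots> = C j + \<pi> j * ?K"
    by (simp add: nn_integral_multc \<pi>_def)
  finally show ?thesis .
qed

text \<open>The expected number of undecided walks bounds the probability that there is one. It is
  linear in the repetitions, and \<open>unfinished_sample\<close> applies with squared depth
  4^j.\<close>

lemma \<pi>_cost: "\<pi> j * 4 ^ j \<le> 2 * C j"
proof -
  interpret accurate_sampling P Q "\<gamma> / 64" I "level_samples \<gamma> j" "stop_threshold \<gamma> j" "2 ^ j" \<gamma>
    by (rule accurate)
  let ?u = "\<lambda>a::real \<times> nat. of_nat (snd a) :: ennreal"
  have "\<pi> j \<le> (\<integral>\<^sup>+ a. ?u a \<partial>(sem P (repeat_prog (M j) (smpl j))))"
    unfolding \<pi>_def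
    by (subst nn_integral_indicator[symmetric], simp, intro nn_integral_mono)
      (auto simp: indicator_def ennreal_of_nat_eq_real_of_nat Suc_le_eq)
  also have "\<dots> = of_nat (M j) * (\<integral>\<^sup>+ a. ?u a \<partial>(sem P (smpl j)))"
    by (rule nn_integral_repeat) auto
  finally have "\<pi> j * of_nat ((2 ^ j)\<^sup>2)
      \<le> of_nat (M j) * (\<integral>\<^sup>+ a. ?u a \<partial>(sem P (smpl j))) * of_nat ((2 ^ j)\<^sup>2)"
    by (rule mult_right_mono) simp
  also have "\<dots> \<le> of_nat (M j) * (2 * cost P (smpl j))"
    unfolding mult.assoc stage_sample_def by (intro mult_left_mono unfinished_sample) simp
  also have "\<dots> = 2 * C j"
    by (simp add: C_def cost_repeat mult_ac)
  finally show ?thesis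
    by (simp add: power_mult[symmetric] mult.commute[of j] power_mult[of 2 2])
qed

end

lemma truncated_cost_le_tilt:
  "truncated_cost P Q
    \<le> (\<integral>\<^sup>+ x. tilt Q x * min (sq_log_inv (pmf P x)) (sq_log_inv (pmf Q x)) \<partial>measure_pmf P)"
  unfolding truncated_cost_def by (intro nn_integral_mono mult_right_mono) auto

text \<open>6 = 2 * 3: a factor 2 for passing from P to the mixture and a factor 3 for charging
  points of low tilt to their neighbours.\<close>

lemma truncated_cost_le_mix:
  "truncated_cost P Q
    \<le> 6 * (\<integral>\<^sup>+ x. tilt (P \<diamondop> Q) x * sq_log_inv (pmf (P \<diamondop> Q) x) \<partial>(P \<diamondop> Q))"
proof -
  have "truncated_cost P Q \<le> (\<integral>\<^sup>+ x. 1 * min (sq_log_inv (pmf P x)) (sq_log_inv (pmf Q x)) \<partial>measure_pmf P)"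
    unfolding truncated_cost_def by (intro nn_integral_mono mult_right_mono) auto
  also have "\<dots> \<le> 2 * (\<integral>\<^sup>+ x. sq_log_inv (pmf (P \<diamondop> Q) x) \<partial>(P \<diamondop> Q))"
    using nn_integral_min_sq_log_inv_le by simp
  also have "\<dots> \<le> 2 * (3 * (\<integral>\<^sup>+ x. tilt (P \<diamondop> Q) x * sq_log_inv (pmf (P \<diamondop> Q) x) \<partial>(P \<diamondop> Q)))"
    by (intro mult_left_mono nn_integral_sq_log_inv_le) auto
  finally show ?thesis
    by (simp add: mult.assoc[symmetric])
qed

text \<open>4534272 = 9 * 4096 * 123, from the repetitions, the samples per level and the cost of a
  walk; 2, 132 and 326 bound \<open>Ld + 1\<close>, \<open>real I\<close> and \<open>w0\<close> by
  multiples of the logarithm in \<open>cost_tester\<close>.\<close>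

definition cost_factor :: real where
  "cost_factor = 4534272 * (2 * 132\<^sup>2 * 326\<^sup>2)"

text \<open>Limits the number of stages until \<pi> is small: 2624 = 64 * 41 combines
  \<open>staged_cost\<close> with \<open>fourth_power_le\<close>, and 14 = 2 * 6 + 2.\<close>

definition log_factor :: real where
  "log_factor = 2 * ln (2624 * cost_factor) + 14"

definition tester_factor :: real where
  "tester_factor = 3 * log_factor ^ 5 * cost_factor"

lemma log_factor_pos: "0 < log_factor"
  by (simp add: log_factor_def cost_factor_def add_nonneg_pos)

lemma tester_factor_pos: "0 < tester_factor"
  using log_factor_pos by (simp add: tester_factor_def cost_factor_def)

context testing
begin

text \<open>The value of \<open>w\<close> in stage 0; stage j adds j ln 2.\<close>

definition w0 :: real where "w0 = 1 + ln (192 * real I / \<gamma>)"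
definition Ld :: real where "Ld = ln (1 / \<delta>)"

lemma Ld_nonneg: "0 \<le> Ld"
  using \<delta> by (simp add: Ld_def)

lemma ratio_ge: "1 \<le> 192 * real I / \<gamma>" "64 / \<gamma> \<le> 192 * real I / \<gamma>"
proof -
  have "64 \<le> 192 * real I"
    using I_pos by simp
  then show le: "64 / \<gamma> \<le> 192 * real I / \<gamma>"
    using \<gamma> by (intro divide_right_mono) auto
  have "1 \<le> 64 / \<gamma>"
    using \<gamma> by simp
  with le show "1 \<le> 192 * real I / \<gamma>"
    by linarith
qed

lemma w0_ge_1: "1 \<le> w0"
  using ratio_ge by (simp add: w0_def)

lemma cost_smpl:
  assumes e: "1 \<le> e" "truncated_cost P Q \<le> ennreal (6 * e)"
  shows "cost P (smpl j)
    \<le> ennreal (4096 * (real I)\<^sup>2 * (1 + real j) / \<gamma>\<^sup>2 * (123 * e * w0\<^sup>2 * (1 + real j)\<^sup>2))"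
proof -
  interpret accurate_sampling P Q "\<gamma> / 64" I "level_samples \<gamma> j" "stop_threshold \<gamma> j" "2 ^ j" \<gamma>
    by (rule accurate)
  define \<nu> where "\<nu> = 4096 * (real I)\<^sup>2 * (1 + real j) / \<gamma>\<^sup>2"
  have I1: "1 \<le> (real I)\<^sup>2"
    using I_pos by (simp add: one_le_power)
  have "\<gamma>\<^sup>2 \<le> 1"
    using \<gamma> by (intro power_le_one) auto
  moreover have "1 * 1 * 1 \<le> 4096 * (real I)\<^sup>2 * (1 + real j)"
    using I1 by (intro mult_mono) auto
  ultimately have "\<gamma>\<^sup>2 \<le> 4096 * (real I)\<^sup>2 * (1 + real j)"
    by linarith
  then have \<nu>: "1 \<le> \<nu>"
    using \<gamma> by (simp add: \<nu>_def le_divide_eq)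
  have n: "real (level_samples \<gamma> j i) \<le> \<nu> * (1 / 2) ^ i" if "i < I" for i
    using level_samples_bounds(2)[OF that, of j] by (simp add: \<nu>_def mult_ac)
  let ?L = "8 * (ln (1 / (\<gamma> / 64)))\<^sup>2 + 18 * w\<^sup>2"
  have "cost P (smpl j) \<le> 1 + ennreal \<nu> * (16 * truncated_cost P Q + ennreal ?L)"
    unfolding stage_sample_def using \<nu> n \<gamma> by (intro cost_sample) auto
  also have "\<dots> \<le> ennreal 1 + ennreal \<nu> * (16 * ennreal (6 * e) + ennreal ?L)"
    using e(2) by (intro add_mono mult_left_mono) auto
  also have "\<dots> = ennreal (1 + \<nu> * (96 * e + ?L))"
  proof -
    have "16 * ennreal (6 * e) = ennreal (96 * e)"
      using e by (simp add: ennreal_mult[of 16 "6 * e", simplified])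
    then show ?thesis
      using e \<nu> by (simp add: ennreal_mult)
  qed
  also have "1 + \<nu> * (96 * e + ?L) \<le> \<nu> * (123 * e * w0\<^sup>2 * (1 + real j)\<^sup>2)"
  proof -
    have w_eq: "w = w0 + real j * ln 2"
    proof -
      have "4 / stop_threshold \<gamma> j = (192 * real I / \<gamma>) * 2 ^ j"
        by (simp add: stop_threshold_def)
      then have "ln (4 / stop_threshold \<gamma> j) = ln (192 * real I / \<gamma>) + ln (2 ^ j)"
        using ratio_ge(1) by (simp only:) (intro ln_mult_pos, auto)
      then show ?thesis
        by (simp add: w_def w0_def ln_realpow)
    qed
    have "real j * ln 2 \<le> real j * 1"
      using ln_2_less_1 by (intro mult_left_mono) auto
    also have "\<dots> \<le> real j * w0"
      using w0_ge_1 by (intro mult_left_mono) auto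
    finally have w_le: "w \<le> w0 * (1 + real j)"
      unfolding w_eq by (simp add: algebra_simps)
    have w2: "w\<^sup>2 \<le> w0\<^sup>2 * (1 + real j)\<^sup>2"
      using w_le w_ge_1 by (simp only: power_mult_distrib[symmetric]) (intro power_mono, auto)
    have "ln (64 / \<gamma>) \<le> ln (192 * real I / \<gamma>)"
      using \<gamma> I_pos ratio_ge(2) by (subst ln_le_cancel_iff) auto
    then have l0: "0 \<le> ln (1 / (\<gamma> / 64))" "ln (1 / (\<gamma> / 64)) \<le> w0 * 1"
      using \<gamma> by (auto simp: w0_def)
    have "w0 * 1 \<le> w0 * (1 + real j)"
      using w0_ge_1 by (intro mult_left_mono) auto
    then have l2: "(ln (1 / (\<gamma> / 64)))\<^sup>2 \<le> w0\<^sup>2 * (1 + real j)\<^sup>2"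
      using l0 by (simp only: power_mult_distrib[symmetric]) (intro power_mono, auto)
    define W where "W = w0\<^sup>2 * (1 + real j)\<^sup>2"
    have "1 * 1 \<le> w0\<^sup>2 * (1 + real j)\<^sup>2"
      using w0_ge_1 by (intro mult_mono) (auto simp: one_le_power)
    then have W: "1 \<le> W" by (simp add: W_def)
    have eW: "e * 1 \<le> e * W" "1 * W \<le> e * W"
      using e W by (intro mult_left_mono mult_right_mono; simp)+
    \<comment> \<open>123 = 1 + 96 + 8 + 18, where 96 = 16 * 6.\<close>
    have "1 + 96 * e + ?L \<le> 123 * (e * W)"
      using w2 l2 e(1) eW unfolding W_def[symmetric] by linarith
    then have "\<nu> * (1 + 96 * e + ?L) \<le> \<nu> * (123 * (e * W))"
      using \<nu> by (intro mult_left_mono) auto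
    then show ?thesis
      using \<nu> by (simp add: W_def algebra_simps)
  qed
  finally show ?thesis
    by (simp add: \<nu>_def ennreal_leI)
qed

lemma M_le: "real (M j) \<le> 9 / \<gamma>\<^sup>2 * (Ld + 1) * (1 + real j)"
proof -
  define t where "t = 8 / \<gamma>\<^sup>2 * (Ld + real j + 1)"
  have \<gamma>2: "1 \<le> 1 / \<gamma>\<^sup>2"
    using \<gamma> by (simp add: power_le_one)
  have t: "0 \<le> t"
    using Ld_nonneg by (simp add: t_def)
  then have "real (M j) \<le> t + 1"
    by (simp add: repetitions_def t_def Ld_def of_nat_nat)
  also have "\<dots> \<le> 8 / \<gamma>\<^sup>2 * ((Ld + 1) * (1 + real j)) + 1 / \<gamma>\<^sup>2 * ((Ld + 1) * (1 + real j))"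
  proof (intro add_mono)
    have "Ld + real j + 1 \<le> (Ld + 1) * (1 + real j)"
      using Ld_nonneg by (simp add: algebra_simps)
    then show "t \<le> 8 / \<gamma>\<^sup>2 * ((Ld + 1) * (1 + real j))"
      unfolding t_def by (intro mult_left_mono) auto
    have "1 * (1 * 1) \<le> 1 / \<gamma>\<^sup>2 * ((Ld + 1) * (1 + real j))"
      using \<gamma>2 Ld_nonneg by (intro mult_mono) auto
    then show "1 \<le> 1 / \<gamma>\<^sup>2 * ((Ld + 1) * (1 + real j))" by simp
  qed
  also have "\<dots> = 9 / \<gamma>\<^sup>2 * (Ld + 1) * (1 + real j)"
    by (simp add: divide_inverse algebra_simps)
  finally show ?thesis .
qed

definition B :: "real \<Rightarrow> real" where
  "B e = 4534272 * ((Ld + 1) * (real I)\<^sup>2 * w0\<^sup>2) * (e / \<gamma> ^ 4)"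

text \<open>The fourth power of j + 1 collects one factor from the repetitions, one from the samples
  per level and two from the square of \<open>w\<close>.\<close>

lemma C_le:
  assumes e: "1 \<le> e" "truncated_cost P Q \<le> ennreal (6 * e)"
  shows "C j \<le> ennreal ((real j + 1) ^ 4 * B e)"
proof -
  let ?c = "4096 * (real I)\<^sup>2 * (1 + real j) / \<gamma>\<^sup>2 * (123 * e * w0\<^sup>2 * (1 + real j)\<^sup>2)"
  have c: "0 \<le> ?c"
    using e by auto
  have "C j \<le> ennreal (real (M j)) * ennreal ?c"
    unfolding C_def cost_repeat ennreal_of_nat_eq_real_of_nat
    by (intro mult_left_mono cost_smpl e) auto
  also have "\<dots> = ennreal (real (M j) * ?c)"
    by (rule ennreal_mult[symmetric]) (use c in auto)
  also have "\<dots> \<le> ennreal ((9 / \<gamma>\<^sup>2 * (Ld + 1) * (1 + real j)) * ?c)"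
    by (intro ennreal_leI mult_right_mono M_le c)
  also have "(9 / \<gamma>\<^sup>2 * (Ld + 1) * (1 + real j)) * ?c = (real j + 1) ^ 4 * B e"
  proof -
    have "9 / g * a * J * (4096 * i * J / g * (123 * b * J\<^sup>2)) = J ^ 4 * (4534272 * (a * i) * (b / g\<^sup>2))"
      for g a J i b :: real
      by (simp add: power2_eq_square power4_eq_xxxx)
    from this[of "\<gamma>\<^sup>2" "Ld + 1" "1 + real j" "(real I)\<^sup>2" "e * w0\<^sup>2"] show ?thesis
      by (simp add: B_def add.commute mult_ac flip: power_mult)
  qed
  finally show ?thesis .
qed

lemma I_bound: "real I \<le> 127 + 2 * ln (1 / \<gamma>)"
proof -
  obtain k where k: "I = Suc k"
    using I_pos by (cases I) auto
  have "\<gamma> / 64 < (1 / 2) ^ k"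
    using less_I k by simp
  then have "2 ^ k < 64 * (1 / \<gamma>)"
    using \<gamma> by (simp add: power_divide field_simps)
  then have "ln (2 ^ k) < ln (64 * (1 / \<gamma>))"
    using \<gamma> by (subst ln_less_cancel_iff) auto
  then have "real k * ln 2 < ln 64 + ln (1 / \<gamma>)"
    using \<gamma> by (subst (asm) ln_mult_pos) (auto simp: ln_realpow)
  moreover have "ln 64 \<le> (63::real)"
    using ln_le_minus_one[of "64::real"] by simp
  moreover have "real k * (1 / 2) \<le> real k * ln 2"
    by (intro mult_left_mono ln_2_ge_half) auto
  ultimately show ?thesis
    using k by simp
qed

lemma w0_bound: "w0 \<le> 192 + real I + ln (1 / \<gamma>)"
proof -
  have "ln (192 * real I * (1 / \<gamma>)) = ln 192 + ln (real I) + ln (1 / \<gamma>)"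
    using I_pos \<gamma> by (simp only: ln_mult_pos mult_pos_pos of_nat_0_less_iff zero_less_numeral zero_less_divide_1_iff)
  moreover have "ln 192 \<le> (191::real)"
    using ln_le_minus_one[of "192::real"] by simp
  moreover have "ln (real I) \<le> real I"
    using ln_le_minus_one[of "real I"] I_pos by simp
  ultimately show ?thesis
    by (simp add: w0_def)
qed

text \<open>Of the ten logarithms, five bound \<open>B e\<close> (one for \<open>Ld\<close>, two
  each for \<open>real I\<close> and \<open>w0\<close>), and five come from the fifth power in
  \<open>staged_cost\<close>.\<close>

lemma cost_tester:
  assumes e: "1 \<le> e" "truncated_cost P Q \<le> ennreal (6 * e)"
  defines "X \<equiv> e / \<gamma> ^ 4"
  shows "cost P (tester_prog Q \<epsilon> \<eta> \<delta>) \<le> ennreal (tester_factor * ln (exp 1 + X + 1 / \<delta>) ^ 10 * X)"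
proof -
  define lam where "lam = ln (exp 1 + X + 1 / \<delta>)"
  have g4: "\<gamma> ^ 4 \<le> \<gamma>" "0 < \<gamma> ^ 4"
    using \<gamma> power_decreasing[of 1 4 \<gamma>] by auto
  have "1 / \<gamma> \<le> 1 / \<gamma> ^ 4"
    by (rule frac_le) (use \<gamma> g4 in auto)
  also have "\<dots> \<le> X"
    unfolding X_def using e g4 by (intro divide_right_mono) auto
  finally have gX: "1 / \<gamma> \<le> X" .
  have g1: "1 \<le> 1 / \<gamma>"
    using \<gamma> by simp
  have X1: "1 \<le> X"
    using gX g1 by linarith
  have d1: "0 < 1 / \<delta>"
    using \<delta> by simp
  have S: "0 < exp 1 + X + 1 / \<delta>" "X \<le> exp 1 + X + 1 / \<delta>" "1 / \<delta> \<le> exp 1 + X + 1 / \<delta>"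
    "exp 1 \<le> exp 1 + X + 1 / \<delta>"
    using X1 d1 exp_gt_zero[of "1::real"] by linarith+
  have lam1: "1 \<le> lam"
    unfolding lam_def using S by (subst ln_ge_iff)
  have lnX: "ln X \<le> lam"
    using X1 S unfolding lam_def by (subst ln_le_cancel_iff) auto
  have "ln (1 / \<gamma>) \<le> ln X"
    using gX \<gamma> X1 by (subst ln_le_cancel_iff) auto
  then have lng: "ln (1 / \<gamma>) \<le> lam"
    using lnX by linarith
  have Ld: "Ld \<le> lam"
    using d1 S unfolding lam_def Ld_def by (subst ln_le_cancel_iff) auto
  have Il: "real I \<le> 132 * lam"
    using I_bound lng lam1 by linarith
  have w0l: "w0 \<le> 326 * lam"
    using w0_bound Il lng lam1 by linarith
  have Bnn: "0 \<le> B e"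
    using e Ld_nonneg \<gamma> by (simp add: B_def)
  have B_le: "B e \<le> cost_factor * lam ^ 5 * X"
  proof -
    have "(Ld + 1) * (real I)\<^sup>2 * w0\<^sup>2 \<le> (2 * lam) * (132 * lam)\<^sup>2 * (326 * lam)\<^sup>2"
      using Ld Ld_nonneg Il w0l w0_ge_1 lam1 by (intro mult_mono power_mono) auto
    also have "\<dots> = (2 * 132\<^sup>2 * 326\<^sup>2) * lam ^ 5"
      by (simp add: power_mult_distrib numeral_eq_Suc)
    finally have "4534272 * ((Ld + 1) * (real I)\<^sup>2 * w0\<^sup>2) * X \<le> 4534272 * ((2 * 132\<^sup>2 * 326\<^sup>2) * lam ^ 5) * X"
      using X1 by (intro mult_right_mono mult_left_mono) auto
    then show ?thesis
      by (simp add: B_def X_def cost_factor_def mult.assoc)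
  qed
  have B1: "1 \<le> 2624 * B e"
  proof -
    have "1 * 1 * 1 \<le> (Ld + 1) * (real I)\<^sup>2 * w0\<^sup>2"
      using Ld_nonneg I_pos w0_ge_1 by (intro mult_mono) (auto simp: one_le_power)
    then have "4534272 * 1 * 1 \<le> B e"
      using X1 unfolding B_def X_def by (intro mult_mono) auto
    then show ?thesis by simp
  qed
  \<comment> \<open>From stage \<kappa> on, 64 * 41 * 2^j * \<open>B e\<close> \<le> 4^j, as
    \<open>staged_cost\<close> demands.\<close>
  obtain \<kappa> where \<kappa>: "2624 * B e \<le> 2 ^ \<kappa>" "real \<kappa> \<le> 2 * ln (2624 * B e) + 1"
    using ex_power_2_between[OF B1] .
  have cf: "1 \<le> cost_factor"
    by (simp add: cost_factor_def)
  have "ln (2624 * B e) \<le> ln ((2624 * cost_factor) * (lam ^ 5 * X))"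
    using B1 B_le by (intro ln_mono) auto
  also have "\<dots> = ln (2624 * cost_factor) + (ln (lam ^ 5) + ln X)"
    using cf lam1 X1 by (subst ln_mult_pos, simp, simp, subst ln_mult_pos) auto
  also have "ln (lam ^ 5) = 5 * ln lam"
    using lam1 by (simp add: ln_realpow)
  also have "ln lam \<le> lam"
    using ln_le_minus_one[of lam] lam1 by simp
  finally have lnB: "ln (2624 * B e) \<le> ln (2624 * cost_factor) + 6 * lam"
    using lnX by simp
  have "ln (2624 * cost_factor) * 1 \<le> ln (2624 * cost_factor) * lam"
    using cf lam1 by (intro mult_left_mono) auto
  then have \<kappa>1: "real \<kappa> + 1 \<le> log_factor * lam"
    using \<kappa>(2) lnB lam1 by (simp add: log_factor_def algebra_simps)
  have "cost P (stages Q \<gamma> mid \<delta> r 0) \<le> ennreal (3 * (real \<kappa> + 1) ^ 5 * B e)" for r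
  proof (rule staged_cost[where K = "\<lambda>r j. cost P (stages Q \<gamma> mid \<delta> r j)" and C = C and \<pi> = \<pi>])
    show "cost P (stages Q \<gamma> mid \<delta> (Suc r) j) \<le> C j + \<pi> j * cost P (stages Q \<gamma> mid \<delta> r (Suc j))" for r j
      by (rule cost_stages_Suc)
    show "C j \<le> ennreal ((real j + 1) ^ 4 * B e)" for j
      by (rule C_le[OF e])
    show "\<pi> j \<le> 1" for j
      unfolding \<pi>_def by (rule measure_pmf.emeasure_le_1)
    show "64 * ((real j + 1) ^ 4 * B e) \<le> 4 ^ j" if "\<kappa> \<le> j" for j
    proof -
      have "64 * ((real j + 1) ^ 4 * B e) \<le> 64 * ((41 * 2 ^ j) * B e)"
        using Bnn by (intro mult_left_mono mult_right_mono fourth_power_le) auto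
      also have "\<dots> = 2 ^ j * (2624 * B e)"
        by simp
      also have "\<dots> \<le> 2 ^ j * 2 ^ j"
        using order.trans[OF \<kappa>(1) power_increasing[OF that]] by (intro mult_left_mono) auto
      also have "\<dots> = 4 ^ j"
        by (simp add: power_mult_distrib[symmetric])
      finally show ?thesis .
    qed
  qed (use \<pi>_cost Bnn in auto)
  then have "cost P (tester_prog Q \<epsilon> \<eta> \<delta>) \<le> ennreal (3 * (real \<kappa> + 1) ^ 5 * B e)"
    unfolding tester_prog_def \<gamma>_def[symmetric] .
  also have "\<dots> \<le> ennreal (3 * (log_factor * lam) ^ 5 * (cost_factor * lam ^ 5 * X))"
    using \<kappa>1 B_le Bnn by (intro ennreal_leI mult_mono power_mono) auto
  also have "3 * (log_factor * lam) ^ 5 * (cost_factor * lam ^ 5 * X) = tester_factor * lam ^ 10 * X"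
    by (simp add: tester_factor_def power_mult_distrib numeral_eq_Suc)
  finally show ?thesis
    by (simp add: lam_def)
qed

lemma expected_queries_tester:
  assumes "truncated_cost P Q \<le> 6 * E"
  shows "expected_queries P (alg (tester_prog Q \<epsilon> \<eta> \<delta>))
    \<le> soft_O tester_factor 10 \<delta> (ennreal (1 / (\<eta> - \<epsilon>) ^ 4) * max 1 E)"
proof (cases "E = \<infinity>")
  case True
  have g: "0 < 1 / (\<eta> - \<epsilon>) ^ 4"
    using \<epsilon> by simp
  then have "ennreal (1 / (\<eta> - \<epsilon>) ^ 4) * max 1 E = \<infinity>"
    using True by (simp add: ennreal_mult_top max_def)
  \<comment> \<open>\<open>enn2real\<close> maps infinity to 0, but the added \<open>exp 1\<close>
    keeps the logarithm positive, so the product is infinite.\<close>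
  moreover have "soft_O tester_factor 10 \<delta> \<infinity> = \<infinity>"
  proof -
    have "1 < exp (1::real)" by simp
    then have "1 < exp 1 + enn2real \<infinity> + 1 / \<delta>"
      using \<delta> by (simp add: add_strict_increasing)
    then have "0 < tester_factor * ln (exp 1 + enn2real \<infinity> + 1 / \<delta>) ^ 10"
      by (intro mult_pos_pos tester_factor_pos zero_less_power ln_gt_zero)
    moreover have "ennreal c * \<infinity> = \<infinity>" if "0 < c" for c
      using that by (simp add: ennreal_mult_top)
    ultimately show ?thesis
      unfolding soft_O_def by blast
  qed
  ultimately show ?thesis
    by simp
next
  case False
  define e where "e = max 1 (enn2real E)"
  have E: "max 1 E = ennreal e"
    using False unfolding e_def by (cases E) (auto simp: max_def ennreal_le_iff)
  have e1: "1 \<le> e"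
    by (simp add: e_def)
  have "truncated_cost P Q \<le> 6 * max 1 E"
    by (rule order.trans[OF assms]) (intro mult_left_mono, auto)
  then have t: "truncated_cost P Q \<le> ennreal (6 * e)"
    using e1 unfolding E by (simp add: ennreal_mult)
  have X: "ennreal (1 / (\<eta> - \<epsilon>) ^ 4) * max 1 E = ennreal (e / \<gamma> ^ 4)"
    using e1 \<epsilon> unfolding E by (subst ennreal_mult[symmetric]) (auto simp: \<gamma>_def)
  have X_nonneg: "0 \<le> e / \<gamma> ^ 4"
    using e1 \<gamma> by simp
  have "expected_queries P (alg (tester_prog Q \<epsilon> \<eta> \<delta>)) \<le> cost P (tester_prog Q \<epsilon> \<eta> \<delta>)"
    by (rule expected_queries_alg)
  also have "\<dots> \<le> ennreal (tester_factor * ln (exp 1 + e / \<gamma> ^ 4 + 1 / \<delta>) ^ 10 * (e / \<gamma> ^ 4))"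
    by (rule cost_tester[OF e1 t])
  also have "\<dots> = soft_O tester_factor 10 \<delta> (ennreal (e / \<gamma> ^ 4))"
    unfolding soft_O_def enn2real_ennreal[OF X_nonneg] using X_nonneg by (rule ennreal_mult'')
  finally show ?thesis
    unfolding X .
qed

end

definition tester :: "int pmf \<Rightarrow> real \<Rightarrow> real \<Rightarrow> real \<Rightarrow> algorithm" where
  "tester Q \<epsilon> \<eta> \<delta> = alg (tester_prog Q \<epsilon> \<eta> \<delta>)"

theorem theorem1:
  shows
    "(\<exists>(toltest :: int pmf \<Rightarrow> real \<Rightarrow> real \<Rightarrow> real \<Rightarrow> algorithm) (C :: real) (k :: nat).
        C > 0 \<and>
        (\<forall>(P :: int pmf) (Q :: int pmf) (\<epsilon> :: real) (\<eta> :: real) (\<delta> :: real).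
           0 < \<epsilon> \<and> \<epsilon> < \<eta> \<and> \<eta> < 1 \<and> 0 < \<delta> \<and> \<delta> < 1 \<longrightarrow>
             only_legal_queries P (toltest Q \<epsilon> \<eta> \<delta>)
           \<and> (tv_dist P Q \<le> \<epsilon> \<longrightarrow> prob_output P (toltest Q \<epsilon> \<eta> \<delta>) Accept \<ge> 1 - \<delta>)
           \<and> (tv_dist P Q \<ge> \<eta> \<longrightarrow> prob_output P (toltest Q \<epsilon> \<eta> \<delta>) Reject \<ge> 1 - \<delta>)
           \<and> expected_queries P (toltest Q \<epsilon> \<eta> \<delta>)
               \<le> soft_O C k \<delta> (ennreal (1 / (\<eta> - \<epsilon>) ^ 4) *
                    max 1 (\<integral>\<^sup>+ x. tilt (P \<diamondop> Q) x * sq_log_inv (pmf (P \<diamondop> Q) x)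
                             \<partial>measure_pmf (P \<diamondop> Q)))))
   \<and> (\<exists>(ERtoltest :: int pmf \<Rightarrow> real \<Rightarrow> real \<Rightarrow> real \<Rightarrow> algorithm) (C :: real) (k :: nat).
        C > 0 \<and>
        (\<forall>(P :: int pmf) (Q :: int pmf) (\<epsilon> :: real) (\<eta> :: real) (\<delta> :: real).
           0 < \<epsilon> \<and> \<epsilon> < \<eta> \<and> \<eta> < 1 \<and> 0 < \<delta> \<and> \<delta> < 1 \<longrightarrow>
             only_legal_queries P (ERtoltest Q \<epsilon> \<eta> \<delta>)
           \<and> (linf_dist P Q \<le> ennreal (2 * \<epsilon>)
                \<longrightarrow> prob_output P (ERtoltest Q \<epsilon> \<eta> \<delta>) Accept \<ge> 1 - \<delta>)
           \<and> (tv_dist P Q \<ge> \<eta> \<longrightarrow> prob_output P (ERtoltest Q \<epsilon> \<eta> \<delta>) Reject \<ge> 1 - \<delta>)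
           \<and> expected_queries P (ERtoltest Q \<epsilon> \<eta> \<delta>)
               \<le> soft_O C k \<delta> (ennreal (1 / (\<eta> - \<epsilon>) ^ 4) *
                    max 1 (\<integral>\<^sup>+ x. tilt Q x * min (sq_log_inv (pmf P x)) (sq_log_inv (pmf Q x))
                             \<partial>measure_pmf P))))"
proof (intro conjI exI[of _ tester] exI[of _ tester_factor] exI[of _ 10] allI impI tester_factor_pos)
  fix P Q :: "int pmf" and \<epsilon> \<eta> \<delta> :: real
  assume "0 < \<epsilon> \<and> \<epsilon> < \<eta> \<and> \<eta> < 1 \<and> 0 < \<delta> \<and> \<delta> < 1"
  then interpret testing P Q \<epsilon> \<eta> \<delta>
    by unfold_locales auto
  show "only_legal_queries P (tester Q \<epsilon> \<eta> \<delta>)" "only_legal_queries P (tester Q \<epsilon> \<eta> \<delta>)"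
    unfolding tester_def by (intro only_legal_queries_alg legal_tester)+
  show "1 - \<delta> \<le> prob_output P (tester Q \<epsilon> \<eta> \<delta>) Accept" if "tv_dist P Q \<le> \<epsilon>"
    unfolding tester_def using that by (rule tester_accept)
  show "1 - \<delta> \<le> prob_output P (tester Q \<epsilon> \<eta> \<delta>) Accept" if "linf_dist P Q \<le> ennreal (2 * \<epsilon>)"
    unfolding tester_def using that \<epsilon> by (intro tester_accept tv_dist_le_of_linf_dist) auto
  show "1 - \<delta> \<le> prob_output P (tester Q \<epsilon> \<eta> \<delta>) Reject" "1 - \<delta> \<le> prob_output P (tester Q \<epsilon> \<eta> \<delta>) Reject"
    if "\<eta> \<le> tv_dist P Q"
    unfolding tester_def using that by (simp_all add: tester_reject)
  let ?bound = "\<lambda>E. expected_queries P (tester Q \<epsilon> \<eta> \<delta>)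
    \<le> soft_O tester_factor 10 \<delta> (ennreal (1 / (\<eta> - \<epsilon>) ^ 4) * max 1 E)"
  show "?bound (\<integral>\<^sup>+ x. tilt (P \<diamondop> Q) x * sq_log_inv (pmf (P \<diamondop> Q) x) \<partial>measure_pmf (P \<diamondop> Q))"
    unfolding tester_def by (intro expected_queries_tester truncated_cost_le_mix)
  let ?E = "\<integral>\<^sup>+ x. tilt Q x * min (sq_log_inv (pmf P x)) (sq_log_inv (pmf Q x)) \<partial>measure_pmf P"
  have "1 * ?E \<le> 6 * ?E"
    by (rule mult_right_mono) simp_all
  then have "truncated_cost P Q \<le> 6 * ?E"
    using truncated_cost_le_tilt[of P Q] by simp
  then show "?bound ?E"
    unfolding tester_def by (rule expected_queries_tester)
qed

end
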